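(* Let $\mathbb{K}$ be a commutative field and let $X\subseteq\mathrm{PG}(N,\mathbb{K})$, $N>3$, be a Segrean Veronesean set of index $2$. Then $X$ is the point set of a Segre variety $\mathcal{S}_{1,2}$ (and then $N=5$), or $\mathcal{S}_{1,3}$ (and then $N=7$), or $\mathcal{S}_{2,2}$ (and then $N=8$).
   Context: A *hypo* $H$ in a $3$-dimensional projective space over $\mathbb{K}$ is the point set of a (nondegenerate) hyperbolic quadric. For $x\in H$, the tangent plane $T_x(H)$ is the unique plane through $x$ meeting $H$ in two intersecting lines through $x$. Let $X$ be a spanning point set of $\mathrm{PG}(N,\mathbb{K})$, $N>3$, and $\Xi$ a set of $3$-dimensional subspaces (hyperbolic spaces) such that for each $\xi\in\Xi$ the intersection $X(\xi)=\xi\cap X$ is a hypo in $\xi$; write $T_x(\xi)=T_x(X(\xi))$ for $x\in X(\xi)$. $X$ (with $\Xi$) is a *Segrean Veronesean set of index $2$* if: (S1) any two points of $X$ lie in at least one element of $\Xi$; (S2) if $\xi_1,\xi_2\in\Xi$ and $\xi_1\neq\xi_2$, then $\xi_1\cap\xi_2\subset X$; (S3* ) for each $x\in X$, all planes $T_x(\xi)$ with $x\in\xi\in\Xi$ are contained in a fixed $4$-dimensional subspace of $\mathrm{PG}(N,\mathbb{K})$. The Segre variety $\mathcal{S}_{m,n}$ is (up to projectivity) the image of $\mathrm{PG}(m,\mathbb{K})\times\mathrm{PG}(n,\mathbb{K})\to\mathrm{PG}((m+1)(n+1)-1,\mathbb{K})$, $((x_i)_i,(y_j)_j)\mapsto(x_iy_j)_{i,j}$.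 *)

theory Defs
  imports "HOL-Analysis.Analysis"
begin

text \<open>
  The space \<open>PG(N, K)\<close> is modelled on \<open>K^'n\<close> with \<open>CARD('n) = N + 1\<close>: projective subspaces of
  dimension \<open>d\<close> are linear subspaces of dimension \<open>d + 1\<close>, points are the linear subspaces of
  dimension 1, and a point \<open>p\<close> lies in a projective subspace \<open>U\<close> iff \<open>p \<subseteq> U\<close>.
\<close>

definition proj_subspace :: "nat \<Rightarrow> ('a::field ^ 'n) set \<Rightarrow> bool" where
  "proj_subspace d U \<longleftrightarrow> vec.subspace U \<and> vec.dim U = d + 1"

definition points :: "('a::field ^ 'n) set \<Rightarrow> ('a ^ 'n) set set" where
  "points U = {p. proj_subspace 0 p \<and> p \<subseteq> U}"

definition polar_form :: "('a::field ^ 'n \<Rightarrow> 'a) \<Rightarrow> 'a ^ 'n \<Rightarrow> 'a ^ 'n \<Rightarrow> 'a" where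
  "polar_form q u v = q (u + v) - q u - q v"

text \<open>The usual characteristic-free notion; additivity and homogeneity of the polar form are only
  required in the first argument because the form is symmetric.\<close>

definition quadratic_form_on :: "('a::field ^ 'n) set \<Rightarrow> ('a ^ 'n \<Rightarrow> 'a) \<Rightarrow> bool" where
  "quadratic_form_on U q \<longleftrightarrow>
     (\<forall>c. \<forall>u\<in>U. q (c *s u) = c ^ 2 * q u) \<and>
     (\<forall>u\<in>U. \<forall>v\<in>U. \<forall>w\<in>U. polar_form q (u + v) w = polar_form q u w + polar_form q v w) \<and>
     (\<forall>c. \<forall>u\<in>U. \<forall>w\<in>U. polar_form q (c *s u) w = c * polar_form q u w)"

definition nondegenerate_on :: "('a::field ^ 'n) set \<Rightarrow> ('a ^ 'n \<Rightarrow> 'a) \<Rightarrow> bool" where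
  "nondegenerate_on U q \<longleftrightarrow>
     (\<forall>u\<in>U. q u = 0 \<and> (\<forall>w\<in>U. polar_form q u w = 0) \<longrightarrow> u = 0)"

definition quadric :: "('a::field ^ 'n) set \<Rightarrow> ('a ^ 'n \<Rightarrow> 'a) \<Rightarrow> ('a ^ 'n) set set" where
  "quadric U q = {p \<in> points U. \<forall>v\<in>p. q v = 0}"

text \<open>A nondegenerate quadric of a 3-dimensional projective space is hyperbolic if it has the
  maximal possible Witt index 2, i.e. if it contains a line.\<close>

definition hypo :: "('a::field ^ 'n) set \<Rightarrow> ('a ^ 'n) set set \<Rightarrow> bool" where
  "hypo \<xi> H \<longleftrightarrow> proj_subspace 3 \<xi> \<and>
     (\<exists>q. quadratic_form_on \<xi> q \<and> nondegenerate_on \<xi> q \<and> H = quadric \<xi> q \<and>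
        (\<exists>L. proj_subspace 1 L \<and> points L \<subseteq> H))"

definition tangent_plane :: "('a::field ^ 'n) set set \<Rightarrow> ('a ^ 'n) set \<Rightarrow> ('a ^ 'n) set" where
  "tangent_plane H x = (THE T. proj_subspace 2 T \<and> x \<subseteq> T \<and>
     (\<exists>L M. proj_subspace 1 L \<and> proj_subspace 1 M \<and> L \<noteq> M \<and> x \<subseteq> L \<and> x \<subseteq> M \<and>
        points T \<inter> H = points L \<union> points M))"

definition segrean_veronesean_set ::
    "('a::field ^ 'n) set set \<Rightarrow> ('a ^ 'n) set set \<Rightarrow> bool" where
  "segrean_veronesean_set X \<Xi> \<longleftrightarrow>
     X \<subseteq> points UNIV \<and> vec.span (\<Union>X) = UNIV \<and>
     (\<forall>\<xi>\<in>\<Xi>. hypo \<xi> (points \<xi> \<inter> X)) \<and>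
     (\<forall>x\<in>X. \<forall>y\<in>X. \<exists>\<xi>\<in>\<Xi>. x \<subseteq> \<xi> \<and> y \<subseteq> \<xi>) \<and>
     (\<forall>\<xi>\<^sub>1\<in>\<Xi>. \<forall>\<xi>\<^sub>2\<in>\<Xi>. \<xi>\<^sub>1 \<noteq> \<xi>\<^sub>2 \<longrightarrow> points (\<xi>\<^sub>1 \<inter> \<xi>\<^sub>2) \<subseteq> X) \<and>
     (\<forall>x\<in>X. \<exists>S. proj_subspace 4 S \<and>
        (\<forall>\<xi>\<in>\<Xi>. x \<subseteq> \<xi> \<longrightarrow> tangent_plane (points \<xi> \<inter> X) x \<subseteq> S))"

definition segre_map :: "'a::field ^ 'm \<Rightarrow> 'a ^ 'k \<Rightarrow> 'a ^ ('m \<times> 'k)" where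
  "segre_map x y = (\<chi> p. x $ fst p * y $ snd p)"

definition standard_segre :: "('a::field ^ ('m::finite \<times> 'k::finite)) set set" where
  "standard_segre = {vec.span {segre_map x y} | (x :: 'a ^ 'm) (y :: 'a ^ 'k). x \<noteq> 0 \<and> y \<noteq> 0}"

text \<open>The type arguments give the numbers of homogeneous coordinates, not the projective dimensions:
  the variety \<open>S_{m,n}\<close> is obtained for \<open>CARD('m) = m + 1\<close> and \<open>CARD('k) = n + 1\<close>.\<close>

definition is_segre_variety ::
    "'m::finite itself \<Rightarrow> 'k::finite itself \<Rightarrow> ('a::field ^ 'n) set set \<Rightarrow> bool" where
  "is_segre_variety _ _ X \<longleftrightarrow>
     (\<exists>f :: 'a ^ ('m \<times> 'k) \<Rightarrow> 'a ^ 'n. Vector_Spaces.linear (*s) (*s) f \<and> bij f \<and>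
        X = (\<lambda>p. f ` p) ` standard_segre)"

end

theory Submission
  imports Defs
begin

text \<open>
  Write \<open>Z\<close> for the cone of vectors in points of \<open>X\<close>, and call points collinear if their span lies in \<open>Z\<close>.
  Two non-collinear points lie in a unique quadric, so collinearity is transitive among the neighbours
  of a point \<open>x\<close>; the singular lines through \<open>x\<close> fall into classes spanning maximal singular subspaces,
  and up to four classes are independent modulo \<open>x\<close>. The bound on the tangent space shows that if one
  point has exactly two classes then so has every point, and that otherwise every class is a single line.

  In the latter case the lines through \<open>x\<close> form an arc in its tangent space \<open>T\<^sub>x\<close>. Then \<open>T\<^sub>x\<close> and
  \<open>T\<^sub>y\<close> span the whole 8-dimensional space for non-collinear \<open>x\<close>, \<open>y\<close>. Moving \<open>y\<close> along a line towards a
  neighbour \<open>u\<close> of \<open>x\<close>, each quadric on two lines through \<open>x\<close> yields a point collinear with \<open>y + B u\<close>, whose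
  coordinates are injective rational functions of degree at most 2 in \<open>B\<close>; ten lines through \<open>x\<close> make this
  impossible.

  If there are two classes \<open>A\<close>, \<open>B\<close> at \<open>x\<close>, completing \<open>a \<in> A\<close>, \<open>b \<in> B\<close> to a quadrangle is bilinear, and \<open>Z\<close>
  consists of the images of the pure tensors under a linear map \<open>A \<otimes> B \<rightarrow> K\<^sup>n\<close>. It is injective because
  every tensor in question has rank at most 3 and a sum of two independent pure tensors is never in \<open>Z\<close>.
  Finally \<open>dim A + dim B \<le> 6\<close> leaves the three Segre varieties.
\<close>

section \<open>Hyperbolic bases and collinearity\<close>

text \<open>Most incidence arguments rest on one device: the sum of two non-collinear vectors of
  \<open>Z\<close> is not in \<open>Z\<close>, so it lies in at most one quadric space. Uniqueness
  of that space, the position of common neighbours and the independence of four classes all come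
  from exhibiting such a sum in two spaces. No dimension count refutes the arc case: tangent spaces
  of dimension 5 that meet in dimension 2 span dimension 8 without contradiction. The obstruction is
  algebraic. Modulo \<open>T\<^sub>x\<close>, the tangent space at \<open>y + B u\<close> is
  governed by a 2 by 2 matrix \<open>1 + B a\<close>, and Cramer's rule is the source of the degree
  2. A function of this kind that is injective and has no poles on the whole field is linear, or in
  characteristic 2 a function of \<open>B\<^sup>2\<close>, and the pairs of lines through
  \<open>x\<close> cannot all comply. The argument counts roots, so small fields must be excluded
  beforehand; six neighbours of a point already provide five scalars. The bound 6 is 5 + 1, since
  the two classes share only the multiples of \<open>x\<close>; hence one of them has dimension at
  most 3, which limits the tensor rank.\<close>

definition frame :: "('a::field ^ 'n) set \<Rightarrow> ('a ^ 'n) set \<Rightarrow> 'a ^ 'n \<Rightarrow> 'a ^ 'n \<Rightarrow> 'a ^ 'n \<Rightarrow> 'a ^ 'n \<Rightarrow> bool" where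
  "frame Z \<xi> x u v y \<longleftrightarrow>
     (\<forall>a b c d. a *s x + b *s u + c *s v + d *s y = 0 \<longrightarrow> a = 0 \<and> b = 0 \<and> c = 0 \<and> d = 0) \<and>
     (\<forall>w. w \<in> \<xi> \<longleftrightarrow> (\<exists>a b c d. w = a *s x + b *s u + c *s v + d *s y)) \<and>
     (\<forall>a b c d. a *s x + b *s u + c *s v + d *s y \<in> Z \<longleftrightarrow> a * d = b * c)"

lemma frameI:
  assumes "\<And>a b c d. a *s x + b *s u + c *s v + d *s y = 0 \<Longrightarrow> a = 0 \<and> b = 0 \<and> c = 0 \<and> d = 0"
    and "\<And>w. w \<in> \<xi> \<Longrightarrow> \<exists>a b c d. w = a *s x + b *s u + c *s v + d *s y"
    and "\<And>a b c d. a *s x + b *s u + c *s v + d *s y \<in> \<xi>"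
    and "\<And>a b c d. a *s x + b *s u + c *s v + d *s y \<in> Z \<longleftrightarrow> a * d = b * c"
  shows "frame Z \<xi> x u v y"
proof -
  have "w \<in> \<xi> \<longleftrightarrow> (\<exists>a b c d. w = a *s x + b *s u + c *s v + d *s y)" for w
    using assms(2)[of w] assms(3) by auto
  then show ?thesis unfolding frame_def using assms(1,4) by (intro conjI allI impI) simp_all
qed

lemma frame_indep:
  assumes "frame Z \<xi> x u v y" and "a *s x + b *s u + c *s v + d *s y = 0"
  shows "a = 0 \<and> b = 0 \<and> c = 0 \<and> d = 0"
  using assms unfolding frame_def by blast

lemma frame_mem:
  assumes "frame Z \<xi> x u v y"
  shows "a *s x + b *s u + c *s v + d *s y \<in> \<xi>"
  using assms unfolding frame_def by blast

lemma frame_ex: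
  assumes "frame Z \<xi> x u v y" and "w \<in> \<xi>"
  obtains a b c d where "w = a *s x + b *s u + c *s v + d *s y"
proof -
  have "\<exists>a b c d. w = a *s x + b *s u + c *s v + d *s y"
    using assms unfolding frame_def by simp
  then show thesis using that by blast
qed

lemma frame_Z:
  assumes "frame Z \<xi> x u v y"
  shows "a *s x + b *s u + c *s v + d *s y \<in> Z \<longleftrightarrow> a * d = b * c"
  using assms unfolding frame_def by blast

text \<open>The quadric \<open>a d = b c\<close> is a grid on which \<open>x\<close>,
  \<open>u\<close>, \<open>y\<close>, \<open>v\<close> form a quadrangle in this cyclic order, with
  opposite pairs \<open>x\<close>, \<open>y\<close> and \<open>u\<close>, \<open>v\<close>. This
  exchange and \<open>frame_rot\<close> generate its dihedral group of order 8.\<close>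

lemma frame_swap:
  assumes "frame Z \<xi> x u v y" shows "frame Z \<xi> x v u y"
proof (rule frameI)
  have e: "a *s x + b *s v + c *s u + d *s y = a *s x + c *s u + b *s v + d *s y" for a b c d
    by (simp add: algebra_simps)
  show "a = 0 \<and> b = 0 \<and> c = 0 \<and> d = 0" if "a *s x + b *s v + c *s u + d *s y = 0" for a b c d
    using frame_indep[OF assms] that unfolding e by blast
  show "\<exists>a b c d. w = a *s x + b *s v + c *s u + d *s y" if "w \<in> \<xi>" for w
  proof -
    from frame_ex[OF assms that] obtain a b c d where "w = a *s x + b *s u + c *s v + d *s y" .
    then have "w = a *s x + c *s v + b *s u + d *s y" by (simp add: algebra_simps)
    then show ?thesis by blast
  qed
  show "a *s x + b *s v + c *s u + d *s y \<in> \<xi>" for a b c d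
    unfolding e by (rule frame_mem[OF assms])
  show "a *s x + b *s v + c *s u + d *s y \<in> Z \<longleftrightarrow> a * d = b * c" for a b c d
    unfolding e frame_Z[OF assms] by (simp add: mult.commute)
qed

lemma frame_rot:
  assumes "frame Z \<xi> x u v y" shows "frame Z \<xi> u x y v"
proof (rule frameI)
  have e: "a *s u + b *s x + c *s y + d *s v = b *s x + a *s u + d *s v + c *s y" for a b c d
    by (simp add: algebra_simps)
  show "a = 0 \<and> b = 0 \<and> c = 0 \<and> d = 0" if "a *s u + b *s x + c *s y + d *s v = 0" for a b c d
    using frame_indep[OF assms] that unfolding e by blast
  show "\<exists>a b c d. w = a *s u + b *s x + c *s y + d *s v" if "w \<in> \<xi>" for w
  proof -
    from frame_ex[OF assms that] obtain a b c d where "w = a *s x + b *s u + c *s v + d *s y" .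
    then have "w = b *s u + a *s x + d *s y + c *s v" by (simp add: algebra_simps)
    then show ?thesis by blast
  qed
  show "a *s u + b *s x + c *s y + d *s v \<in> \<xi>" for a b c d
    unfolding e by (rule frame_mem[OF assms])
  show "a *s u + b *s x + c *s y + d *s v \<in> Z \<longleftrightarrow> a * d = b * c" for a b c d
    unfolding e frame_Z[OF assms] by (rule eq_commute)
qed

lemma frame_rev:
  assumes "frame Z \<xi> x u v y" shows "frame Z \<xi> y u v x"
  using frame_rot[OF frame_swap[OF frame_rot[OF assms]]] frame_swap by blast

text \<open>Replaces the line \<open>x v\<close> by another line of its ruling, the one joining
  corresponding points of \<open>x u\<close> and \<open>v y\<close>. On coordinate matrices this is
  a column operation, which preserves \<open>a d - b c\<close>.\<close>

lemma frame_shear: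
  fixes x u v y :: "'a::field ^ 'n"
  assumes "frame Z \<xi> x u v y" shows "frame Z \<xi> (x + k *s u) u (v + k *s y) y"
proof (rule frameI)
  have e: "a *s (x + k *s u) + b *s u + c *s (v + k *s y) + d *s y
      = a *s x + (b + k * a) *s u + c *s v + (d + k * c) *s y" for a b c d
    by (simp add: vec_eq_iff algebra_simps)
  show "a = 0 \<and> b = 0 \<and> c = 0 \<and> d = 0" if "a *s (x + k *s u) + b *s u + c *s (v + k *s y) + d *s y = 0" for a b c d
    using frame_indep[OF assms that[unfolded e]] by (elim conjE) simp
  show "\<exists>a b c d. w = a *s (x + k *s u) + b *s u + c *s (v + k *s y) + d *s y" if "w \<in> \<xi>" for w
  proof -
    from frame_ex[OF assms that] obtain a b c d where "w = a *s x + b *s u + c *s v + d *s y" .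
    then have "w = a *s (x + k *s u) + (b - k * a) *s u + c *s (v + k *s y) + (d - k * c) *s y"
      using e[of a "b - k * a" c "d - k * c"] by simp
    then show ?thesis by blast
  qed
  show "a *s (x + k *s u) + b *s u + c *s (v + k *s y) + d *s y \<in> \<xi>" for a b c d
    unfolding e by (rule frame_mem[OF assms])
  show "a *s (x + k *s u) + b *s u + c *s (v + k *s y) + d *s y \<in> Z \<longleftrightarrow> a * d = b * c" for a b c d
    unfolding e frame_Z[OF assms] by (simp add: algebra_simps)
qed

lemma frame_scale:
  fixes x u v y :: "'a::field ^ 'n"
  assumes "frame Z \<xi> x u v y" "k \<noteq> 0" shows "frame Z \<xi> (k *s x) (k *s u) v y"
proof (rule frameI)
  have e: "a *s (k *s x) + b *s (k *s u) + c *s v + d *s y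
      = (a * k) *s x + (b * k) *s u + c *s v + d *s y" for a b c d
    by (simp add: vec_eq_iff algebra_simps)
  show "a = 0 \<and> b = 0 \<and> c = 0 \<and> d = 0" if "a *s (k *s x) + b *s (k *s u) + c *s v + d *s y = 0" for a b c d
    using frame_indep[OF assms(1) that[unfolded e]] assms(2) by simp
  show "\<exists>a b c d. w = a *s (k *s x) + b *s (k *s u) + c *s v + d *s y" if "w \<in> \<xi>" for w
  proof -
    from frame_ex[OF assms(1) that] obtain a b c d where "w = a *s x + b *s u + c *s v + d *s y" .
    then have "w = (a / k) *s (k *s x) + (b / k) *s (k *s u) + c *s v + d *s y"
      unfolding e using assms(2) by simp
    then show ?thesis by blast
  qed
  show "a *s (k *s x) + b *s (k *s u) + c *s v + d *s y \<in> \<xi>" for a b c d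
    unfolding e by (rule frame_mem[OF assms(1)])
  show "a *s (k *s x) + b *s (k *s u) + c *s v + d *s y \<in> Z \<longleftrightarrow> a * d = b * c" for a b c d
    unfolding e frame_Z[OF assms(1)] using assms(2) by (simp add: algebra_simps)
qed

text \<open>One shear in each ruling and a scaling move \<open>x\<close> to any point of the quadric
  with \<open>a\<close> nonzero, that is, to any point not collinear with \<open>y\<close>. Both
  shears leave \<open>y\<close> in place.\<close>

lemma frame_corner:
  fixes x u v y z :: "'a::field ^ 'n"
  assumes f: "frame Z \<xi> x u v y" and z: "z = a *s x + b *s u + c *s v + d *s y" "a \<noteq> 0" "z \<in> Z"
  obtains u' v' where "frame Z \<xi> z u' v' y"
proof -
  have ad: "a * d = b * c" using z(1,3) frame_Z[OF f, of a b c d] by simp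
  have f1: "frame Z \<xi> (x + (b/a) *s u) u (v + (b/a) *s y) y" by (rule frame_shear[OF f])
  have f2: "frame Z \<xi> (x + (b/a) *s u + (c/a) *s (v + (b/a) *s y)) (v + (b/a) *s y) (u + (c/a) *s y) y"
    by (rule frame_shear[OF frame_swap[OF f1]])
  have f3: "frame Z \<xi> (a *s (x + (b/a) *s u + (c/a) *s (v + (b/a) *s y))) (a *s (v + (b/a) *s y)) (u + (c/a) *s y) y"
    by (rule frame_scale[OF f2 z(2)])
  have d: "d = b * c / a" using ad z(2) by (simp add: field_simps)
  have "a *s (x + (b/a) *s u + (c/a) *s (v + (b/a) *s y)) = z"
    unfolding z(1) d using z(2) by (simp add: vec_eq_iff distrib_left)
  with f3 have "frame Z \<xi> z (a *s (v + (b/a) *s y)) (u + (c/a) *s y) y" by simp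
  then show thesis by (rule that)
qed

section \<open>Collinearity of vectors\<close>

definition coll :: "('a::field ^ 'n) set \<Rightarrow> 'a ^ 'n \<Rightarrow> 'a ^ 'n \<Rightarrow> bool" where
  "coll Z u v \<longleftrightarrow> (\<forall>a b. a *s u + b *s v \<in> Z)"

lemma coll_sym: "coll Z u v \<Longrightarrow> coll Z v u"
  unfolding coll_def by (metis add.commute)

lemma coll_D: "coll Z u v \<Longrightarrow> a *s u + b *s v \<in> Z"
  unfolding coll_def by blast

lemma coll_left: "coll Z u v \<Longrightarrow> u \<in> Z"
  using coll_D[of Z u v 1 0] by simp

lemma coll_right: "coll Z u v \<Longrightarrow> v \<in> Z"
  using coll_D[of Z u v 0 1] by simp

lemma coll_lin:
  fixes u v :: "'a::field ^ 'n"
  assumes "coll Z u v" shows "coll Z (a *s u + b *s v) (c *s u + d *s v)"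
  unfolding coll_def
proof (intro allI)
  fix p q
  have "p *s (a *s u + b *s v) + q *s (c *s u + d *s v) = (p * a + q * c) *s u + (p * b + q * d) *s v"
    by (simp add: vec_eq_iff algebra_simps)
  with coll_D[OF assms] show "p *s (a *s u + b *s v) + q *s (c *s u + d *s v) \<in> Z" by metis
qed

lemma coll_lin_right: "coll Z u v \<Longrightarrow> coll Z u (c *s u + d *s v)"
  using coll_lin[of Z u v 1 0 c d] by simp

lemma coll_scale_right: "coll Z u v \<Longrightarrow> coll Z u (d *s v)"
  using coll_lin[of Z u v 1 0 0 d] by simp

lemma coll_unscale_right:
  assumes "coll Z u (d *s v)" "d \<noteq> 0" shows "coll Z u v"
  using coll_scale_right[OF assms(1), of "inverse d"] assms(2) by (simp add: vec_eq_iff)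

text \<open>The right-hand side is conjugacy for the polar form of \<open>a d - b c\<close>: two
  singular vectors span a singular line exactly if they are conjugate.\<close>

lemma frame_coll_iff:
  fixes x u v y :: "'a::field ^ 'n"
  assumes f: "frame Z \<xi> x u v y" and "a * d = b * c" "a' * d' = b' * c'"
  shows "coll Z (a *s x + b *s u + c *s v + d *s y) (a' *s x + b' *s u + c' *s v + d' *s y)
     \<longleftrightarrow> a * d' + d * a' = b * c' + c * b'"
proof -
  have e: "p *s (a *s x + b *s u + c *s v + d *s y) + q *s (a' *s x + b' *s u + c' *s v + d' *s y)
     = (p * a + q * a') *s x + (p * b + q * b') *s u + (p * c + q * c') *s v + (p * d + q * d') *s y" for p q
    by (simp add: vec_eq_iff algebra_simps)
  have r: "(p * a + q * a') * (p * d + q * d') = (p * b + q * b') * (p * c + q * c')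
      \<longleftrightarrow> p * q * (a * d' + d * a' - (b * c' + c * b')) = 0" for p q
  proof -
    have "(p * a + q * a') * (p * d + q * d') - (p * b + q * b') * (p * c + q * c')
      = p * q * (a * d' + d * a' - (b * c' + c * b')) + p * p * (a * d - b * c) + q * q * (a' * d' - b' * c')"
      by (simp add: algebra_simps)
    then have "(p * a + q * a') * (p * d + q * d') - (p * b + q * b') * (p * c + q * c')
      = p * q * (a * d' + d * a' - (b * c' + c * b'))" using assms(2,3) by simp
    then show ?thesis unfolding eq_iff_diff_eq_0[of "(p * a + q * a') * (p * d + q * d')"] by simp
  qed
  have "coll Z (a *s x + b *s u + c *s v + d *s y) (a' *s x + b' *s u + c' *s v + d' *s y)
     \<longleftrightarrow> (\<forall>p q. p * q * (a * d' + d * a' - (b * c' + c * b')) = 0)"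
    unfolding coll_def e frame_Z[OF f] r ..
  also have "\<dots> \<longleftrightarrow> a * d' + d * a' - (b * c' + c * b') = 0"
  proof
    assume "\<forall>p q. p * q * (a * d' + d * a' - (b * c' + c * b')) = 0"
    then have "1 * 1 * (a * d' + d * a' - (b * c' + c * b')) = 0" by blast
    then show "a * d' + d * a' - (b * c' + c * b') = 0" by simp
  qed simp
  finally show ?thesis by simp
qed

lemma frame_vertices:
  fixes x u v y :: "'a::field ^ 'n"
  assumes f: "frame Z \<xi> x u v y"
  shows "x \<in> \<xi>" "u \<in> \<xi>" "v \<in> \<xi>" "y \<in> \<xi>" "x \<in> Z" "u \<in> Z" "v \<in> Z" "y \<in> Z"
    "x \<noteq> 0" "u \<noteq> 0" "v \<noteq> 0" "y \<noteq> 0"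
    "coll Z x u" "coll Z x v" "coll Z u y" "coll Z v y" "\<not> coll Z x y" "\<not> coll Z u v"
proof -
  note m = frame_mem[OF f] and z = frame_Z[OF f] and i = frame_indep[OF f] and c = frame_coll_iff[OF f]
  show "x \<in> \<xi>" using m[of 1 0 0 0] by simp
  show "u \<in> \<xi>" using m[of 0 1 0 0] by simp
  show "v \<in> \<xi>" using m[of 0 0 1 0] by simp
  show "y \<in> \<xi>" using m[of 0 0 0 1] by simp
  show "x \<in> Z" using z[of 1 0 0 0] by simp
  show "u \<in> Z" using z[of 0 1 0 0] by simp
  show "v \<in> Z" using z[of 0 0 1 0] by simp
  show "y \<in> Z" using z[of 0 0 0 1] by simp
  show "x \<noteq> 0" using i[of 1 0 0 0] by auto
  show "u \<noteq> 0" using i[of 0 1 0 0] by auto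
  show "v \<noteq> 0" using i[of 0 0 1 0] by auto
  show "y \<noteq> 0" using i[of 0 0 0 1] by auto
  show "coll Z x u" using c[of 1 0 0 0 0 0 1 0] by simp
  show "coll Z x v" using c[of 1 0 0 0 0 0 0 1] by simp
  show "coll Z u y" using c[of 0 0 1 0 0 1 0 0] by simp
  show "coll Z v y" using c[of 0 0 0 1 0 1 0 0] by simp
  show "\<not> coll Z x y" using c[of 1 0 0 0 0 1 0 0] by simp
  show "\<not> coll Z u v" using c[of 0 0 1 0 0 0 0 1] by simp
qed

lemma frame_first_coll:
  fixes x u v y :: "'a::field ^ 'n"
  assumes f: "frame Z \<xi> x u v y" and "a * d = b * c"
  shows "coll Z x (a *s x + b *s u + c *s v + d *s y) \<longleftrightarrow> d = 0"
  using frame_coll_iff[OF f _ assms(2), of 1 0 0 0] by simp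

lemma frame_last_coll:
  fixes x u v y :: "'a::field ^ 'n"
  assumes f: "frame Z \<xi> x u v y" and "a * d = b * c"
  shows "coll Z y (a *s x + b *s u + c *s v + d *s y) \<longleftrightarrow> a = 0"
  using frame_coll_iff[OF f _ assms(2), of 0 1 0 0] by simp

section \<open>Cones whose vectors are pairwise joined by hyperbolic spaces\<close>

locale hyperbolic_cone =
  fixes Z :: "('a::field ^ 'n) set" and \<Xi> :: "('a ^ 'n) set set"
  assumes frame_exists: "\<xi> \<in> \<Xi> \<Longrightarrow> \<exists>x u v y. frame Z \<xi> x u v y"
    and join: "x \<in> Z \<Longrightarrow> y \<in> Z \<Longrightarrow> \<exists>\<xi>\<in>\<Xi>. x \<in> \<xi> \<and> y \<in> \<xi>"
    and meet: "\<xi> \<in> \<Xi> \<Longrightarrow> \<xi>' \<in> \<Xi> \<Longrightarrow> \<xi> \<noteq> \<xi>' \<Longrightarrow> w \<in> \<xi> \<Longrightarrow> w \<in> \<xi>' \<Longrightarrow> w \<in> Z"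
begin

abbreviation col (infix "\<frown>" 50) where "u \<frown> v \<equiv> coll Z u v"

lemma mem_lin:
  assumes "\<xi> \<in> \<Xi>" "u \<in> \<xi>" "v \<in> \<xi>"
  shows "a *s u + b *s v \<in> \<xi>"
proof -
  from frame_exists[OF assms(1)] obtain x p q y where f: "frame Z \<xi> x p q y" by blast
  from frame_ex[OF f assms(2)] obtain a1 b1 c1 d1 where u: "u = a1 *s x + b1 *s p + c1 *s q + d1 *s y" .
  from frame_ex[OF f assms(3)] obtain a2 b2 c2 d2 where v: "v = a2 *s x + b2 *s p + c2 *s q + d2 *s y" .
  have e: "a *s u + b *s v = (a * a1 + b * a2) *s x + (a * b1 + b * b2) *s p + (a * c1 + b * c2) *s q + (a * d1 + b * d2) *s y"
    unfolding u v by (simp add: vec_eq_iff algebra_simps)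
  show ?thesis unfolding e by (rule frame_mem[OF f])
qed

lemma mem_scale: "\<xi> \<in> \<Xi> \<Longrightarrow> u \<in> \<xi> \<Longrightarrow> a *s u \<in> \<xi>"
  using mem_lin[of \<xi> u u a 0] by simp

lemma Z_scale: assumes "x \<in> Z" shows "a *s x \<in> Z"
proof -
  from join[OF assms assms] obtain \<xi> where \<xi>: "\<xi> \<in> \<Xi>" "x \<in> \<xi>" by blast
  from frame_exists[OF \<xi>(1)] obtain x' p q y where f: "frame Z \<xi> x' p q y" by blast
  from frame_ex[OF f \<xi>(2)] obtain a1 b1 c1 d1 where u: "x = a1 *s x' + b1 *s p + c1 *s q + d1 *s y" .
  have "a *s x = (a * a1) *s x' + (a * b1) *s p + (a * c1) *s q + (a * d1) *s y"
    unfolding u by (simp add: vec_eq_iff algebra_simps)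
  moreover have "a1 * d1 = b1 * c1" using assms frame_Z[OF f] unfolding u by simp
  ultimately show ?thesis using frame_Z[OF f, of "a * a1" "a * b1" "a * c1" "a * d1"] by simp
qed

lemma coll_zero: "x \<in> Z \<Longrightarrow> x \<frown> 0"
  unfolding coll_def by (simp add: Z_scale)

lemma coll_self: assumes "x \<in> Z" shows "x \<frown> k *s x"
proof -
  have e: "a *s x + b *s (k *s x) = (a + b * k) *s x" for a b by (simp add: vec_eq_iff algebra_simps)
  show ?thesis unfolding coll_def e using Z_scale[OF assms] by blast
qed

lemma coll_lin_mixed:
  assumes "x \<frown> u" shows "u \<frown> a *s x + b *s u"
  using coll_lin[OF assms, of 0 1 a b] by simp

text \<open>A line with three points on a quadric lies on it: the form at \<open>a u + b v\<close>
  reduces to \<open>a b\<close> times the polar form.\<close>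

lemma coll_of_sum:
  assumes "u \<in> Z" "v \<in> Z" "a *s u + b *s v \<in> Z" "a \<noteq> 0" "b \<noteq> 0"
  shows "u \<frown> v"
proof -
  from join[OF assms(1,2)] obtain \<xi> where \<xi>: "\<xi> \<in> \<Xi>" "u \<in> \<xi>" "v \<in> \<xi>" by blast
  from frame_exists[OF \<xi>(1)] obtain x p q y where f: "frame Z \<xi> x p q y" by blast
  from frame_ex[OF f \<xi>(2)] obtain a1 b1 c1 d1 where u: "u = a1 *s x + b1 *s p + c1 *s q + d1 *s y" .
  from frame_ex[OF f \<xi>(3)] obtain a2 b2 c2 d2 where v: "v = a2 *s x + b2 *s p + c2 *s q + d2 *s y" .
  have s: "a *s u + b *s v = (a * a1 + b * a2) *s x + (a * b1 + b * b2) *s p + (a * c1 + b * c2) *s q + (a * d1 + b * d2) *s y"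
    unfolding u v by (simp add: vec_eq_iff algebra_simps)
  have u1: "a1 * d1 = b1 * c1" using assms(1) frame_Z[OF f] unfolding u by simp
  have v1: "a2 * d2 = b2 * c2" using assms(2) frame_Z[OF f] unfolding v by simp
  have s1: "(a * a1 + b * a2) * (a * d1 + b * d2) = (a * b1 + b * b2) * (a * c1 + b * c2)"
    using assms(3) unfolding s frame_Z[OF f] .
  have "a * b * (a1 * d2 + d1 * a2 - (b1 * c2 + c1 * b2)) =
    (a * a1 + b * a2) * (a * d1 + b * d2) - (a * b1 + b * b2) * (a * c1 + b * c2)
    - a * a * (a1 * d1 - b1 * c1) - b * b * (a2 * d2 - b2 * c2)"
    by (simp add: algebra_simps)
  then have "a * b * (a1 * d2 + d1 * a2 - (b1 * c2 + c1 * b2)) = 0" unfolding u1 v1 s1 by simp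
  then have "a1 * d2 + d1 * a2 = b1 * c2 + c1 * b2" using assms(4,5) by simp
  then show ?thesis unfolding u v using frame_coll_iff[OF f u1 v1] by simp
qed

lemma sum_notin:
  assumes "u \<in> Z" "v \<in> Z" "\<not> u \<frown> v" "a \<noteq> 0" "b \<noteq> 0" shows "a *s u + b *s v \<notin> Z"
  using coll_of_sum[OF assms(1,2)] assms(3-) by blast

lemma space_unique:
  assumes "u \<in> Z" "v \<in> Z" "\<not> u \<frown> v" "\<xi> \<in> \<Xi>" "\<xi>' \<in> \<Xi>" "u \<in> \<xi>" "v \<in> \<xi>" "u \<in> \<xi>'" "v \<in> \<xi>'"
  shows "\<xi> = \<xi>'"
proof (rule ccontr)
  assume "\<xi> \<noteq> \<xi>'"
  from meet[OF assms(4,5) this mem_lin[OF assms(4,6,7)] mem_lin[OF assms(5,8,9)]]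
  have "1 *s u + 1 *s v \<in> Z" .
  with sum_notin[OF assms(1-3), of 1 1] show False by simp
qed

text \<open>The vectors \<open>v + u\<close> and \<open>w - u\<close> are in \<open>Z\<close>, and
  their sum \<open>v + w\<close> is not. A space through both therefore meets \<open>\<xi>\<close>
  outside \<open>Z\<close> and coincides with it.\<close>

lemma nbr_mem:
  assumes "u \<frown> v" "u \<frown> w" "\<not> v \<frown> w" "\<xi> \<in> \<Xi>" "v \<in> \<xi>" "w \<in> \<xi>"
  shows "u \<in> \<xi>"
proof -
  have vz: "v \<in> Z" "w \<in> Z" using assms(1,2) coll_right by blast+
  have p: "v + u \<in> Z" "w - u \<in> Z"
    using coll_D[OF assms(1), of 1 1] coll_D[OF assms(2), of "-1" 1] by (simp_all add: add.commute)
  from join[OF p] obtain \<eta> where \<eta>: "\<eta> \<in> \<Xi>" "v + u \<in> \<eta>" "w - u \<in> \<eta>" by blast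
  have "v + w \<in> \<eta>" using mem_lin[OF \<eta>, of 1 1] by simp
  moreover have "v + w \<in> \<xi>" using mem_lin[OF assms(4-6), of 1 1] by simp
  moreover have "v + w \<notin> Z" using sum_notin[OF vz assms(3), of 1 1] by simp
  ultimately have "\<eta> = \<xi>" using meet[OF \<eta>(1) assms(4)] by blast
  then have "1 *s (v + u) + (-1) *s v \<in> \<xi>" using mem_lin[OF assms(4) _ assms(5)] \<eta>(2) by blast
  then show ?thesis by simp
qed

text \<open>The symmetries of the quadrangle bring a nonzero coordinate of \<open>z\<close> to the
  first place, where \<open>frame_corner\<close> applies.\<close>

lemma frame_at:
  assumes "\<xi> \<in> \<Xi>" "z \<in> Z" "z \<in> \<xi>" "z \<noteq> 0"
  obtains p q r where "frame Z \<xi> z p q r"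
proof -
  from frame_exists[OF assms(1)] obtain x p q y where f: "frame Z \<xi> x p q y" by blast
  from frame_ex[OF f assms(3)] obtain a b c d where e: "z = a *s x + b *s p + c *s q + d *s y" .
  have "a \<noteq> 0 \<or> b \<noteq> 0 \<or> c \<noteq> 0 \<or> d \<noteq> 0" using assms(4) e by auto
  then consider "a \<noteq> 0" | "b \<noteq> 0" | "c \<noteq> 0" | "d \<noteq> 0" by blast
  then show ?thesis
  proof cases
    case 1
    show ?thesis by (rule frame_corner[OF f e 1 assms(2)]) (rule that)
  next
    case 2
    have e': "z = b *s p + a *s x + d *s y + c *s q" unfolding e by (simp add: algebra_simps)
    show ?thesis by (rule frame_corner[OF frame_rot[OF f] e' 2 assms(2)]) (rule that)
  next
    case 3
    have e': "z = c *s q + a *s x + d *s y + b *s p" unfolding e by (simp add: algebra_simps)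
    show ?thesis by (rule frame_corner[OF frame_rot[OF frame_swap[OF f]] e' 3 assms(2)]) (rule that)
  next
    case 4
    have e': "z = d *s y + b *s p + c *s q + a *s x" unfolding e by (simp add: algebra_simps)
    show ?thesis by (rule frame_corner[OF frame_rev[OF f] e' 4 assms(2)]) (rule that)
  qed
qed

lemma opp_frame:
  assumes "u \<in> Z" "w \<in> Z" "\<not> u \<frown> w"
  obtains \<xi> a b where "\<xi> \<in> \<Xi>" "frame Z \<xi> u a b w"
proof -
  from join[OF assms(1,2)] obtain \<xi> where \<xi>: "\<xi> \<in> \<Xi>" "u \<in> \<xi>" "w \<in> \<xi>" by blast
  have "u \<noteq> 0" using assms(2,3) coll_zero coll_sym by blast
  from frame_at[OF \<xi>(1) assms(1) \<xi>(2) this] obtain p q r where f: "frame Z \<xi> u p q r" .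
  from frame_ex[OF f \<xi>(3)] obtain a b c d where e: "w = a *s u + b *s p + c *s q + d *s r" .
  have "a * d = b * c" using assms(2) frame_Z[OF f] unfolding e by simp
  then have "d \<noteq> 0" using frame_first_coll[OF f] assms(3) unfolding e by blast
  have e': "w = d *s r + b *s p + c *s q + a *s u" unfolding e by (simp add: algebra_simps)
  from frame_corner[OF frame_rev[OF f] e' \<open>d \<noteq> 0\<close> assms(2)] obtain p' q' where "frame Z \<xi> w p' q' u" .
  from frame_rev[OF this] \<xi>(1) that show thesis by blast
qed

text \<open>A common neighbour lies in \<open>\<xi>\<close> by \<open>nbr_mem\<close>; collinearity
  with \<open>u\<close> and with \<open>w\<close> kills its last and its first coordinate, and the
  equation of the quadric leaves only one of the other two.\<close>

lemma common_nbr: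
  assumes "\<xi> \<in> \<Xi>" and f: "frame Z \<xi> u a b w" and "x \<frown> u" "x \<frown> w"
  shows "(\<exists>k. x = k *s a) \<or> (\<exists>k. x = k *s b)"
proof -
  have nc: "\<not> u \<frown> w" using frame_vertices[OF f] by blast
  have "x \<in> \<xi>" using nbr_mem[OF assms(3,4) nc assms(1)] frame_vertices[OF f] by blast
  from frame_ex[OF f this] obtain p q r s where e: "x = p *s u + q *s a + r *s b + s *s w" .
  have z: "p * s = q * r" using coll_left[OF assms(3)] frame_Z[OF f] unfolding e by simp
  have "s = 0" using frame_first_coll[OF f z] coll_sym[OF assms(3)] unfolding e by blast
  moreover have "p = 0" using frame_last_coll[OF f z] coll_sym[OF assms(4)] unfolding e by blast
  ultimately show ?thesis using z unfolding e by auto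
qed

text \<open>Here \<open>x\<close>, \<open>u\<close>, \<open>v\<close> become vertices as vectors and
  not merely as points. The normalization makes the fourth vertex a well-defined vector, on which
  all later coordinates rest.\<close>

lemma nbr_frame:
  assumes "x \<frown> u" "x \<frown> v" "\<not> u \<frown> v" "x \<noteq> 0"
  obtains \<xi> y where "\<xi> \<in> \<Xi>" "frame Z \<xi> x u v y"
proof -
  have uv: "u \<in> Z" "v \<in> Z" using assms coll_right by blast+
  have main: "\<exists>\<xi> y. \<xi> \<in> \<Xi> \<and> frame Z \<xi> x u v y" if f: "frame Z \<xi> u a b v" "\<xi> \<in> \<Xi>" "x = k *s a" for \<xi> a b k
  proof -
    have k: "k \<noteq> 0" using assms(4) that(3) by auto
    \<comment> \<open>Scaling by \<open>k\<close> turns \<open>a\<close> into \<open>x\<close> but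
      also changes \<open>u\<close>; scaling the other pair by the inverse restores
      \<open>u\<close>.\<close>
    have 1: "frame Z \<xi> (k *s a) (k *s u) v b" by (rule frame_scale[OF frame_rot[OF f(1)] k])
    have 2: "frame Z \<xi> (inverse k *s (k *s u)) (inverse k *s b) (k *s a) v"
      by (rule frame_scale[OF frame_swap[OF frame_rot[OF 1]]]) (use k in simp)
    have "inverse k *s (k *s u) = u" using k by (simp add: vec_eq_iff)
    with frame_rot[OF frame_swap[OF 2]] that(2,3) show ?thesis by auto
  qed
  from opp_frame[OF uv assms(3)] obtain \<xi> a b where f: "\<xi> \<in> \<Xi>" "frame Z \<xi> u a b v" .
  from common_nbr[OF f assms(1,2)] show thesis
    using main[OF f(2,1)] main[OF frame_swap[OF f(2)] f(1)] that by blast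
qed

lemma frame_nbr:
  assumes f: "frame Z \<xi> x u v y" and "w \<in> \<xi>" "x \<frown> w"
  obtains a b where "w = a *s x + b *s u" | a b where "w = a *s x + b *s v"
proof -
  from frame_ex[OF f assms(2)] obtain a b c d where e: "w = a *s x + b *s u + c *s v + d *s y" .
  have z: "a * d = b * c" using coll_right[OF assms(3)] frame_Z[OF f] unfolding e by simp
  have "d = 0" using frame_first_coll[OF f z] assms(3) unfolding e by blast
  with z have "b = 0 \<or> c = 0" by simp
  then show thesis
  proof
    assume "b = 0"
    with e \<open>d = 0\<close> have "w = a *s x + c *s v" by simp
    then show thesis by (rule that(2))
  next
    assume "c = 0"
    with e \<open>d = 0\<close> have "w = a *s x + b *s u" by simp
    then show thesis by (rule that(1))
  qed
qed

end

text \<open>Vector dimension 5 is projective dimension 4. The bound is put on all vectors collinear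
  with \<open>x\<close>, which is the same as on all tangent planes because each neighbour of
  \<open>x\<close> lies in one of them.\<close>

locale grid_cone = hyperbolic_cone Z \<Xi> for Z :: "('a::field ^ 'n) set" and \<Xi> +
  assumes tangent: "x \<in> Z \<Longrightarrow> x \<noteq> 0 \<Longrightarrow>
      \<exists>S. vec.subspace S \<and> vec.dim S \<le> 5 \<and> (\<forall>u. coll Z x u \<longrightarrow> u \<in> S)"

section \<open>Classes of lines through a point\<close>

text \<open>Families instead of sets, because the vectors to which this is applied may coincide;
  then the coefficients 1 and -1 give the relation.\<close>

lemma family_dependent:
  fixes f :: "nat \<Rightarrow> 'a::field ^ 'n"
  assumes "\<And>i. i < k \<Longrightarrow> f i \<in> S" and "vec.dim S < k"
  shows "\<exists>g. (\<exists>i<k. g i \<noteq> 0) \<and> (\<Sum>i<k. g i *s f i) = 0"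
proof (cases "inj_on f {..<k}")
  case True
  have "vec.dependent (f ` {..<k})"
  proof (rule ccontr)
    assume "\<not> vec.dependent (f ` {..<k})"
    then have "card (f ` {..<k}) \<le> vec.dim S"
      using assms(1) by (intro vec.independent_card_le_dim) auto
    with assms(2) card_image[OF True] show False by simp
  qed
  then obtain g where g: "\<exists>v\<in>f ` {..<k}. g v \<noteq> 0" "(\<Sum>v\<in>f ` {..<k}. g v *s v) = 0"
    unfolding vec.dependent_finite[OF finite_imageI[OF finite_lessThan]] by blast
  have "(\<Sum>i<k. (g \<circ> f) i *s f i) = 0"
    using g(2) unfolding sum.reindex[OF True] by (simp add: comp_def)
  with g(1) show ?thesis by (intro exI[of _ "g \<circ> f"]) auto
next
  case False
  then obtain i j where ij: "i < k" "j < k" "i \<noteq> j" "f i = f j" unfolding inj_on_def by auto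
  define g where "g = (\<lambda>l. if l = i then 1 else if l = j then -1 else (0::'a))"
  have "(\<Sum>l<k. g l *s f l) = (\<Sum>l\<in>{i, j}. g l *s f l)"
    using ij by (intro sum.mono_neutral_right) (auto simp: g_def)
  also have "\<dots> = 0" using ij by (simp add: g_def)
  finally show ?thesis using ij by (intro exI[of _ g]) (auto simp: g_def)
qed

lemma six_dependent:
  fixes S :: "('a::field ^ 'n) set"
  assumes "vec.dim S \<le> 5" "v1 \<in> S" "v2 \<in> S" "v3 \<in> S" "v4 \<in> S" "v5 \<in> S" "v6 \<in> S"
  obtains a1 a2 a3 a4 a5 a6 where
    "a1 *s v1 + a2 *s v2 + a3 *s v3 + a4 *s v4 + a5 *s v5 + a6 *s v6 = 0"
    "\<not> (a1 = 0 \<and> a2 = 0 \<and> a3 = 0 \<and> a4 = 0 \<and> a5 = 0 \<and> a6 = 0)"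
proof -
  let ?f = "\<lambda>i::nat. [v1, v2, v3, v4, v5, v6] ! i"
  have "\<exists>g. (\<exists>i<6. g i \<noteq> 0) \<and> (\<Sum>i<6. g i *s ?f i) = 0"
  proof (rule family_dependent)
    show "?f i \<in> S" if "i < 6" for i
    proof -
      have "i = 0 \<or> i = 1 \<or> i = 2 \<or> i = 3 \<or> i = 4 \<or> i = 5" using that by linarith
      then show ?thesis using assms(2-) by (elim disjE) simp_all
    qed
  qed (use assms(1) in simp)
  then obtain g where g: "\<exists>i<6. g i \<noteq> 0" "(\<Sum>i<6. g i *s ?f i) = 0" by blast
  show thesis
  proof (rule that[of "g 0" "g 1" "g 2" "g 3" "g 4" "g 5"])
    show "g 0 *s v1 + g 1 *s v2 + g 2 *s v3 + g 3 *s v4 + g 4 *s v5 + g 5 *s v6 = 0"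
      using g(2) by (simp add: eval_nat_numeral lessThan_Suc algebra_simps)
    show "\<not> (g 0 = 0 \<and> g 1 = 0 \<and> g 2 = 0 \<and> g 3 = 0 \<and> g 4 = 0 \<and> g 5 = 0)"
    proof
      assume z: "g 0 = 0 \<and> g 1 = 0 \<and> g 2 = 0 \<and> g 3 = 0 \<and> g 4 = 0 \<and> g 5 = 0"
      from g(1) obtain i where i: "i < 6" "g i \<noteq> 0" by blast
      have "i = 0 \<or> i = 1 \<or> i = 2 \<or> i = 3 \<or> i = 4 \<or> i = 5" using i(1) by linarith
      with z i(2) show False by auto
    qed
  qed
qed

text \<open>Says that \<open>v\<close> vanishes modulo \<open>x\<close>. The relation is not
  symmetric, since \<open>par x 0\<close> always holds.\<close>

definition par :: "'a::field ^ 'n \<Rightarrow> 'a ^ 'n \<Rightarrow> bool" where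
  "par x v \<longleftrightarrow> (\<exists>k. v = k *s x)"

lemma par_zero: "par x 0"
  unfolding par_def by (rule exI[of _ 0]) simp

lemma par_self: "par x x"
  unfolding par_def by (rule exI[of _ 1]) simp

lemma par_scale: "par x (k *s x)"
  unfolding par_def by blast

lemma par_lin: "par x u \<Longrightarrow> par x v \<Longrightarrow> par x (a *s u + b *s v)"
  unfolding par_def by (metis vec.scale_left_distrib vec.scale_scale)

lemma par_sym: assumes "par x v" "v \<noteq> 0" shows "par v x"
proof -
  from assms(1) obtain k where k: "v = k *s x" unfolding par_def by blast
  with assms(2) have "k \<noteq> 0" by auto
  then have "x = inverse k *s v" using k by (simp add: vec_eq_iff)
  then show ?thesis unfolding par_def by blast
qed

lemma solve_second:
  fixes f x p :: "'a::field ^ 'n"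
  assumes "f = a *s x + b *s p" "b \<noteq> 0" shows "p = (- a / b) *s x + (1 / b) *s f"
  using assms(2) unfolding assms(1) by (simp add: vec_eq_iff divide_simps)

context grid_cone
begin

lemma par_coll: "par x v \<Longrightarrow> x \<frown> u \<Longrightarrow> v \<frown> u"
  unfolding par_def using coll_scale_right coll_sym by blast

text \<open>If \<open>u\<close> and \<open>w\<close> were not collinear, their only common
  neighbours would be the other two vertices \<open>a\<close>, \<open>b\<close> of a quadrangle.
  Both \<open>x\<close> and \<open>v\<close> are common neighbours and not proportional, so they are
  multiples of different ones, which are not collinear.\<close>

lemma coll_trans:
  assumes "x \<frown> u" "x \<frown> v" "x \<frown> w" "u \<frown> v" "v \<frown> w" "\<not> par x v" and x0: "x \<noteq> 0"
  shows "u \<frown> w"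
proof (rule ccontr)
  assume n: "\<not> u \<frown> w"
  have uw: "u \<in> Z" "w \<in> Z" using assms coll_right by blast+
  from opp_frame[OF uw n] obtain \<xi> a b where f: "\<xi> \<in> \<Xi>" "frame Z \<xi> u a b w" .
  have x: "(\<exists>k. x = k *s a) \<or> (\<exists>k. x = k *s b)" by (rule common_nbr[OF f assms(1,3)])
  have v: "(\<exists>k. v = k *s a) \<or> (\<exists>k. v = k *s b)" by (rule common_nbr[OF f coll_sym[OF assms(4)] assms(5)])
  have v0: "v \<noteq> 0" using assms(6) par_zero by blast
  have nab: "\<not> a \<frown> b" using frame_vertices[OF f(2)] by blast
  have bad: False if "x = k *s c" "v = m *s c" for k m c
  proof -
    have "par c x" "par c v" using that par_scale by blast+
    from par_sym[OF this(1) x0] have "par x c" .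
    from par_lin[OF this this, of m 0] that(2) have "par x v" by simp
    with assms(6) show False by blast
  qed
  have bad2: "a \<frown> b" if "k *s c \<frown> m *s d" "k \<noteq> 0" "m \<noteq> 0" "c = a \<and> d = b \<or> c = b \<and> d = a" for k m c d
    using coll_unscale_right[OF coll_sym[OF coll_unscale_right[OF that(1,3)]] that(2)] that(4) coll_sym by blast
  from x v bad have "(\<exists>k m. x = k *s a \<and> v = m *s b) \<or> (\<exists>k m. x = k *s b \<and> v = m *s a)" by blast
  then show False
  proof (elim disjE exE conjE)
    fix k m assume e: "x = k *s a" "v = m *s b"
    then have "k \<noteq> 0" "m \<noteq> 0" using x0 v0 by auto
    with bad2[of k a m b] assms(2) e nab show False by blast
  next
    fix k m assume e: "x = k *s b" "v = m *s a"
    then have "k \<noteq> 0" "m \<noteq> 0" using x0 v0 by auto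
    with bad2[of k b m a] assms(2) e nab show False by blast
  qed
qed

lemma coll_span:
  assumes "x \<noteq> 0" "x \<frown> u" "x \<frown> v" "u \<frown> v"
  shows "u \<frown> a *s x + b *s v"
proof (cases "par x v")
  case True
  then have "par x (a *s x + b *s v)" by (rule par_lin[OF par_self])
  then show ?thesis using par_coll[OF _ assms(2)] coll_sym by blast
next
  case False
  have "x \<frown> a *s x + b *s v" using coll_lin[OF assms(3), of 1 0 a b] by simp
  moreover have "v \<frown> a *s x + b *s v" by (rule coll_lin_mixed[OF assms(3)])
  ultimately show ?thesis using coll_trans[OF assms(2,3) _ assms(4) _ False assms(1)] by blast
qed

lemma three_classes:
  assumes "x \<noteq> 0" "x \<frown> b" "x \<frown> c" "x \<frown> d"
    and bc: "par x b \<or> par x c \<or> \<not> b \<frown> c" and bd: "par x b \<or> par x d \<or> \<not> b \<frown> d"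
    and cd: "par x c \<or> par x d \<or> \<not> c \<frown> d"
    and s: "p *s x + b + c + d = 0"
  shows "par x d"
proof (rule ccontr)
  assume nd: "\<not> par x d"
  have two: "par x c" if "x \<frown> c" "par x c \<or> \<not> c \<frown> d" "c = k *s x + (-1) *s d" for c k
    using that coll_lin_mixed[OF assms(4), of k "-1"] coll_sym by metis
  have pd: False if "par x u" "par x v" "d = (-1) *s u + (-1) *s v" for u v
    using nd par_lin[OF that(1,2), of "-1" "-1"] that(3) by simp
  have npb: "\<not> par x b"
  proof
    assume pb: "par x b"
    then obtain k where k: "b = k *s x" unfolding par_def by blast
    have c: "c = (- p - k) *s x + (-1) *s d"
      using s unfolding k by (simp add: vec_eq_iff algebra_simps eq_neg_iff_add_eq_0)
    have pc: "par x c" using two[OF assms(3) _ c] cd nd by blast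
    have "par x (1 *s b + 1 *s c)" using par_lin[OF pb pc] .
    moreover have "d = (-1) *s (p *s x) + (-1) *s (1 *s b + 1 *s c)"
      using s by (simp add: vec_eq_iff algebra_simps eq_neg_iff_add_eq_0)
    ultimately show False using pd par_scale by blast
  qed
  have npc: "\<not> par x c"
  proof
    assume pc: "par x c"
    then obtain k where k: "c = k *s x" unfolding par_def by blast
    have c: "b = (- p - k) *s x + (-1) *s d"
      using s unfolding k by (simp add: vec_eq_iff algebra_simps eq_neg_iff_add_eq_0)
    have "par x b" using two[OF assms(2) _ c] bd nd by blast
    with npb show False by blast
  qed
  have "\<not> b \<frown> c" using bc npb npc by blast
  then have "1 *s b + 1 *s c \<notin> Z" using sum_notin assms(2,3) coll_right by (metis zero_neq_one)
  moreover have "1 *s b + 1 *s c = (- p) *s x + (-1) *s d"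
    using s by (simp add: vec_eq_iff algebra_simps eq_neg_iff_add_eq_0)
  ultimately show False using coll_D[OF assms(4)] by metis
qed

lemma frame_nbr_coll:
  assumes f: "frame Z \<xi> x u v y" and "w \<in> \<xi>" "x \<frown> w"
  shows "w \<frown> u \<or> w \<frown> v"
  using frame_nbr[OF assms] coll_lin_mixed frame_vertices(13,14)[OF f] coll_sym by metis

text \<open>Modulo \<open>x\<close>, the sum \<open>b + c\<close> equals \<open>- (d + e)\<close>.
  It lies outside \<open>Z\<close> and in the spaces of \<open>b\<close>, \<open>c\<close> and of
  \<open>d\<close>, \<open>e\<close>, so these agree; but a quadric has only two lines through
  \<open>x\<close>.\<close>

lemma four_classes:
  assumes "x \<noteq> 0" "x \<frown> b" "x \<frown> c" "x \<frown> d" "x \<frown> e"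
    and "par x b \<or> par x c \<or> \<not> b \<frown> c" and "par x b \<or> par x d \<or> \<not> b \<frown> d"
    and "par x b \<or> par x e \<or> \<not> b \<frown> e" and "par x c \<or> par x d \<or> \<not> c \<frown> d"
    and "par x c \<or> par x e \<or> \<not> c \<frown> e" and "par x d \<or> par x e \<or> \<not> d \<frown> e"
    and s: "p *s x + b + c + d + e = 0"
  shows "par x e"
proof (rule ccontr)
  assume ne: "\<not> par x e"
  have npb: "\<not> par x b"
  proof
    assume "par x b"
    then obtain k where k: "b = k *s x" unfolding par_def by blast
    have "(p + k) *s x + c + d + e = 0" using s unfolding k by (simp add: vec_eq_iff algebra_simps)
    from three_classes[OF assms(1,3,4,5,9-11) this] ne show False by blast
  qed
  have npc: "\<not> par x c"
  proof
    assume "par x c"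
    then obtain k where k: "c = k *s x" unfolding par_def by blast
    have "(p + k) *s x + b + d + e = 0" using s unfolding k by (simp add: vec_eq_iff algebra_simps)
    from three_classes[OF assms(1,2,4,5,7,8,11) this] ne show False by blast
  qed
  have npd: "\<not> par x d"
  proof
    assume "par x d"
    then obtain k where k: "d = k *s x" unfolding par_def by blast
    have "(p + k) *s x + b + c + e = 0" using s unfolding k by (simp add: vec_eq_iff algebra_simps)
    from three_classes[OF assms(1-3,5,6,8,10) this] ne show False by blast
  qed
  have bc: "\<not> b \<frown> c" and bd: "\<not> b \<frown> d" and cd: "\<not> c \<frown> d" and de: "\<not> d \<frown> e"
    using assms(6,7,9,11) npb npc npd ne by blast+
  from nbr_frame[OF assms(2,3) bc assms(1)] obtain \<xi> y where f: "\<xi> \<in> \<Xi>" "frame Z \<xi> x b c y" .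
  from nbr_frame[OF assms(4,5) de assms(1)] obtain \<eta> y' where g: "\<eta> \<in> \<Xi>" "frame Z \<eta> x d e y'" .
  note fv = frame_vertices[OF f(2)] and gv = frame_vertices[OF g(2)]
  have "1 *s b + 1 *s c \<notin> Z" by (rule sum_notin[OF fv(6,7) bc]) simp_all
  moreover have "1 *s b + 1 *s c \<in> \<xi>" by (rule mem_lin[OF f(1) fv(2,3)])
  moreover have "1 *s b + 1 *s c \<in> \<eta>"
  proof -
    have "1 *s (p *s x + 1 *s d) + 1 *s e \<in> \<eta>" using mem_lin[OF g(1)] gv(1-3) by blast
    then have "(-1) *s (1 *s (p *s x + 1 *s d) + 1 *s e) \<in> \<eta>" by (rule mem_scale[OF g(1)])
    moreover have "1 *s b + 1 *s c = (-1) *s (1 *s (p *s x + 1 *s d) + 1 *s e)"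
      using s by (simp add: vec_eq_iff algebra_simps eq_neg_iff_add_eq_0)
    ultimately show ?thesis by simp
  qed
  ultimately have "\<xi> = \<eta>" using meet[OF f(1) g(1)] by blast
  then have "d \<in> \<xi>" using gv(2) by simp
  from frame_nbr_coll[OF f(2) this assms(4)] bd cd coll_sym show False by blast
qed

lemma nbrs_exist:
  assumes "x \<in> Z" "x \<noteq> 0"
  obtains u v where "x \<frown> u" "x \<frown> v" "\<not> u \<frown> v"
proof -
  from join[OF assms(1,1)] obtain \<xi> where \<xi>: "\<xi> \<in> \<Xi>" "x \<in> \<xi>" by blast
  from frame_at[OF \<xi>(1) assms(1) \<xi>(2) assms(2)] obtain p q r where f: "frame Z \<xi> x p q r" .
  from frame_vertices[OF f] that show thesis by blast
qed

lemma par_coll_all: "par x u \<Longrightarrow> x \<frown> w \<Longrightarrow> w \<frown> u"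
  using par_coll coll_sym by blast

lemma nbr_off:
  assumes "x \<noteq> 0" "x \<frown> p" "\<not> par x p"
  obtains b where "x \<frown> b" "\<not> b \<frown> p"
proof -
  from nbrs_exist[OF coll_left[OF assms(2)] assms(1)] obtain u v where uv: "x \<frown> u" "x \<frown> v" "\<not> u \<frown> v" .
  show thesis
  proof (cases "u \<frown> p")
    case True
    have "\<not> v \<frown> p" using coll_trans[OF uv(1) assms(2) uv(2) True _ assms(3,1)] uv(3) coll_sym by blast
    with that uv(2) show thesis by blast
  next
    case False
    with that uv(1) show thesis by blast
  qed
qed

section \<open>Points with exactly two classes of lines\<close>

definition two_classes :: "'a ^ 'n \<Rightarrow> bool" where
  "two_classes x \<longleftrightarrow> (\<exists>u v. x \<frown> u \<and> x \<frown> v \<and> \<not> u \<frown> v \<and> (\<forall>w. x \<frown> w \<longrightarrow> w \<frown> u \<or> w \<frown> v))"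

text \<open>Pigeonhole: three pairwise non-collinear neighbours cannot be distributed over two
  classes.\<close>

lemma two_classes_any:
  assumes "two_classes x" "x \<noteq> 0" "x \<frown> u" "x \<frown> v" "\<not> u \<frown> v" "x \<frown> w"
  shows "w \<frown> u \<or> w \<frown> v"
proof (rule ccontr)
  assume n: "\<not> (w \<frown> u \<or> w \<frown> v)"
  from assms(1) obtain a b where ab: "x \<frown> a" "x \<frown> b" "\<not> a \<frown> b" "\<And>w. x \<frown> w \<Longrightarrow> w \<frown> a \<or> w \<frown> b"
    unfolding two_classes_def by blast
  have pa: "\<not> par x a" using par_coll_all[OF _ ab(2)] ab(3) coll_sym by blast
  have pb: "\<not> par x b" using par_coll_all[OF _ ab(1)] ab(3) by blast
  have t: "p \<frown> q" if "x \<frown> p" "x \<frown> q" "p \<frown> c" "q \<frown> c" "c = a \<or> c = b" for p q c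
    using coll_trans[OF that(1) _ that(2) that(3) coll_sym[OF that(4)] _ assms(2)] that(5) pa pb ab(1,2) by blast
  show False
    using ab(4)[OF assms(3)] ab(4)[OF assms(4)] ab(4)[OF assms(6)] t assms(3-6) n coll_sym by metis
qed

lemma indep_par:
  assumes "\<forall>a b. v \<noteq> a *s x + b *s u" "q \<noteq> 0" shows "\<not> par x (p *s u + q *s v)"
proof
  assume "par x (p *s u + q *s v)"
  then obtain k where "p *s u + q *s v = k *s x" unfolding par_def by blast
  then have "q *s v = k *s x - p *s u" by (simp add: algebra_simps)
  then have "inverse q *s (q *s v) = inverse q *s (k *s x - p *s u)" by simp
  then have "v = (inverse q * k) *s x + (- inverse q * p) *s u"
    using assms(2) by (simp add: vec_eq_iff algebra_simps)
  with assms(1) show False by blast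
qed

lemma six_nbrs:
  assumes "x \<noteq> 0" "x \<frown> v2" "x \<frown> v3" "x \<frown> v4" "x \<frown> v5" "x \<frown> v6"
  obtains a1 a2 a3 a4 a5 a6 where
    "a1 *s x + a2 *s v2 + a3 *s v3 + a4 *s v4 + a5 *s v5 + a6 *s v6 = 0"
    "\<not> (a1 = 0 \<and> a2 = 0 \<and> a3 = 0 \<and> a4 = 0 \<and> a5 = 0 \<and> a6 = 0)"
proof -
  have xZ: "x \<in> Z" using coll_left assms(2) by blast
  from tangent[OF xZ assms(1)] obtain S where S: "vec.dim S \<le> 5" "\<And>u. x \<frown> u \<Longrightarrow> u \<in> S" by blast
  have "x \<frown> x" using coll_self[OF xZ, of 1] by simp
  from six_dependent[OF S(1) S(2)[OF this] S(2)[OF assms(2)] S(2)[OF assms(3)] S(2)[OF assms(4)] S(2)[OF assms(5)] S(2)[OF assms(6)]] that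
  show thesis by blast
qed

lemma coll_add:
  assumes "x \<noteq> 0" "x \<frown> u" "x \<frown> v" "u \<frown> v"
  shows "x \<frown> p *s u + q *s v"
proof (cases "u = 0")
  case True
  then show ?thesis using coll_scale_right[OF assms(3)] by simp
next
  case False
  show ?thesis by (rule coll_span[OF False coll_sym[OF assms(2)] assms(4,3)])
qed

lemma other_class:
  assumes "x \<noteq> 0" "x \<frown> a" "x \<frown> b" "\<not> a \<frown> b" "x \<frown> c" "c \<frown> a" "\<not> par x c"
  shows "\<not> c \<frown> b"
  using coll_trans[OF assms(2,5,3) coll_sym[OF assms(6)] _ assms(7,1)] assms(4) by blast

lemma par_scale_cancel: "par x (k *s c) \<Longrightarrow> \<not> par x c \<Longrightarrow> k = 0"
proof (rule ccontr)
  assume a: "par x (k *s c)" "\<not> par x c" "k \<noteq> 0"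
  have "par x (inverse k *s (k *s c) + 0 *s 0)" by (rule par_lin[OF a(1) par_zero])
  moreover have "inverse k *s (k *s c) + 0 *s 0 = c" using a(3) by (simp add: vec_eq_iff)
  ultimately show False using a(2) by simp
qed

lemma two_coeffs:
  assumes "par x (p *s a + q *s a')" "\<forall>p q. a' \<noteq> p *s x + q *s a" "\<not> par x a"
  shows "p = 0 \<and> q = 0"
proof -
  have "q = 0" using indep_par[OF assms(2)] assms(1) by blast
  with assms(1) have "par x (p *s a)" by simp
  from par_scale_cancel[OF this assms(3)] \<open>q = 0\<close> show ?thesis by blast
qed

text \<open>In each of the next two configurations six independent vectors would lie in the tangent space.\<close>

lemma no_two_planes_and_line:
  assumes x: "x \<noteq> 0" "x \<frown> a" "x \<frown> a'" "a \<frown> a'" "\<forall>p q. a' \<noteq> p *s x + q *s a"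
    and b: "x \<frown> b" "x \<frown> b'" "b \<frown> b'" "\<forall>p q. b' \<noteq> p *s x + q *s b"
    and c: "x \<frown> c" "\<not> a \<frown> b" "\<not> a \<frown> c" "\<not> b \<frown> c"
  shows False
proof -
  have np: "\<not> par x a" "\<not> par x b" "\<not> par x c"
    using par_coll_all x(2) b(1) c coll_sym by blast+
  from six_nbrs[OF x(1-3) b(1,2) c(1)] obtain a1 a2 a3 a4 a5 a6 where
    e: "a1 *s x + a2 *s a + a3 *s a' + a4 *s b + a5 *s b' + a6 *s c = 0"
    and nz: "\<not> (a1 = 0 \<and> a2 = 0 \<and> a3 = 0 \<and> a4 = 0 \<and> a5 = 0 \<and> a6 = 0)" .
  \<comment> \<open>Collecting the terms by classes turns the six-term relation into one between
    representatives of three classes.\<close>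
  define A B C where "A = a2 *s a + a3 *s a'" and "B = a4 *s b + a5 *s b'" and "C = a6 *s c"
  have xA: "x \<frown> A" and xB: "x \<frown> B" and xC: "x \<frown> C"
    unfolding A_def B_def C_def
    using coll_add[OF x(1-4)] coll_add[OF x(1) b(1-3)] coll_scale_right[OF c(1)] by blast+
  have Aa: "A \<frown> a" using coll_lin[OF x(4), of a2 a3 1 0] unfolding A_def by simp
  have Bb: "B \<frown> b" using coll_lin[OF b(3), of a4 a5 1 0] unfolding B_def by simp
  have Cc: "C \<frown> c" unfolding C_def by (rule coll_sym[OF coll_self[OF coll_right[OF c(1)]]])
  have AB: "par x A \<or> par x B \<or> \<not> A \<frown> B"
    using other_class[OF x(1,2) b(1) c(2) xA Aa] other_class[OF x(1) b(1) xA _ xB Bb] coll_sym by blast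
  have AC: "par x A \<or> par x C \<or> \<not> A \<frown> C"
    using other_class[OF x(1,2) c(1,3) xA Aa] other_class[OF x(1) c(1) xA _ xC Cc] coll_sym by blast
  have BC: "par x B \<or> par x C \<or> \<not> B \<frown> C"
    using other_class[OF x(1) b(1) c(1,4) xB Bb] other_class[OF x(1) c(1) xB _ xC Cc] coll_sym by blast
  have s: "a1 *s x + A + B + C = 0" "a1 *s x + B + C + A = 0" "a1 *s x + A + C + B = 0"
    using e unfolding A_def B_def C_def by (simp_all add: algebra_simps)
  have "par x C" by (rule three_classes[OF x(1) xA xB xC AB AC BC s(1)])
  then have 6: "a6 = 0" unfolding C_def by (rule par_scale_cancel) (rule np)
  have "par x A" by (rule three_classes[OF x(1) xB xC xA BC _ _ s(2)]) (use AB AC coll_sym in blast)+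
  then have 2: "a2 = 0 \<and> a3 = 0" unfolding A_def by (rule two_coeffs[OF _ x(5) np(1)])
  have "par x B" by (rule three_classes[OF x(1) xA xC xB AC AB _ s(3)]) (use BC coll_sym in blast)
  then have 4: "a4 = 0 \<and> a5 = 0" unfolding B_def by (rule two_coeffs[OF _ b(4) np(2)])
  from e 2 4 6 have "a1 *s x = 0" by simp
  with x(1) have "a1 = 0" using vec.scale_eq_0_iff by blast
  with nz 2 4 6 show False by blast
qed

lemma no_plane_and_three_lines:
  assumes x: "x \<noteq> 0" "x \<frown> a" "x \<frown> a'" "a \<frown> a'" "\<forall>p q. a' \<noteq> p *s x + q *s a"
    and b: "x \<frown> b" "x \<frown> c" "x \<frown> d"
    and n: "\<not> a \<frown> b" "\<not> a \<frown> c" "\<not> a \<frown> d" "\<not> b \<frown> c" "\<not> b \<frown> d" "\<not> c \<frown> d"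
  shows False
proof -
  have np: "\<not> par x a" "\<not> par x b" "\<not> par x c" "\<not> par x d"
    using par_coll_all x(2) b n coll_sym by blast+
  from six_nbrs[OF x(1-3) b] obtain a1 a2 a3 a4 a5 a6 where
    e: "a1 *s x + a2 *s a + a3 *s a' + a4 *s b + a5 *s c + a6 *s d = 0"
    and nz: "\<not> (a1 = 0 \<and> a2 = 0 \<and> a3 = 0 \<and> a4 = 0 \<and> a5 = 0 \<and> a6 = 0)" .
  define A B C D where "A = a2 *s a + a3 *s a'" and "B = a4 *s b" and "C = a5 *s c" and "D = a6 *s d"
  have xs: "x \<frown> A" "x \<frown> B" "x \<frown> C" "x \<frown> D"
    unfolding A_def B_def C_def D_def
    using coll_add[OF x(1-4)] coll_scale_right b by blast+
  have Aa: "A \<frown> a" using coll_lin[OF x(4), of a2 a3 1 0] unfolding A_def by simp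
  have Bb: "B \<frown> b" and Cc: "C \<frown> c" and Dd: "D \<frown> d"
    unfolding B_def C_def D_def using coll_self b coll_right coll_sym by blast+
  have oc: "par x U \<or> par x V \<or> \<not> U \<frown> V"
    if "x \<frown> u" "x \<frown> v" "\<not> u \<frown> v" "x \<frown> U" "U \<frown> u" "x \<frown> V" "V \<frown> v" for u v U V
    using other_class[OF x(1) that(1-5)] other_class[OF x(1) that(2,4) _ that(6,7)] coll_sym by blast
  have AB: "par x A \<or> par x B \<or> \<not> A \<frown> B" by (rule oc[OF x(2) b(1) n(1) xs(1) Aa xs(2) Bb])
  have AC: "par x A \<or> par x C \<or> \<not> A \<frown> C" by (rule oc[OF x(2) b(2) n(2) xs(1) Aa xs(3) Cc])
  have AD: "par x A \<or> par x D \<or> \<not> A \<frown> D" by (rule oc[OF x(2) b(3) n(3) xs(1) Aa xs(4) Dd])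
  have BC: "par x B \<or> par x C \<or> \<not> B \<frown> C" by (rule oc[OF b(1) b(2) n(4) xs(2) Bb xs(3) Cc])
  have BD: "par x B \<or> par x D \<or> \<not> B \<frown> D" by (rule oc[OF b(1) b(3) n(5) xs(2) Bb xs(4) Dd])
  have CD: "par x C \<or> par x D \<or> \<not> C \<frown> D" by (rule oc[OF b(2) b(3) n(6) xs(3) Cc xs(4) Dd])
  have s: "a1 *s x + A + B + C + D = 0" "a1 *s x + A + B + D + C = 0"
      "a1 *s x + A + C + D + B = 0" "a1 *s x + B + C + D + A = 0"
    using e unfolding A_def B_def C_def D_def by (simp_all add: algebra_simps)
  have "par x D" by (rule four_classes[OF x(1) xs AB AC AD BC BD CD s(1)])
  then have 6: "a6 = 0" unfolding D_def by (rule par_scale_cancel) (rule np)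
  have "par x C" by (rule four_classes[OF x(1) xs(1,2,4,3) AB AD AC BD BC _ s(2)]) (use CD coll_sym in blast)
  then have 5: "a5 = 0" unfolding C_def by (rule par_scale_cancel) (rule np)
  have "par x B" by (rule four_classes[OF x(1) xs(1,3,4,2) AC AD AB CD _ _ s(3)]) (use BC BD coll_sym in blast)+
  then have 4: "a4 = 0" unfolding B_def by (rule par_scale_cancel) (rule np)
  have "par x A" by (rule four_classes[OF x(1) xs(2,3,4,1) BC BD _ CD _ _ s(4)]) (use AB AC AD coll_sym in blast)+
  then have 2: "a2 = 0 \<and> a3 = 0" unfolding A_def by (rule two_coeffs[OF _ x(5) np(1)])
  from e 2 4 5 6 have "a1 *s x = 0" by simp
  with x(1) have "a1 = 0" using vec.scale_eq_0_iff by blast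
  with nz 2 4 5 6 show False by blast
qed

text \<open>For \<open>b\<close> in the class at \<open>p\<close> not containing \<open>x\<close>,
  the fourth vertex \<open>c\<close> and \<open>p\<close> are shown to represent all classes at
  \<open>x\<close>. A third class, of \<open>w\<close> say, yields a vertex \<open>b'\<close> that
  must lie in the class of \<open>b\<close> at \<open>p\<close>, and this leads to too many quadrics
  on the line \<open>p x\<close>.\<close>

lemma two_classes_step:
  assumes two: "two_classes p" and p0: "p \<noteq> 0" and px: "p \<frown> x" and npx: "\<not> par p x"
  shows "two_classes x"
proof -
  have x0: "x \<noteq> 0" using npx par_zero by blast
  have xp: "x \<frown> p" by (rule coll_sym[OF px])
  from nbr_off[OF p0 px npx] obtain b where b: "p \<frown> b" "\<not> b \<frown> x" .
  have nxb: "\<not> x \<frown> b" using b coll_sym by blast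
  from nbr_frame[OF px b(1) nxb p0] obtain \<xi> c where xi: "\<xi> \<in> \<Xi>" and f: "frame Z \<xi> p x b c" .
  note fv = frame_vertices[OF f]
  have "w \<frown> p \<or> w \<frown> c" if w: "x \<frown> w" for w
  proof (rule ccontr)
    assume n: "\<not> (w \<frown> p \<or> w \<frown> c)"
    have npw: "\<not> p \<frown> w" using n coll_sym by blast
    have cw: "\<not> c \<frown> w" using n coll_sym by blast
    from nbr_frame[OF xp w npw x0] obtain \<xi>' b' where xi': "\<xi>' \<in> \<Xi>" and f': "frame Z \<xi>' x p w b'" .
    note fv' = frame_vertices[OF f']
    have nbx': "\<not> b' \<frown> x" using fv'(17) coll_sym by blast
    have bb': "b \<frown> b'" using two_classes_any[OF two p0 px b(1) nxb fv'(15)] nbx' coll_sym by blast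
    have f2: "frame Z \<xi> x p c b" by (rule frame_rot[OF f])
    have "w \<notin> \<xi>" using frame_nbr_coll[OF f2 _ w] n by blast
    then have ne: "\<xi> \<noteq> \<xi>'" using fv'(3) by blast
    have b'_out: "b' \<notin> \<xi>" using space_unique[OF fv'(5,8,17) xi xi'] fv fv' ne by blast
    have bspan: "\<forall>r q. b' \<noteq> r *s p + q *s b" using mem_lin[OF xi fv(1,3)] b'_out by blast
    have npb': "\<not> par p b'" using bspan by (metis par_def add.right_neutral vector_smult_lzero)
    have npb: "\<not> par p b" using par_coll_all px b(2) coll_sym by blast
    \<comment> \<open>The question is whether the class of \<open>x\<close> at \<open>p\<close>
      exceeds the line \<open>p x\<close>. If it does, the tangent space at \<open>x\<close> becomes
      too large; if not, a vertex forced onto that line merges two quadrics.\<close>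
    show False
    proof (cases "\<exists>b1. p \<frown> b1 \<and> b1 \<frown> x \<and> (\<forall>r q. b1 \<noteq> r *s x + q *s p)")
      case True
      then obtain b1 where b1: "p \<frown> b1" "b1 \<frown> x" "\<forall>r q. b1 \<noteq> r *s x + q *s p" by blast
      \<comment> \<open>Since \<open>b\<close> and \<open>b'\<close> share a class,
        \<open>b + b'\<close> is again a neighbour of \<open>p\<close>. It defines a third quadric
        on the line \<open>p x\<close> and so a further neighbour \<open>c2\<close> of
        \<open>x\<close>.\<close>
      let ?b = "1 *s b + 1 *s b'"
      have pb2: "p \<frown> ?b" by (rule coll_add[OF p0 b(1) fv'(15) bb'])
      have npb2: "\<not> par p ?b" by (rule indep_par[OF bspan]) simp
      have b2b: "?b \<frown> b" using coll_lin[OF bb', of 1 1 1 0] by simp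
      have nxb2: "\<not> x \<frown> ?b" using coll_trans[OF px pb2 b(1) _ b2b npb2 p0] nxb by blast
      from nbr_frame[OF px pb2 nxb2 p0] obtain \<eta> c2 where eta: "\<eta> \<in> \<Xi>" and g: "frame Z \<eta> p x ?b c2" .
      note gv = frame_vertices[OF g]
      have ne2: "\<eta> \<noteq> \<xi>"
      proof
        assume "\<eta> = \<xi>"
        then have "1 *s ?b + (-1) *s b \<in> \<xi>" using mem_lin[OF xi] gv(3) fv(3) by blast
        with b'_out show False by simp
      qed
      have ne3: "\<eta> \<noteq> \<xi>'"
      proof
        assume "\<eta> = \<xi>'"
        then have "1 *s ?b + (-1) *s b' \<in> \<xi>'" using mem_lin[OF xi'] gv(3) fv'(4) by blast
        then have "b \<in> \<xi>'" by simp
        with space_unique[OF fv(6,7) nxb xi xi'] fv fv' ne show False by blast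
      qed
      have c2: "\<forall>r q. c2 \<noteq> r *s x + q *s c"
      proof (intro allI notI)
        fix r q assume "c2 = r *s x + q *s c"
        then have "c2 \<in> \<xi>" using mem_lin[OF xi fv(2,4)] by simp
        with space_unique[OF gv(5,8,17) eta xi] gv fv ne2 show False by blast
      qed
      have w2: "\<forall>r q. c2 \<noteq> r *s x + q *s w"
      proof (intro allI notI)
        fix r q assume "c2 = r *s x + q *s w"
        then have "c2 \<in> \<xi>'" using mem_lin[OF xi' fv'(1,3)] by simp
        with space_unique[OF gv(5,8,17) eta xi'] gv fv' ne3 show False by blast
      qed
      show False
      \<comment> \<open>The vectors \<open>p\<close>, \<open>b1\<close> give a plane at
        \<open>x\<close>. Either \<open>c2\<close> completes a second plane with \<open>c\<close> or
        \<open>w\<close>, or \<open>c\<close>, \<open>w\<close>, \<open>c2\<close> are three further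
        classes.\<close>
      proof (cases "c \<frown> c2 \<or> w \<frown> c2")
        case True
        then show False
        proof
          assume "c \<frown> c2"
          from no_two_planes_and_line[OF x0 xp coll_sym[OF b1(2)] b1(1,3) fv(15) gv(15) this c2 w fv(17) npw cw] show False .
        next
          assume "w \<frown> c2"
          from no_two_planes_and_line[OF x0 xp coll_sym[OF b1(2)] b1(1,3) w gv(15) this w2 fv(15) npw fv(17)] cw coll_sym show False by blast
        qed
      next
        case False
        from no_plane_and_three_lines[OF x0 xp coll_sym[OF b1(2)] b1(1,3) fv(15) w gv(15) fv(17) npw gv(17) cw] False show False by blast
      qed
    next
      case False
      have ncb': "\<not> c \<frown> b'"
      proof
        assume h: "c \<frown> b'"
        have "\<not> par b b'"
        proof
          assume "par b b'"
          then obtain k where "b' = k *s b" unfolding par_def by blast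
          with bspan have "b' \<noteq> 0 *s p + k *s b" by blast
          with \<open>b' = k *s b\<close> show False by simp
        qed
        from coll_trans[OF coll_sym[OF b(1)] bb' fv(16) fv'(15) coll_sym[OF h] this fv(11)] fv(17)
        show False by blast
      qed
      from nbr_frame[OF fv(16) bb' ncb' fv(11)] obtain \<zeta> d where zeta: "\<zeta> \<in> \<Xi>" and h: "frame Z \<zeta> b c b' d" .
      note hv = frame_vertices[OF h]
      have npd: "\<not> p \<frown> d"
      proof
        assume "p \<frown> d"
        from coll_trans[OF b(1) fv'(15) this bb' hv(16) npb' p0] hv(17) show False by blast
      qed
      from nbr_frame[OF coll_sym[OF fv'(15)] hv(16) npd fv'(12)] obtain \<eta> t where
        eta: "\<eta> \<in> \<Xi>" and g: "frame Z \<eta> b' p d t" .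
      note gv = frame_vertices[OF g]
      have "\<not> t \<frown> b"
      proof
        assume "t \<frown> b"
        from coll_trans[OF gv(15) b(1) fv'(15) this bb' npb p0] gv(17) coll_sym show False by blast
      qed
      \<comment> \<open>Being outside the class of \<open>b\<close>, the neighbour \<open>t\<close>
        of \<open>p\<close> is in that of \<open>x\<close>, which in this case is just the line
        \<open>p x\<close>.\<close>
      then have "t \<frown> x" using two_classes_any[OF two p0 px b(1) nxb gv(15)] by blast
      then obtain r q where t: "t = r *s x + q *s p" using False gv(15) by blast
      have "r \<noteq> 0"
      proof
        assume "r = 0"
        then have "par p t" unfolding t par_def by auto
        from par_coll_all[OF this fv'(15)] gv(17) show False by blast
      qed
      have xe: "x = (- q / r) *s p + (1 / r) *s t"
        by (rule solve_second[OF _ \<open>r \<noteq> 0\<close>]) (simp add: t add.commute)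
      have "x \<in> \<eta>" unfolding xe by (rule mem_lin[OF eta gv(2,4)])
      then have "\<eta> = \<xi>'" using space_unique[OF fv'(5,8,17) xi' eta] fv'(1,4) gv(1) by blast
      then have d_in: "d \<in> \<xi>'" using gv(3) by simp
      have fr: "frame Z \<xi>' b' p w x" by (rule frame_rev[OF f'])
      obtain r1 q1 where d: "d = r1 *s b' + q1 *s w"
      proof (rule frame_nbr[OF fr d_in hv(16)])
        fix a1 b1 assume "d = a1 *s b' + b1 *s p"
        then have "p \<frown> d" using coll_lin_mixed[OF coll_sym[OF fv'(15)]] by simp
        with npd show thesis by blast
      qed (rule that)
      have nxd: "r1 \<noteq> 0"
      proof
        assume "r1 = 0"
        then have dd: "d = q1 *s w" using d by simp
        then have "q1 \<noteq> 0" using hv(12) by auto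
        with hv(15) dd coll_unscale_right cw show False by blast
      qed
      \<comment> \<open>The quadric on \<open>x c\<close> and \<open>x w\<close> contains
        \<open>d\<close>, hence \<open>b'\<close>, and so is \<open>\<xi>'\<close>. But the lines of
        \<open>\<xi>'\<close> through \<open>x\<close> are \<open>x p\<close> and
        \<open>x w\<close>.\<close>
      from nbr_frame[OF fv(15) w cw x0] obtain \<theta> e where th: "\<theta> \<in> \<Xi>" and k: "frame Z \<theta> x c w e" .
      note kv = frame_vertices[OF k]
      have dw: "d \<frown> w" unfolding d using coll_lin[OF fv'(16), of q1 r1 1 0] coll_sym[OF fv'(16)] coll_lin[OF coll_sym[OF fv'(16)], of r1 q1 0 1] by simp
      have "d \<in> \<theta>" by (rule nbr_mem[OF coll_sym[OF hv(15)] dw cw th kv(2,3)])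
      moreover have "b' = (- q1 / r1) *s w + (1 / r1) *s d"
        by (rule solve_second[OF _ nxd]) (simp add: d add.commute)
      ultimately have "b' \<in> \<theta>" using mem_lin[OF th kv(3)] by blast
      then have "\<theta> = \<xi>'" using space_unique[OF fv'(5,8,17) xi' th] fv'(1,4) kv(1) by blast
      then have "c \<in> \<xi>'" using kv(2) by simp
      from frame_nbr_coll[OF f' this fv(15)] fv(17) cw coll_sym show False by blast
    qed
  qed
  then show ?thesis unfolding two_classes_def using xp fv(15,17) by blast
qed

text \<open>Any two points are collinear or have a common neighbour, so at most two steps suffice.
  Proportional vectors have the same neighbours and need a separate remark.\<close>

lemma two_classes_all:
  assumes "two_classes p" "p \<in> Z" "p \<noteq> 0" "y \<in> Z" "y \<noteq> 0"
  shows "two_classes y"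
proof -
  have nbr: "two_classes y" if "two_classes p" "p \<noteq> 0" "p \<frown> y" "y \<noteq> 0" for p y
  proof (cases "par p y")
    case True
    from True have "par y p" using par_sym that(4) by blast
    then have "y \<frown> w \<longleftrightarrow> p \<frown> w" for w using True par_coll by blast
    with that(1) show ?thesis unfolding two_classes_def by simp
  next
    case False
    show ?thesis by (rule two_classes_step[OF that(1-3) False])
  qed
  show ?thesis
  proof (cases "p \<frown> y")
    case True
    show ?thesis by (rule nbr[OF assms(1,3) True assms(5)])
  next
    case False
    from opp_frame[OF assms(2,4) False] obtain \<xi> a b where f: "frame Z \<xi> p a b y" by blast
    note fv = frame_vertices[OF f]
    show ?thesis using nbr[OF nbr[OF assms(1,3) fv(13,10)] fv(10,15) assms(5)] .
  qed
qed

text \<open>The lemma makes planes impossible once no point has two classes. At \<open>p1\<close>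
  the two classes are those of \<open>x\<close> and of the vertex \<open>y\<close> opposite
  \<open>x\<close>; a further line through \<open>p1\<close> is traced to a neighbour
  \<open>g\<close> of \<open>x\<close> and excluded according to the class of
  \<open>g\<close>.\<close>

lemma two_classes_near_plane:
  assumes x: "x \<noteq> 0" "x \<frown> a" "x \<frown> a'" "a \<frown> a'" "\<forall>p q. a' \<noteq> p *s x + q *s a"
    and p: "x \<frown> p1" "x \<frown> p2" "\<not> a \<frown> p1" "\<not> a \<frown> p2" "\<not> p1 \<frown> p2"
  shows "two_classes p1"
proof -
  have np: "\<not> par x a" "\<not> par x p1" "\<not> par x p2"
    using par_coll_all x(2) p coll_sym by blast+
  \<comment> \<open>Any other neighbour would produce a second plane or a fourth class at
    \<open>x\<close>, the two excluded configurations.\<close>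
  have cls: "w \<frown> a \<or> (\<exists>r q. w = r *s x + q *s p1) \<or> (\<exists>r q. w = r *s x + q *s p2)" if w: "x \<frown> w" for w
  proof (rule ccontr)
    assume n: "\<not> (w \<frown> a \<or> (\<exists>r q. w = r *s x + q *s p1) \<or> (\<exists>r q. w = r *s x + q *s p2))"
    show False
    proof (cases "w \<frown> p1 \<or> w \<frown> p2")
      case True
      then show False
      proof
        assume "w \<frown> p1"
        from no_two_planes_and_line[OF x p(1) w coll_sym[OF this] _ p(2,3,4,5)] n show False by blast
      next
        assume "w \<frown> p2"
        from no_two_planes_and_line[OF x p(2) w coll_sym[OF this] _ p(1,4,3)] n p(5) coll_sym show False by blast
      qed
    next
      case False
      from no_plane_and_three_lines[OF x p(1,2) w p(3,4) _ p(5)] n False coll_sym show False by blast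
    qed
  qed
  from nbr_frame[OF p(1,2,5) x(1)] obtain \<xi> y where xi: "\<xi> \<in> \<Xi>" and f: "frame Z \<xi> x p1 p2 y" .
  note fv = frame_vertices[OF f]
  have a_out: "g \<notin> \<xi>" if g: "x \<frown> g" "g \<frown> a" "\<not> par x g" for g
  proof
    assume "g \<in> \<xi>"
    from frame_nbr_coll[OF f this g(1)]
    have "a \<frown> p1 \<or> a \<frown> p2"
      using coll_trans[OF x(2) g(1) p(1) coll_sym[OF g(2)] _ g(3) x(1)]
        coll_trans[OF x(2) g(1) p(2) coll_sym[OF g(2)] _ g(3) x(1)] by blast
    with p(3,4) show False by blast
  qed
  have np_g: "\<not> g \<frown> p1 \<and> \<not> g \<frown> p2" if g: "x \<frown> g" "g \<frown> a" "\<not> par x g" for g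
    using other_class[OF x(1,2) p(1,3) g] other_class[OF x(1,2) p(2,4) g] by blast
  \<comment> \<open>The point \<open>u\<close> is one of the two remaining vertices of the quadric
    on \<open>g\<close> and \<open>y\<close>: each is collinear with \<open>p1\<close> or
    \<open>p2\<close>, and they cannot both be collinear with \<open>p2\<close>.\<close>
  have key: "\<exists>u. u \<frown> g \<and> u \<frown> y \<and> u \<frown> p1 \<and> \<not> u \<frown> x"
    if g: "x \<frown> g" "g \<frown> a" "\<not> par x g" for g
  proof -
    have ngy: "\<not> g \<frown> y" using nbr_mem[OF coll_sym[OF g(1)] _ fv(17) xi fv(1,4)] a_out[OF g] by blast
    have gp: "\<not> g \<frown> p1" "\<not> g \<frown> p2" using np_g[OF g] by blast+
    have g0: "g \<noteq> 0" using g(3) par_zero by blast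
    have inner: "\<not> t \<frown> x \<and> (t \<frown> p1 \<or> t \<frown> p2)" if t: "g \<frown> t" "t \<frown> y" "t \<noteq> 0" for t
    proof -
      have tx: "\<not> t \<frown> x"
      proof
        assume h: "t \<frown> x"
        from common_nbr[OF xi f h t(2)] obtain k q where q: "t = k *s q" "q = p1 \<or> q = p2" by blast
        then have "k \<noteq> 0" using t(3) by auto
        with t(1) q coll_unscale_right gp show False by blast
      qed
      have nxt: "\<not> t \<frown> x" by (rule tx)
      from nbr_frame[OF t(1) coll_sym[OF g(1)] nxt g0] obtain \<eta> h where eta: "\<eta> \<in> \<Xi>" and k: "frame Z \<eta> g t x h" .
      note kv = frame_vertices[OF k]
      have nha: "\<not> h \<frown> a"
      proof
        assume "h \<frown> a"
        from coll_trans[OF kv(16) x(2) g(1) this coll_sym[OF g(2)] np(1) x(1)] kv(17) coll_sym show False by blast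
      qed
      then obtain r q pi where h: "h = r *s x + q *s pi" and pi: "pi = p1 \<or> pi = p2"
        using cls[OF kv(16)] by blast
      have h_in: "h \<in> \<xi>" unfolding h using mem_lin[OF xi fv(1)] fv(2,3) pi by blast
      have yp: "y \<frown> pi" using pi fv(15,16) coll_sym by blast
      \<comment> \<open>If not, \<open>h\<close> is not collinear with \<open>y\<close>, so
        \<open>t\<close> lies in \<open>\<xi>\<close> as their common neighbour, and then so does
        \<open>g\<close> as a common neighbour of \<open>t\<close> and \<open>x\<close>.\<close>
      have "r = 0"
      proof (rule ccontr)
        assume "r \<noteq> 0"
        have "\<not> h \<frown> y"
        proof
          assume hy: "h \<frown> y"
          have xe: "x = (- q / r) *s pi + (1 / r) *s h"
            by (rule solve_second[OF _ \<open>r \<noteq> 0\<close>]) (simp add: h add.commute)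
          have ph: "pi \<frown> h" unfolding h using pi coll_lin_mixed[OF p(1)] coll_lin_mixed[OF p(2)] by blast
          have "y \<frown> x" unfolding xe by (rule coll_add[OF fv(12) yp coll_sym[OF hy] ph])
          with fv(17) coll_sym show False by blast
        qed
        from nbr_mem[OF kv(15) t(2) this xi h_in fv(4)] have "t \<in> \<xi>" .
        from nbr_mem[OF t(1) coll_sym[OF g(1)] nxt xi this fv(1)] a_out[OF g] show False by blast
      qed
      with h have hq: "h = q *s pi" by simp
      with kv(12) have "q \<noteq> 0" by auto
      with kv(15) hq coll_unscale_right have "t \<frown> pi" by blast
      with tx pi show ?thesis by blast
    qed
    from opp_frame[OF coll_left[OF g(2)] fv(8) ngy] obtain \<eta> u v where eta: "\<eta> \<in> \<Xi>" and k: "frame Z \<eta> g u v y" .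
    note kv = frame_vertices[OF k]
    have iu: "\<not> u \<frown> x \<and> (u \<frown> p1 \<or> u \<frown> p2)" by (rule inner[OF kv(13,15,10)])
    have iv: "\<not> v \<frown> x \<and> (v \<frown> p1 \<or> v \<frown> p2)" by (rule inner[OF kv(14,16,11)])
    \<comment> \<open>Otherwise \<open>u\<close> and \<open>v\<close> are both common neighbours of
      \<open>g\<close> and \<open>p2\<close> other than \<open>x\<close>, hence multiples of one
      vertex and collinear.\<close>
    have "u \<frown> p1 \<or> v \<frown> p1"
    proof (rule ccontr)
      assume "\<not> (u \<frown> p1 \<or> v \<frown> p1)"
      then have uv: "u \<frown> p2" "v \<frown> p2" using iu iv by blast+
      from nbr_frame[OF g(1) p(2) gp(2) x(1)] obtain \<zeta> e where ze: "\<zeta> \<in> \<Xi>" and l: "frame Z \<zeta> x g p2 e" .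
      note lr = frame_rot[OF l]
      have xx: "x \<frown> k *s x" for k by (rule coll_self[OF coll_left[OF x(2)]])
      obtain m where m: "u = m *s e" using common_nbr[OF ze lr coll_sym[OF kv(13)] uv(1)] iu xx coll_sym by metis
      obtain m' where m': "v = m' *s e" using common_nbr[OF ze lr coll_sym[OF kv(14)] uv(2)] iv xx coll_sym by metis
      have "m *s e \<frown> m' *s e" using coll_lin[OF coll_self[OF frame_vertices(8)[OF l], of 1], of m 0 m' 0] by simp
      with m m' kv(18) show False by blast
    qed
    then show ?thesis using iu iv kv coll_sym by blast
  qed
  have "w \<frown> x \<or> w \<frown> y" if w: "p1 \<frown> w" for w
  proof (rule ccontr)
    assume n: "\<not> (w \<frown> x \<or> w \<frown> y)"
    from nbr_frame[OF w coll_sym[OF p(1)] _ fv(10)] n obtain \<eta> g where eta: "\<eta> \<in> \<Xi>" and k: "frame Z \<eta> p1 w x g" by blast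
    note kv = frame_vertices[OF k]
    from cls[OF kv(16)] consider "g \<frown> a" | r q where "g = r *s x + q *s p1" | r q where "g = r *s x + q *s p2" by blast
    then show False
    proof cases
      case 1
      have npg: "\<not> par x g" using par_coll_all[OF _ p(1)] kv(17) by blast
      from key[OF kv(16) 1 npg] obtain u where u: "u \<frown> g" "u \<frown> y" "u \<frown> p1" "\<not> u \<frown> x" by blast
      from common_nbr[OF eta k u(3,1)] obtain m where m: "u = m *s w"
        using u(4) coll_self[OF coll_left[OF x(2)]] coll_sym by blast
      have "m \<noteq> 0"
      proof
        assume "m = 0"
        then have "u = 0" using m by simp
        with u(4) coll_zero[OF coll_left[OF x(2)]] coll_sym show False by blast
      qed
      then have "w \<frown> y" using u(2) m coll_unscale_right coll_sym by blast
      with n show False by blast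
    next
      case 2
      then have "g \<frown> p1" using coll_lin_mixed[OF p(1)] coll_sym by blast
      with kv(17) coll_sym show False by blast
    next
      case 3
      then have "g \<in> \<xi>" using mem_lin[OF xi fv(1,3)] by simp
      from nbr_mem[OF coll_sym[OF w] kv(15) kv(17) xi fv(2) this] have "w \<in> \<xi>" .
      from frame_nbr_coll[OF frame_rot[OF f] this w] n show False by blast
    qed
  qed
  then show ?thesis unfolding two_classes_def using coll_sym[OF p(1)] fv(15,17) by blast
qed

lemma no_planes:
  assumes nt: "\<And>p. p \<in> Z \<Longrightarrow> p \<noteq> 0 \<Longrightarrow> \<not> two_classes p"
    and x: "x \<noteq> 0" "x \<frown> a" "x \<frown> a'" "a \<frown> a'" "\<not> par x a"
  shows "\<exists>p q. a' = p *s x + q *s a"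
proof (rule ccontr)
  assume "\<not> ?thesis"
  then have n: "\<forall>p q. a' \<noteq> p *s x + q *s a" by blast
  from nbr_off[OF x(1,2,5)] obtain p1 where p1: "x \<frown> p1" "\<not> p1 \<frown> a" .
  from nt[OF coll_left[OF x(2)] x(1)] x(2) p1 obtain p2 where p2: "x \<frown> p2" "\<not> p2 \<frown> p1" "\<not> p2 \<frown> a"
    unfolding two_classes_def by blast
  have "two_classes p1"
    by (rule two_classes_near_plane[OF x(1-4) n p1(1) p2(1)]) (use p1 p2 coll_sym in blast)+
  moreover have "p1 \<noteq> 0" using p1(2) coll_zero[OF coll_right[OF x(2)]] coll_sym by blast
  ultimately show False using nt coll_right[OF p1(1)] by blast
qed

section \<open>Lines far from a point\<close>

text \<open>Conjugacy to \<open>y\<close> is a single linear condition on the two coefficients, so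
  it has a nontrivial solution.\<close>

lemma line_meets:
  assumes "\<xi> \<in> \<Xi>" "y \<in> \<xi>" "t \<in> \<xi>" "t' \<in> \<xi>" "y \<in> Z" "t \<frown> t'"
  obtains a b where "a \<noteq> 0 \<or> b \<noteq> 0" "y \<frown> a *s t + b *s t'"
proof -
  from frame_exists[OF assms(1)] obtain x p q r where f: "frame Z \<xi> x p q r" by blast
  from frame_ex[OF f assms(2)] obtain a0 b0 c0 d0 where y: "y = a0 *s x + b0 *s p + c0 *s q + d0 *s r" .
  from frame_ex[OF f assms(3)] obtain a1 b1 c1 d1 where t: "t = a1 *s x + b1 *s p + c1 *s q + d1 *s r" .
  from frame_ex[OF f assms(4)] obtain a2 b2 c2 d2 where t': "t' = a2 *s x + b2 *s p + c2 *s q + d2 *s r" .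
  define k1 where "k1 = a0 * d1 + d0 * a1 - (b0 * c1 + c0 * b1)"
  define k2 where "k2 = a0 * d2 + d0 * a2 - (b0 * c2 + c0 * b2)"
  have zy: "a0 * d0 = b0 * c0" using assms(5) unfolding y frame_Z[OF f] .
  have main: "y \<frown> a *s t + b *s t'" if "a * k1 + b * k2 = 0" for a b
  proof -
    have e: "a *s t + b *s t' = (a * a1 + b * a2) *s x + (a * b1 + b * b2) *s p + (a * c1 + b * c2) *s q + (a * d1 + b * d2) *s r"
      unfolding t t' by (simp add: vec_eq_iff algebra_simps)
    have z: "(a * a1 + b * a2) * (a * d1 + b * d2) = (a * b1 + b * b2) * (a * c1 + b * c2)"
      using coll_D[OF assms(6), of a b] unfolding e frame_Z[OF f] .
    have "a0 * (a * d1 + b * d2) + d0 * (a * a1 + b * a2) - (b0 * (a * c1 + b * c2) + c0 * (a * b1 + b * b2)) = a * k1 + b * k2"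
      unfolding k1_def k2_def by (simp add: algebra_simps)
    then show ?thesis unfolding e unfolding y frame_coll_iff[OF f zy z] using that by simp
  qed
  show thesis
  proof (cases "k1 = 0 \<and> k2 = 0")
    case True
    then show thesis using that[of 1 0] main[of 1 0] by simp
  next
    case False
    have "k2 \<noteq> 0 \<or> - k1 \<noteq> 0" using False by auto
    moreover have "y \<frown> k2 *s t + (- k1) *s t'" by (rule main) (simp add: algebra_simps)
    ultimately show thesis by (rule that)
  qed
qed

text \<open>\<open>four_classes\<close> kills the coefficient of its last vector; it is applied with
  each of the four representatives in that place.\<close>

lemma class_coeffs:
  assumes "x \<noteq> 0" "x \<frown> a" "x \<frown> b" "x \<frown> c" "x \<frown> d"
    and n: "\<not> a \<frown> b" "\<not> a \<frown> c" "\<not> a \<frown> d" "\<not> b \<frown> c" "\<not> b \<frown> d" "\<not> c \<frown> d"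
    and e: "k *s x + k1 *s a + k2 *s b + k3 *s c + k4 *s d = 0"
  shows "k = 0 \<and> k1 = 0 \<and> k2 = 0 \<and> k3 = 0 \<and> k4 = 0"
proof -
  have np: "\<not> par x a" "\<not> par x b" "\<not> par x c" "\<not> par x d"
    using par_coll_all assms coll_sym by blast+
  have sc: "par x (r *s u) \<or> par x (s *s v) \<or> \<not> r *s u \<frown> s *s v" if "\<not> u \<frown> v" for r s u v
  proof (cases "r = 0 \<or> s = 0")
    case True
    then show ?thesis by (elim disjE) (simp_all add: par_zero)
  next
    case False
    then show ?thesis using that coll_unscale_right coll_sym by metis
  qed
  have last: "l4 = 0" if "x \<frown> a" "x \<frown> b" "x \<frown> c" "x \<frown> d" "\<not> a \<frown> b" "\<not> a \<frown> c" "\<not> a \<frown> d" "\<not> b \<frown> c" "\<not> b \<frown> d" "\<not> c \<frown> d"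
    "l *s x + l1 *s a + l2 *s b + l3 *s c + l4 *s d = 0" "\<not> par x d" for a b c d l l1 l2 l3 l4
    using four_classes[OF assms(1) coll_scale_right[OF that(1)] coll_scale_right[OF that(2)] coll_scale_right[OF that(3)]
        coll_scale_right[OF that(4)] sc[OF that(5)] sc[OF that(6)] sc[OF that(7)] sc[OF that(8)] sc[OF that(9)] sc[OF that(10)] that(11)]
      par_scale_cancel that(12) by blast
  have ns: "\<not> b \<frown> a" "\<not> c \<frown> a" "\<not> d \<frown> a" "\<not> c \<frown> b" "\<not> d \<frown> b" "\<not> d \<frown> c" using n coll_sym by blast+
  have 4: "k4 = 0" by (rule last[OF assms(2-5) n e np(4)])
  have e3: "k *s x + k1 *s a + k2 *s b + k4 *s d + k3 *s c = 0" using e by (simp add: algebra_simps)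
  have 3: "k3 = 0" by (rule last[OF assms(2,3,5,4) n(1,3,2,5,4) ns(6) e3 np(3)])
  have e2: "k *s x + k1 *s a + k3 *s c + k4 *s d + k2 *s b = 0" using e by (simp add: algebra_simps)
  have 2: "k2 = 0" by (rule last[OF assms(2,4,5,3) n(2,3,1,6) ns(4,5) e2 np(2)])
  have e1: "k *s x + k2 *s b + k3 *s c + k4 *s d + k1 *s a = 0" using e by (simp add: algebra_simps)
  have 1: "k1 = 0" by (rule last[OF assms(3,4,5,2) n(4,5) ns(1) n(6) ns(2,3) e1 np(1)])
  have "k *s x = 0" using e 1 2 3 4 by simp
  with assms(1) have "k = 0" using vec.scale_eq_0_iff by blast
  with 1 2 3 4 show ?thesis by blast
qed

text \<open>The vector \<open>x\<close> and four representatives of different classes are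
  independent, so they exhaust a tangent space of dimension at most 5.\<close>

lemma four_classes_span:
  assumes "x \<noteq> 0" "x \<frown> a" "x \<frown> b" "x \<frown> c" "x \<frown> d"
    and n: "\<not> a \<frown> b" "\<not> a \<frown> c" "\<not> a \<frown> d" "\<not> b \<frown> c" "\<not> b \<frown> d" "\<not> c \<frown> d"
    and w: "x \<frown> w"
  obtains k k1 k2 k3 k4 where "w = k *s x + k1 *s a + k2 *s b + k3 *s c + k4 *s d"
proof -
  from six_nbrs[OF assms(1-5) w] obtain a1 a2 a3 a4 a5 a6 where
    e: "a1 *s x + a2 *s a + a3 *s b + a4 *s c + a5 *s d + a6 *s w = 0"
    and nz: "\<not> (a1 = 0 \<and> a2 = 0 \<and> a3 = 0 \<and> a4 = 0 \<and> a5 = 0 \<and> a6 = 0)" .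
  have "a6 \<noteq> 0"
  proof
    assume "a6 = 0"
    with e have "a1 *s x + a2 *s a + a3 *s b + a4 *s c + a5 *s d = 0" by simp
    from class_coeffs[OF assms(1-5) n this] nz \<open>a6 = 0\<close> show False by blast
  qed
  define i where "i = inverse a6"
  have i: "i * a6 = 1" unfolding i_def using \<open>a6 \<noteq> 0\<close> by simp
  have "w = i *s (a6 *s w)" using i by (simp add: vec_eq_iff mult.assoc[symmetric])
  also have "a6 *s w = - (a1 *s x + a2 *s a + a3 *s b + a4 *s c + a5 *s d)"
    using e by (metis add.commute eq_neg_iff_add_eq_0)
  also have "i *s \<dots> = (- (i * a1)) *s x + (- (i * a2)) *s a + (- (i * a3)) *s b + (- (i * a4)) *s c + (- (i * a5)) *s d"
    by (simp add: vec_eq_iff algebra_simps)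
  finally show thesis by (rule that)
qed

text \<open>Projectively: \<open>y\<close> is collinear with no point of the line
  \<open>x p\<close>. Such a line cannot share a quadric space with \<open>y\<close>.\<close>

definition far :: "'a ^ 'n \<Rightarrow> 'a ^ 'n \<Rightarrow> 'a ^ 'n \<Rightarrow> bool" where
  "far y x p \<longleftrightarrow> y \<in> Z \<and> x \<frown> p \<and> (\<forall>r s. r \<noteq> 0 \<or> s \<noteq> 0 \<longrightarrow> \<not> y \<frown> r *s x + s *s p)"

lemma farD: "far y x p \<Longrightarrow> r \<noteq> 0 \<or> s \<noteq> 0 \<Longrightarrow> \<not> y \<frown> r *s x + s *s p"
  unfolding far_def by blast

lemma far_coll: "far y x p \<Longrightarrow> x \<frown> p"
  unfolding far_def by blast

lemma far_Z: "far y x p \<Longrightarrow> y \<in> Z"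
  unfolding far_def by blast

lemma far_first: "far y x p \<Longrightarrow> \<not> y \<frown> x"
  using farD[of y x p 1 0] by simp

lemma far_second: "far y x p \<Longrightarrow> \<not> y \<frown> p"
  using farD[of y x p 0 1] by simp

lemma far_nonzero:
  assumes "far y x p" "r \<noteq> 0 \<or> s \<noteq> 0" shows "r *s x + s *s p \<noteq> 0"
  using farD[OF assms] coll_zero assms(1) unfolding far_def by metis

lemma far_outside:
  assumes "far y x p" "\<xi> \<in> \<Xi>" "x \<in> \<xi>" "p \<in> \<xi>" shows "y \<notin> \<xi>"
proof
  assume "y \<in> \<xi>"
  from line_meets[OF assms(2) this assms(3,4) far_Z[OF assms(1)] far_coll[OF assms(1)]]
  obtain a b where "a \<noteq> 0 \<or> b \<noteq> 0" "y \<frown> a *s x + b *s p" .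
  with farD[OF assms(1)] show False by blast
qed

text \<open>The source of far lines: if \<open>y\<close> were collinear with a point of the line
  other than \<open>x\<close>, that point would be a common neighbour of \<open>x\<close> and
  \<open>y\<close> and draw \<open>p\<close> into \<open>\<xi>\<close>.\<close>

lemma far_intro:
  assumes "\<xi> \<in> \<Xi>" "x \<in> \<xi>" "y \<in> \<xi>" "y \<in> Z" "\<not> x \<frown> y" "x \<frown> p" "p \<notin> \<xi>"
  shows "far y x p"
  unfolding far_def
proof (intro conjI allI impI notI)
  fix r s assume rs: "r \<noteq> 0 \<or> s \<noteq> 0" and h: "y \<frown> r *s x + s *s p"
  show False
  proof (cases "s = 0")
    case True
    with rs h coll_unscale_right[of Z y r x] assms(5) coll_sym show False by auto
  next
    case False
    have "x \<frown> r *s x + s *s p" using coll_lin[OF assms(6), of 1 0 r s] by simp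
    from nbr_mem[OF coll_sym[OF this] coll_sym[OF h] assms(5,1,2,3)] have "r *s x + s *s p \<in> \<xi>" .
    then have "(- r / s) *s x + (1 / s) *s (r *s x + s *s p) \<in> \<xi>" by (rule mem_lin[OF assms(1,2)])
    with solve_second[OF refl[of "r *s x + s *s p"] False] assms(7) show False by simp
  qed
qed (use assms in auto)

end

section \<open>Cones in which every class is a single line\<close>

locale arc_cone = grid_cone Z \<Xi> for Z :: "('a::field ^ 'n) set" and \<Xi> +
  assumes no_plane: "x \<noteq> 0 \<Longrightarrow> x \<frown> a \<Longrightarrow> x \<frown> b \<Longrightarrow> a \<frown> b \<Longrightarrow> \<not> par x a \<Longrightarrow> \<exists>p q. b = p *s x + q *s a"
    and third: "x \<noteq> 0 \<Longrightarrow> x \<frown> u \<Longrightarrow> x \<frown> v \<Longrightarrow> \<not> u \<frown> v \<Longrightarrow> \<exists>w. x \<frown> w \<and> \<not> w \<frown> u \<and> \<not> w \<frown> v"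
    and span_Z: "vec.span Z = UNIV"
begin

lemma far_nbr_off_line:
  assumes "far y x p" "u \<frown> y" "u \<noteq> 0" shows "u \<noteq> r *s x + s *s p"
proof
  assume e: "u = r *s x + s *s p"
  then have "r \<noteq> 0 \<or> s \<noteq> 0" using assms(3) by auto
  from farD[OF assms(1) this] e assms(2) coll_sym show False by blast
qed

text \<open>A vector collinear with two points of a line lies on that line, since classes are lines;
  but \<open>y\<close> has no neighbour on a far line. The determinant says that the two points
  differ.\<close>

lemma far_nbr_ncoll:
  assumes fr: "far y x p" and u: "u \<frown> y" "u \<frown> r *s x + s *s p" "u \<noteq> 0"
    and d: "r * s' - r' * s \<noteq> 0"
  shows "\<not> u \<frown> r' *s x + s' *s p"
proof
  let ?t = "r *s x + s *s p" and ?t' = "r' *s x + s' *s p"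
  assume h: "u \<frown> ?t'"
  have t0: "?t \<noteq> 0" by (rule far_nonzero[OF fr]) (use d in auto)
  have tt: "?t \<frown> ?t'" by (rule coll_lin[OF far_coll[OF fr]])
  have "\<not> par ?t ?t'"
  proof
    assume "par ?t ?t'"
    then obtain k where "?t' = k *s ?t" unfolding par_def by blast
    then have "(r' - k * r) *s x + (s' - k * s) *s p = 0" by (simp add: vec_eq_iff algebra_simps)
    then have "r' = k * r \<and> s' = k * s" using far_nonzero[OF fr, of "r' - k * r" "s' - k * s"] by auto
    with d show False by (simp add: algebra_simps)
  qed
  from no_plane[OF t0 tt coll_sym[OF u(2)] coll_sym[OF h] this]
  obtain a b where "u = a *s ?t + b *s ?t'" by blast
  then have "u = (a * r + b * r') *s x + (a * s + b * s') *s p" by (simp add: vec_eq_iff algebra_simps)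
  with far_nbr_off_line[OF fr u(1,3)] show False by blast
qed

text \<open>Collinear \<open>u\<close>, \<open>u'\<close> would be collinear on one line through
  \<open>y\<close>. The quadric on \<open>?t\<close> and \<open>u'\<close> then contains
  \<open>u\<close>, hence \<open>y\<close>, and also \<open>?t'\<close>, so the far line would have
  a point collinear with \<open>y\<close>. In consequence each point of a far line contributes two
  new lines through \<open>y\<close>.\<close>

lemma far_pairs:
  assumes fr: "far y x p" and u: "u \<frown> y" "u \<frown> r *s x + s *s p" "u \<noteq> 0"
    and u': "u' \<frown> y" "u' \<frown> r' *s x + s' *s p" "u' \<noteq> 0" and d: "r * s' - r' * s \<noteq> 0"
  shows "\<not> u \<frown> u'"
proof
  let ?t = "r *s x + s *s p" and ?t' = "r' *s x + s' *s p"
  assume h: "u \<frown> u'"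
  have rs: "r \<noteq> 0 \<or> s \<noteq> 0" using d by auto
  have d': "r' * s - r * s' \<noteq> 0" using d by (simp add: algebra_simps)
  have tt: "?t \<frown> ?t'" by (rule coll_lin[OF far_coll[OF fr]])
  have n: "\<not> u' \<frown> ?t" by (rule far_nbr_ncoll[OF fr u' d'])
  have y0: "y \<noteq> 0" using far_first[OF fr] coll_zero[OF coll_left[OF far_coll[OF fr]]] coll_sym by blast
  have "\<not> par y u"
  proof
    assume "par y u"
    then have "par u y" using par_sym u(3) by blast
    from par_coll[OF this u(2)] farD[OF fr rs] show False by blast
  qed
  from no_plane[OF y0 coll_sym[OF u(1)] coll_sym[OF u'(1)] h this]
  obtain a b where e: "u' = a *s y + b *s u" by blast
  have "a \<noteq> 0"
  proof
    assume "a = 0"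
    then have "u' = b *s u" using e by simp
    then have "?t \<frown> u'" using coll_scale_right[OF coll_sym[OF u(2)]] by simp
    with n coll_sym show False by blast
  qed
  have tZ: "?t \<in> Z" using coll_left[OF tt] .
  have n': "\<not> ?t \<frown> u'" using n coll_sym by blast
  from opp_frame[OF tZ coll_left[OF u'(1)] n'] obtain \<xi> a1 b1 where xi: "\<xi> \<in> \<Xi>" and f: "frame Z \<xi> ?t a1 b1 u'" .
  note fv = frame_vertices[OF f]
  have "u \<in> \<xi>" by (rule nbr_mem[OF u(2) h n' xi fv(1,4)])
  then have "(- b / a) *s u + (1 / a) *s u' \<in> \<xi>" using mem_lin[OF xi _ fv(4)] by blast
  moreover have "y = (- b / a) *s u + (1 / a) *s u'"
    by (rule solve_second[OF _ \<open>a \<noteq> 0\<close>]) (simp add: e add.commute)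
  ultimately have yx: "y \<in> \<xi>" by simp
  have "?t' \<in> \<xi>" by (rule nbr_mem[OF coll_sym[OF tt] coll_sym[OF u'(2)] n' xi fv(1,4)])
  from line_meets[OF xi yx fv(1) this far_Z[OF fr] tt] obtain k l where kl: "k \<noteq> 0 \<or> l \<noteq> 0" "y \<frown> k *s ?t + l *s ?t'" .
  have "k *s ?t + l *s ?t' = (k * r + l * r') *s x + (k * s + l * s') *s p" by (simp add: vec_eq_iff algebra_simps)
  moreover have "k * r + l * r' \<noteq> 0 \<or> k * s + l * s' \<noteq> 0"
  proof (rule ccontr)
    assume "\<not> ?thesis"
    then have z: "k * r + l * r' = 0" "k * s + l * s' = 0" by auto
    have "k * (r * s' - r' * s) = (k * r + l * r') * s' - (k * s + l * s') * r'" by (simp add: algebra_simps)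
    moreover have "l * (r * s' - r' * s) = (k * s + l * s') * r - (k * r + l * r') * s" by (simp add: algebra_simps)
    ultimately show False using z d kl(1) by simp
  qed
  ultimately show False using farD[OF fr] kl(2) by metis
qed

lemma far_exists:
  assumes "y \<in> Z" "y \<noteq> 0" obtains x p where "far y x p"
proof -
  from nbrs_exist[OF assms] obtain u v where uv: "y \<frown> u" "y \<frown> v" "\<not> u \<frown> v" .
  from nbr_frame[OF uv assms(2)] obtain \<xi> x where xi: "\<xi> \<in> \<Xi>" and f: "frame Z \<xi> y u v x" .
  note fv = frame_vertices[OF f]
  from third[OF fv(12) coll_sym[OF fv(15)] coll_sym[OF fv(16)] uv(3)] obtain w where w: "x \<frown> w" "\<not> w \<frown> u" "\<not> w \<frown> v" by blast
  have "w \<notin> \<xi>" using frame_nbr_coll[OF frame_rev[OF f] _ w(1)] w by blast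
  from far_intro[OF xi fv(4,1) assms(1) _ w(1) this] fv(17) coll_sym that show thesis by blast
qed

lemma far_nbrs:
  assumes "far y x p" "r \<noteq> 0 \<or> s \<noteq> 0"
  obtains u v where "u \<frown> y" "u \<frown> r *s x + s *s p" "v \<frown> y" "v \<frown> r *s x + s *s p" "\<not> u \<frown> v" "u \<noteq> 0" "v \<noteq> 0"
proof -
  have "r *s x + s *s p \<in> Z" using coll_D[OF far_coll[OF assms(1)]] .
  from opp_frame[OF far_Z[OF assms(1)] this farD[OF assms]] obtain \<xi> u v where f: "frame Z \<xi> y u v (r *s x + s *s p)" by blast
  note fv = frame_vertices[OF f]
  show thesis by (rule that[OF coll_sym[OF fv(13)] fv(15) coll_sym[OF fv(14)] fv(16,18,10,11)])
qed

text \<open>Needed for the root count of a cubic and for six points on a far line. The three points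
  \<open>x\<close>, \<open>p\<close>, \<open>x + p\<close> give six lines through \<open>y\<close>;
  expressing the last two in terms of \<open>y\<close> and the first four, the ratios of
  corresponding coefficients are four distinct nonzero scalars.\<close>

lemma five_scalars:
  assumes "Z \<noteq> {0}" "Z \<noteq> {}"
  obtains c1 c2 c3 c4 :: 'a where "distinct [0, c1, c2, c3, c4]"
proof -
  from assms obtain y where y: "y \<in> Z" "y \<noteq> 0" by blast
  from far_exists[OF y] obtain x p where fr: "far y x p" .
  from far_nbrs[OF fr, of 1 0] obtain u0 v0 where 0: "u0 \<frown> y" "u0 \<frown> 1 *s x + 0 *s p" "v0 \<frown> y" "v0 \<frown> 1 *s x + 0 *s p" "\<not> u0 \<frown> v0" "u0 \<noteq> 0" "v0 \<noteq> 0"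
    by auto
  from far_nbrs[OF fr, of 0 1] obtain u1 v1 where 1: "u1 \<frown> y" "u1 \<frown> 0 *s x + 1 *s p" "v1 \<frown> y" "v1 \<frown> 0 *s x + 1 *s p" "\<not> u1 \<frown> v1" "u1 \<noteq> 0" "v1 \<noteq> 0"
    by auto
  from far_nbrs[OF fr, of 1 1] obtain u2 v2 where 2: "u2 \<frown> y" "u2 \<frown> 1 *s x + 1 *s p" "v2 \<frown> y" "v2 \<frown> 1 *s x + 1 *s p" "\<not> u2 \<frown> v2" "u2 \<noteq> 0" "v2 \<noteq> 0"
    by auto
  have nc: "\<not> u0 \<frown> u1" "\<not> u0 \<frown> v1" "\<not> v0 \<frown> u1" "\<not> v0 \<frown> v1"
    "\<not> u0 \<frown> u2" "\<not> u0 \<frown> v2" "\<not> v0 \<frown> u2" "\<not> v0 \<frown> v2"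
    "\<not> u1 \<frown> u2" "\<not> u1 \<frown> v2" "\<not> v1 \<frown> u2" "\<not> v1 \<frown> v2"
    using far_pairs[OF fr 0(1,2,6) 1(1,2,6)] far_pairs[OF fr 0(1,2,6) 1(3,4,7)]
      far_pairs[OF fr 0(3,4,7) 1(1,2,6)] far_pairs[OF fr 0(3,4,7) 1(3,4,7)]
      far_pairs[OF fr 0(1,2,6) 2(1,2,6)] far_pairs[OF fr 0(1,2,6) 2(3,4,7)]
      far_pairs[OF fr 0(3,4,7) 2(1,2,6)] far_pairs[OF fr 0(3,4,7) 2(3,4,7)]
      far_pairs[OF fr 1(1,2,6) 2(1,2,6)] far_pairs[OF fr 1(1,2,6) 2(3,4,7)]
      far_pairs[OF fr 1(3,4,7) 2(1,2,6)] far_pairs[OF fr 1(3,4,7) 2(3,4,7)] by simp_all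
  have ys: "y \<frown> u0" "y \<frown> v0" "y \<frown> u1" "y \<frown> v1" "y \<frown> u2" "y \<frown> v2" using 0 1 2 coll_sym by blast+
  have basis: "\<exists>k k1 k2 k3 k4. w = k *s y + k1 *s u0 + k2 *s v0 + k3 *s u1 + k4 *s v1" if "y \<frown> w" for w
    using four_classes_span[OF y(2) ys(1-4) 0(5) nc(1,2,3,4) 1(5) that] by metis
  from basis[OF ys(5)] obtain a a1 a2 a3 a4 where a: "u2 = a *s y + a1 *s u0 + a2 *s v0 + a3 *s u1 + a4 *s v1" by blast
  from basis[OF ys(6)] obtain b b1 b2 b3 b4 where b: "v2 = b *s y + b1 *s u0 + b2 *s v0 + b3 *s u1 + b4 *s v1" by blast
  have rel: "r = 0 \<and> s = 0" if "k *s y + r *s u2 + s *s v2 + k3 *s g + k4 *s h = 0"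
    "{g, h} \<subseteq> {u0, v0, u1, v1}" "\<not> g \<frown> h" for k r s k3 k4 g h
  proof -
    have g: "y \<frown> g" "y \<frown> h" "\<not> u2 \<frown> g" "\<not> u2 \<frown> h" "\<not> v2 \<frown> g" "\<not> v2 \<frown> h" using that(2) ys nc coll_sym by blast+
    from class_coeffs[OF y(2) ys(5,6) g(1,2) 2(5) g(3-6) that(3,1)] show ?thesis by blast
  qed
  have nz: "b1 \<noteq> 0 \<and> b2 \<noteq> 0 \<and> b3 \<noteq> 0 \<and> b4 \<noteq> 0 \<and> a1 \<noteq> 0 \<and> a2 \<noteq> 0 \<and> a3 \<noteq> 0 \<and> a4 \<noteq> 0"
  proof -
    have one: "c1 \<noteq> 0 \<and> c2 \<noteq> 0 \<and> c3 \<noteq> 0 \<and> c4 \<noteq> 0"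
      if w: "w = c *s y + c1 *s u0 + c2 *s v0 + c3 *s u1 + c4 *s v1" "w = u2 \<or> w = v2" for w c c1 c2 c3 c4
    proof -
      have g: "y \<frown> w" "\<not> u0 \<frown> w" "\<not> v0 \<frown> w" "\<not> u1 \<frown> w" "\<not> v1 \<frown> w" using w(2) ys nc by blast+
      have e: "(- c) *s y + (- c1) *s u0 + (- c2) *s v0 + (- c3) *s u1 + (- c4) *s v1 + 1 *s w = 0"
        unfolding w(1) by (simp add: vec_eq_iff)
      have "c1 \<noteq> 0"
      proof
        assume "c1 = 0"
        then have "(- c) *s y + (- c2) *s v0 + (- c3) *s u1 + (- c4) *s v1 + 1 *s w = 0" using e by simp
        from class_coeffs[OF y(2) ys(2,3,4) g(1) nc(3,4) g(3) 1(5) g(4,5) this] show False by simp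
      qed
      moreover have "c2 \<noteq> 0"
      proof
        assume "c2 = 0"
        then have "(- c) *s y + (- c1) *s u0 + (- c3) *s u1 + (- c4) *s v1 + 1 *s w = 0" using e by simp
        from class_coeffs[OF y(2) ys(1,3,4) g(1) nc(1,2) g(2) 1(5) g(4,5) this] show False by simp
      qed
      moreover have "c3 \<noteq> 0"
      proof
        assume "c3 = 0"
        then have "(- c) *s y + (- c1) *s u0 + (- c2) *s v0 + (- c4) *s v1 + 1 *s w = 0" using e by simp
        from class_coeffs[OF y(2) ys(1,2,4) g(1) 0(5) nc(2) g(2) nc(4) g(3,5) this] show False by simp
      qed
      moreover have "c4 \<noteq> 0"
      proof
        assume "c4 = 0"
        then have "(- c) *s y + (- c1) *s u0 + (- c2) *s v0 + (- c3) *s u1 + 1 *s w = 0" using e by simp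
        from class_coeffs[OF y(2) ys(1,2,3) g(1) 0(5) nc(1) g(2) nc(3) g(3,4) this] show False by simp
      qed
      ultimately show ?thesis by blast
    qed
    from one[OF a] one[OF b] show ?thesis by blast
  qed
  have sp: "(r * a + s * b) *s y + (r * a1 + s * b1) *s u0 + (r * a2 + s * b2) *s v0 + (r * a3 + s * b3) *s u1 + (r * a4 + s * b4) *s v1
     = r *s u2 + s *s v2" for r s unfolding a b by (simp add: vec_eq_iff algebra_simps)
  \<comment> \<open>Equal ratios allow a combination of \<open>u2\<close> and \<open>v2\<close> in
    which two of the four vectors cancel. That is a relation among \<open>y\<close> and four
    different classes.\<close>
  have ratio: "a1 / b1 \<noteq> a2 / b2" "a1 / b1 \<noteq> a3 / b3" "a1 / b1 \<noteq> a4 / b4" "a2 / b2 \<noteq> a3 / b3" "a2 / b2 \<noteq> a4 / b4" "a3 / b3 \<noteq> a4 / b4"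
  proof -
    have ex: False if "r \<noteq> 0" "(r * a + s * b) *s y + k1 *s g + k2 *s h = r *s u2 + s *s v2"
      "{g, h} \<subseteq> {u0, v0, u1, v1}" "\<not> g \<frown> h" for r s k1 k2 g h
    proof -
      have "(- (r * a + s * b)) *s y + r *s u2 + s *s v2 + (- k1) *s g + (- k2) *s h = 0"
        unfolding that(2)[symmetric] add.assoc using that(2)[symmetric] by (simp add: vec_eq_iff algebra_simps)
      from rel[OF this that(3,4)] that(1) show False by blast
    qed
    show "a1 / b1 \<noteq> a2 / b2"
    proof
      assume "a1 / b1 = a2 / b2"
      then have z: "b1 * a1 + - a1 * b1 = 0" "b1 * a2 + - a1 * b2 = 0" using nz by (simp_all add: field_simps)
      have "(b1 * a + - a1 * b) *s y + (b1 * a3 + - a1 * b3) *s u1 + (b1 * a4 + - a1 * b4) *s v1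
        = b1 *s u2 + (- a1) *s v2" using sp[of "b1" "- a1"] unfolding z by simp
      from ex[OF _ this] nz nc 0(5) 1(5) show False by blast
    qed
    show "a1 / b1 \<noteq> a3 / b3"
    proof
      assume "a1 / b1 = a3 / b3"
      then have z: "b1 * a1 + - a1 * b1 = 0" "b1 * a3 + - a1 * b3 = 0" using nz by (simp_all add: field_simps)
      have "(b1 * a + - a1 * b) *s y + (b1 * a2 + - a1 * b2) *s v0 + (b1 * a4 + - a1 * b4) *s v1
        = b1 *s u2 + (- a1) *s v2" using sp[of "b1" "- a1"] unfolding z by simp
      from ex[OF _ this] nz nc 0(5) 1(5) show False by blast
    qed
    show "a1 / b1 \<noteq> a4 / b4"
    proof
      assume "a1 / b1 = a4 / b4"
      then have z: "b1 * a1 + - a1 * b1 = 0" "b1 * a4 + - a1 * b4 = 0" using nz by (simp_all add: field_simps)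
      have "(b1 * a + - a1 * b) *s y + (b1 * a2 + - a1 * b2) *s v0 + (b1 * a3 + - a1 * b3) *s u1
        = b1 *s u2 + (- a1) *s v2" using sp[of "b1" "- a1"] unfolding z by simp
      from ex[OF _ this] nz nc 0(5) 1(5) show False by blast
    qed
    show "a2 / b2 \<noteq> a3 / b3"
    proof
      assume "a2 / b2 = a3 / b3"
      then have z: "b2 * a2 + - a2 * b2 = 0" "b2 * a3 + - a2 * b3 = 0" using nz by (simp_all add: field_simps)
      have "(b2 * a + - a2 * b) *s y + (b2 * a1 + - a2 * b1) *s u0 + (b2 * a4 + - a2 * b4) *s v1
        = b2 *s u2 + (- a2) *s v2" using sp[of "b2" "- a2"] unfolding z by simp
      from ex[OF _ this] nz nc 0(5) 1(5) show False by blast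
    qed
    show "a2 / b2 \<noteq> a4 / b4"
    proof
      assume "a2 / b2 = a4 / b4"
      then have z: "b2 * a2 + - a2 * b2 = 0" "b2 * a4 + - a2 * b4 = 0" using nz by (simp_all add: field_simps)
      have "(b2 * a + - a2 * b) *s y + (b2 * a1 + - a2 * b1) *s u0 + (b2 * a3 + - a2 * b3) *s u1
        = b2 *s u2 + (- a2) *s v2" using sp[of "b2" "- a2"] unfolding z by simp
      from ex[OF _ this] nz nc 0(5) 1(5) show False by blast
    qed
    show "a3 / b3 \<noteq> a4 / b4"
    proof
      assume "a3 / b3 = a4 / b4"
      then have z: "b3 * a3 + - a3 * b3 = 0" "b3 * a4 + - a3 * b4 = 0" using nz by (simp_all add: field_simps)
      have "(b3 * a + - a3 * b) *s y + (b3 * a1 + - a3 * b1) *s u0 + (b3 * a2 + - a3 * b2) *s v0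
        = b3 *s u2 + (- a3) *s v2" using sp[of "b3" "- a3"] unfolding z by simp
      from ex[OF _ this] nz nc 0(5) 1(5) show False by blast
    qed
  qed
  show thesis by (rule that[of "a1 / b1" "a2 / b2" "a3 / b3" "a4 / b4"]) (use nz ratio in auto)
qed

end

lemma three_dependent:
  fixes S :: "('a::field ^ 'n) set"
  assumes "vec.dim S \<le> 2" "v1 \<in> S" "v2 \<in> S" "v3 \<in> S"
  obtains a1 a2 a3 where "a1 *s v1 + a2 *s v2 + a3 *s v3 = 0" "\<not> (a1 = 0 \<and> a2 = 0 \<and> a3 = 0)"
proof -
  let ?f = "\<lambda>i::nat. [v1, v2, v3] ! i"
  have "\<exists>g. (\<exists>i<3. g i \<noteq> 0) \<and> (\<Sum>i<3. g i *s ?f i) = 0"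
  proof (rule family_dependent)
    show "?f i \<in> S" if "i < 3" for i
    proof -
      have "i = 0 \<or> i = 1 \<or> i = 2" using that by linarith
      then show ?thesis using assms(2-) by (elim disjE) simp_all
    qed
  qed (use assms(1) in simp)
  then obtain g where g: "\<exists>i<3. g i \<noteq> 0" "(\<Sum>i<3. g i *s ?f i) = 0" by blast
  show thesis
  proof (rule that[of "g 0" "g 1" "g 2"])
    show "g 0 *s v1 + g 1 *s v2 + g 2 *s v3 = 0"
      using g(2) by (simp add: eval_nat_numeral lessThan_Suc algebra_simps)
    show "\<not> (g 0 = 0 \<and> g 1 = 0 \<and> g 2 = 0)"
    proof
      assume z: "g 0 = 0 \<and> g 1 = 0 \<and> g 2 = 0"
      from g(1) obtain i where i: "i < 3" "g i \<noteq> 0" by blast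
      have "i = 0 \<or> i = 1 \<or> i = 2" using i(1) by linarith
      with z i(2) show False by auto
    qed
  qed
qed

section \<open>Tangent spaces and the dimension of the ambient space\<close>

context arc_cone
begin

definition tangent_space :: "'a ^ 'n \<Rightarrow> ('a ^ 'n) set" where
  "tangent_space x = vec.span {u. x \<frown> u}"

lemma tangent_space_nbr: "x \<frown> u \<Longrightarrow> u \<in> tangent_space x"
  unfolding tangent_space_def by (rule vec.span_base) simp

lemma tangent_space_self: "x \<in> Z \<Longrightarrow> x \<in> tangent_space x"
  using tangent_space_nbr coll_self[of x 1] by simp

lemma tangent_space_lin: "u \<in> tangent_space x \<Longrightarrow> v \<in> tangent_space x \<Longrightarrow> a *s u + b *s v \<in> tangent_space x"
  unfolding tangent_space_def by (intro vec.span_add vec.span_scale)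

lemma tangent_space_subspace: "vec.subspace (tangent_space x)"
  unfolding tangent_space_def by (rule vec.subspace_span)

lemma tangent_space_dim: assumes "x \<in> Z" "x \<noteq> 0" shows "vec.dim (tangent_space x) \<le> 5"
proof -
  from tangent[OF assms] obtain S where S: "vec.subspace S" "vec.dim S \<le> 5" "\<forall>u. x \<frown> u \<longrightarrow> u \<in> S" by blast
  have "tangent_space x \<subseteq> S" unfolding tangent_space_def using S by (intro vec.span_minimal) auto
  from vec.dim_subset[OF this] S(2) show ?thesis by linarith
qed

definition tangent_sum :: "'a ^ 'n \<Rightarrow> 'a ^ 'n \<Rightarrow> ('a ^ 'n) set" where
  "tangent_sum x y = {s + t | s t. s \<in> tangent_space x \<and> t \<in> tangent_space y}"

lemma tangent_sum_subspace: "vec.subspace (tangent_sum x y)"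
  unfolding tangent_sum_def by (rule vec.subspace_sums[OF tangent_space_subspace tangent_space_subspace])

lemma tangent_sum_left: "s \<in> tangent_space x \<Longrightarrow> s \<in> tangent_sum x y"
  unfolding tangent_sum_def using vec.subspace_0[OF tangent_space_subspace, of y] by force

lemma tangent_sum_right: "t \<in> tangent_space y \<Longrightarrow> t \<in> tangent_sum x y"
  unfolding tangent_sum_def using vec.subspace_0[OF tangent_space_subspace, of x] by force

lemma tangent_sum_lin: "u \<in> tangent_sum x y \<Longrightarrow> v \<in> tangent_sum x y \<Longrightarrow> a *s u + b *s v \<in> tangent_sum x y"
  using tangent_sum_subspace by (intro vec.subspace_add vec.subspace_scale)

text \<open>The tangent space at \<open>p\<close> is spanned by \<open>p\<close>, \<open>x\<close>,
  the two common neighbours of \<open>p\<close> and \<open>y\<close>, and one more neighbour, which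
  is found as a difference of a neighbour of \<open>y\<close> and a neighbour of
  \<open>x\<close>.\<close>

lemma far_tangent:
  assumes fr: "far y x p" and w: "p \<frown> w"
  shows "w \<in> tangent_sum x y"
proof -
  from far_nbrs[OF fr, of 0 1] obtain u v where u: "u \<frown> y" "u \<frown> 0 *s x + 1 *s p" "v \<frown> y" "v \<frown> 0 *s x + 1 *s p" "\<not> u \<frown> v" "u \<noteq> 0" "v \<noteq> 0"
    by auto
  have up: "p \<frown> u" "p \<frown> v" using coll_sym[OF u(2)] coll_sym[OF u(4)] by simp_all
  let ?t = "1 *s x + 1 *s p"
  have "(1 :: 'a) \<noteq> 0 \<or> (1 :: 'a) \<noteq> 0" by simp
  from far_nbrs[OF fr this] obtain ut vt where ut: "ut \<frown> y" "ut \<frown> ?t" "ut \<noteq> 0"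
    and "vt \<frown> y" "vt \<frown> ?t" "\<not> ut \<frown> vt" "vt \<noteq> 0" .
  have xp: "x \<frown> p" by (rule far_coll[OF fr])
  have t0: "?t \<noteq> 0" by (rule far_nonzero[OF fr]) simp
  have p0: "p \<noteq> 0" using far_nonzero[OF fr, of 0 1] by simp
  have nxu: "\<not> u \<frown> x" "\<not> v \<frown> x" "\<not> ut \<frown> x"
    using far_nbr_ncoll[OF fr u(1,2,6), where r' = 1 and s' = 0] far_nbr_ncoll[OF fr u(3,4,7), where r' = 1 and s' = 0] far_nbr_ncoll[OF fr ut(1-3), where r' = 1 and s' = 0] by simp_all
  have tx: "?t \<frown> x" using coll_lin[OF xp, of 1 1 1 0] by simp
  have nxut: "\<not> x \<frown> ut" using nxu(3) coll_sym by blast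
  from nbr_frame[OF tx coll_sym[OF ut(2)] nxut t0] obtain \<zeta> w0 where ze: "\<zeta> \<in> \<Xi>" and f: "frame Z \<zeta> ?t x ut w0" .
  note fv = frame_vertices[OF f]
  \<comment> \<open>In the quadric on \<open>?t = x + p\<close>, \<open>x\<close> and
    \<open>ut\<close>, this vector is the point of the line \<open>ut w0\<close> collinear with
    \<open>p = ?t - x\<close>.\<close>
  define w' where "w' = 0 *s ?t + 0 *s x + 1 *s ut + (-1) *s w0"
  have pe: "p = 1 *s ?t + (-1) *s x + 0 *s ut + 0 *s w0" by simp
  have xe: "x = 0 *s ?t + 1 *s x + 0 *s ut + 0 *s w0" by simp
  have pw: "p \<frown> w'" unfolding w'_def using frame_coll_iff[OF f, of 1 0 "-1" 0 0 "-1" 0 1] pe by simp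
  have nxw: "\<not> x \<frown> w'" unfolding w'_def using frame_coll_iff[OF f, of 0 0 1 0 0 "-1" 0 1] xe by simp
  have w'_in: "w' \<in> \<zeta>" unfolding w'_def by (rule frame_mem[OF f])
  have npw: "\<not> par p w'" using par_coll_all[OF _ coll_sym[OF xp]] nxw by blast
  have p_in: "p \<in> \<zeta>" using mem_lin[OF ze fv(1,2), of 1 "-1"] by simp
  have yout: "y \<notin> \<zeta>" by (rule far_outside[OF fr ze fv(2) p_in])
  have nw: "\<not> q \<frown> w'" if q: "q \<frown> y" "q \<frown> 0 *s x + 1 *s p" "q \<noteq> 0" for q
  proof
    assume h: "q \<frown> w'"
    have pq: "p \<frown> q" using coll_sym[OF q(2)] by simp
    from no_plane[OF p0 pw pq coll_sym[OF h] npw] obtain a b where "q = a *s p + b *s w'" by blast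
    then have "q \<in> \<zeta>" using mem_lin[OF ze p_in w'_in] by simp
    moreover have "\<not> q \<frown> ut" by (rule far_pairs[OF fr q ut]) simp
    ultimately have "y \<in> \<zeta>" using nbr_mem[OF coll_sym[OF q(1)] coll_sym[OF ut(1)] _ ze _ fv(3)] by blast
    with yout show False by blast
  qed
  have nc: "\<not> x \<frown> u" "\<not> x \<frown> v" "\<not> u \<frown> w'" "\<not> v \<frown> w'"
    using nxu coll_sym nw[OF u(1,2,6)] nw[OF u(3,4,7)] by blast+
  from four_classes_span[OF p0 coll_sym[OF xp] up pw nc(1,2) nxw u(5) nc(3,4) w]
  obtain k k1 k2 k3 k4 where e: "w = k *s p + k1 *s x + k2 *s u + k3 *s v + k4 *s w'" .
  have 1: "p \<in> tangent_sum x y" "x \<in> tangent_sum x y" "w0 \<in> tangent_sum x y"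
    by (intro tangent_sum_left tangent_space_nbr xp tangent_space_self fv coll_left[OF xp])+
  have 2: "u \<in> tangent_sum x y" "v \<in> tangent_sum x y" "ut \<in> tangent_sum x y"
    by (intro tangent_sum_right tangent_space_nbr coll_sym[OF u(1)] coll_sym[OF u(3)] coll_sym[OF ut(1)])+
  have "w' \<in> tangent_sum x y"
    unfolding w'_def using tangent_sum_lin[OF 2(3) 1(3), of 1 "-1"] by simp
  with 1 2 show ?thesis unfolding e
    using vec.subspace_add[OF tangent_sum_subspace] vec.subspace_scale[OF tangent_sum_subspace] by simp
qed

text \<open>A point \<open>z\<close> opposite \<open>x\<close> has two common neighbours with
  \<open>x\<close>. If one of them lies off the space of \<open>x\<close> and \<open>y\<close>, it
  spans with \<open>x\<close> a line far from \<open>y\<close> and \<open>far_tangent\<close>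
  applies; otherwise \<open>z\<close> lies in that space.\<close>

lemma tangent_sum_UNIV:
  assumes "x \<in> Z" "y \<in> Z" "\<not> x \<frown> y"
  shows "tangent_sum x y = UNIV"
proof -
  have "z \<in> tangent_sum x y" if z: "z \<in> Z" for z
  proof (cases "x \<frown> z")
    case True
    then show ?thesis by (intro tangent_sum_left tangent_space_nbr)
  next
    case False
    from opp_frame[OF assms] obtain \<xi> u v where xi: "\<xi> \<in> \<Xi>" and f: "frame Z \<xi> x u v y" .
    from opp_frame[OF assms(1) z False] obtain \<eta> a b where eta: "\<eta> \<in> \<Xi>" and g: "frame Z \<eta> x a b z" .
    note fv = frame_vertices[OF f] and gv = frame_vertices[OF g]
    have fx: "far y x c" if "x \<frown> c" "c \<notin> \<xi>" for c
      by (rule far_intro[OF xi fv(1,4,8,17) that])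
    consider "a \<notin> \<xi>" | "b \<notin> \<xi>" | "a \<in> \<xi>" "b \<in> \<xi>" by blast
    then show ?thesis
    proof cases
      case 1
      show ?thesis by (rule far_tangent[OF fx[OF gv(13) 1] gv(15)])
    next
      case 2
      show ?thesis by (rule far_tangent[OF fx[OF gv(14) 2] gv(16)])
    next
      case 3
      have "\<xi> = \<eta>" by (rule space_unique[OF gv(6,7,18) xi eta 3 gv(2,3)])
      then obtain k k1 k2 k3 where e: "z = k *s x + k1 *s u + k2 *s v + k3 *s y"
        using frame_ex[OF f] gv(4) by metis
      have "x \<in> tangent_sum x y" "u \<in> tangent_sum x y" "v \<in> tangent_sum x y" "y \<in> tangent_sum x y"
        by (intro tangent_sum_left tangent_sum_right tangent_space_nbr tangent_space_self fv)+
      then show ?thesis unfolding e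
        using vec.subspace_add[OF tangent_sum_subspace] vec.subspace_scale[OF tangent_sum_subspace] by metis
    qed
  qed
  then have "vec.span Z \<subseteq> tangent_sum x y" by (intro vec.span_minimal tangent_sum_subspace) auto
  then show ?thesis using span_Z by blast
qed

lemma tangent_space_dims:
  assumes "x \<in> Z" "y \<in> Z" "\<not> x \<frown> y"
  shows "CARD('n) + vec.dim (tangent_space x \<inter> tangent_space y) \<le> 10"
proof -
  have "x \<noteq> 0" "y \<noteq> 0" using assms coll_zero coll_sym by blast+
  then have "vec.dim (tangent_space x) \<le> 5" "vec.dim (tangent_space y) \<le> 5" using tangent_space_dim assms by blast+
  moreover have "vec.dim (tangent_sum x y) + vec.dim (tangent_space x \<inter> tangent_space y) = vec.dim (tangent_space x) + vec.dim (tangent_space y)"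
    unfolding tangent_sum_def by (rule vec.dim_sums_Int[OF tangent_space_subspace tangent_space_subspace])
  ultimately show ?thesis unfolding tangent_sum_UNIV[OF assms] vec_dim_card by linarith
qed

text \<open>Provides eight independent vectors, the lower bound for the dimension. A common vector
  of the two spaces would force a neighbour of \<open>p\<close> on the line \<open>p u\<close> into
  \<open>\<eta>\<close>, which contains no neighbour of \<open>p\<close> that is not collinear with
  \<open>x\<close>.\<close>

lemma disjoint_spaces:
  assumes fr: "far y x p"
  obtains \<xi> \<eta> where "\<xi> \<in> \<Xi>" "\<eta> \<in> \<Xi>" "\<xi> \<inter> \<eta> \<subseteq> {0}"
proof -
  have xp: "x \<frown> p" by (rule far_coll[OF fr])
  have x0: "x \<noteq> 0" using far_nonzero[OF fr, of 1 0] by simp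
  have p0: "p \<noteq> 0" using far_nonzero[OF fr, of 0 1] by simp
  have yp: "\<not> p \<frown> y" using far_second[OF fr] coll_sym by blast
  from opp_frame[OF coll_right[OF xp] far_Z[OF fr] yp] obtain \<xi> u v where xi: "\<xi> \<in> \<Xi>" and f: "frame Z \<xi> p u v y" .
  note fv = frame_vertices[OF f]
  have x_out: "x \<notin> \<xi>" using far_outside[OF fr xi] fv(1,4) by blast
  have "u \<frown> 0 *s x + 1 *s p" using coll_sym[OF fv(13)] by simp
  from far_nbr_ncoll[OF fr fv(15) this fv(10), where r' = 1 and s' = 0] have "\<not> u \<frown> x" by simp
  then have nxu: "\<not> x \<frown> u" using coll_sym by blast
  from nbr_frame[OF coll_sym[OF xp] fv(13) nxu p0] obtain \<zeta> s where ze: "\<zeta> \<in> \<Xi>" and g: "frame Z \<zeta> p x u s" .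
  note gv = frame_vertices[OF g]
  from third[OF x0 xp gv(15,17)] obtain i where i: "x \<frown> i" "\<not> i \<frown> p" "\<not> i \<frown> s" by blast
  have nsi: "\<not> s \<frown> i" using i(3) coll_sym by blast
  from nbr_frame[OF gv(15) i(1) nsi x0] obtain \<eta> c where eta: "\<eta> \<in> \<Xi>" and h: "frame Z \<eta> x s i c" .
  note hv = frame_vertices[OF h]
  have p_out: "p \<notin> \<eta>"
    using frame_nbr_coll[OF h _ xp] gv(17) i(2) coll_sym by blast
  have out2: "\<not> (q \<in> \<eta> \<and> q \<frown> p \<and> \<not> q \<frown> x)" for q
    using nbr_mem[OF coll_sym[OF xp] coll_sym _ eta hv(1)] p_out coll_sym by blast
  have "z = 0" if z: "z \<in> \<xi>" "z \<in> \<eta>" for z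
  proof (rule ccontr)
    assume z0: "z \<noteq> 0"
    have zZ: "z \<in> Z" using meet[OF xi eta _ z] x_out hv(1) by blast
    have nzx: "\<not> z \<frown> x"
    proof
      assume zx: "z \<frown> x"
      have zp: "z \<frown> p" using nbr_mem[OF coll_sym[OF zx] xp _ xi z(1) fv(1)] x_out by blast
      have npz: "\<not> par x z"
      proof
        assume "par x z"
        with par_sym z0 have "par z x" by blast
        then show False using mem_scale[OF xi z(1)] x_out unfolding par_def by blast
      qed
      from frame_nbr_coll[OF h z(2) coll_sym[OF zx]] show False
        using coll_trans[OF xp coll_sym[OF zx] gv(15) coll_sym[OF zp] _ npz x0]
          coll_trans[OF xp coll_sym[OF zx] i(1) coll_sym[OF zp] _ npz x0] gv(17) i(2) coll_sym by blast
    qed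
    have nzp: "\<not> z \<frown> p" using out2 z(2) nzx by blast
    from line_meets[OF xi z(1) fv(1,2) zZ fv(13)] obtain a b where ab: "a \<noteq> 0 \<or> b \<noteq> 0" "z \<frown> a *s p + b *s u" .
    have b0: "b \<noteq> 0"
    proof
      assume "b = 0"
      with ab coll_unscale_right[of Z z a p] nzp show False by auto
    qed
    let ?u = "a *s p + b *s u" and ?s = "a *s x + b *s s"
    have us: "?u \<frown> ?s"
      using frame_coll_iff[OF g, of a 0 0 b 0 b a 0] by simp
    have nus: "\<not> ?u \<frown> x"
      using frame_coll_iff[OF g, of a 0 0 b 0 0 1 0] b0 by simp
    have s_in: "?s \<in> \<eta>" by (rule mem_lin[OF eta hv(1,2)])
    have "?u \<in> \<eta>"
    proof (cases "?s \<frown> z")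
      case False
      show ?thesis by (rule nbr_mem[OF us coll_sym[OF ab(2)] False eta s_in z(2)])
    next
      case True
      have xs: "x \<frown> ?s" using coll_lin[OF gv(15), of 1 0 a b] by simp
      have s0: "?s \<noteq> 0"
      proof
        assume "?s = 0"
        then have "0 *s p + a *s x + 0 *s u + b *s s = 0" by simp
        from frame_indep[OF g this] b0 show False by blast
      qed
      have "\<not> par ?s z" using par_coll_all[OF _ coll_sym[OF xs]] nzx coll_sym by blast
      from no_plane[OF s0 True coll_sym[OF us] ab(2) this] obtain k l where "?u = k *s ?s + l *s z" by blast
      then show ?thesis using mem_lin[OF eta s_in z(2)] by simp
    qed
    moreover have "?u \<frown> p" using coll_lin[OF fv(13), of a b 1 0] by simp
    ultimately show False using out2 nus by blast
  qed
  with xi eta that show thesis by blast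
qed

lemma card_ge_8:
  assumes "far y x p" shows "8 \<le> CARD('n)"
proof (rule ccontr)
  assume less: "\<not> 8 \<le> CARD('n)"
  from disjoint_spaces[OF assms] obtain \<xi> \<eta> where xe: "\<xi> \<in> \<Xi>" "\<eta> \<in> \<Xi>" "\<xi> \<inter> \<eta> \<subseteq> {0}" .
  from frame_exists[OF xe(1)] obtain a b c d where f: "frame Z \<xi> a b c d" by blast
  from frame_exists[OF xe(2)] obtain a' b' c' d' where g: "frame Z \<eta> a' b' c' d'" by blast
  let ?f = "\<lambda>i::nat. [a, b, c, d, a', b', c', d'] ! i"
  have "\<exists>g. (\<exists>i<8. g i \<noteq> 0) \<and> (\<Sum>i<8. g i *s ?f i) = 0"
  proof (rule family_dependent)
    show "vec.dim (UNIV :: ('a ^ 'n) set) < 8" unfolding vec_dim_card using less by simp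
  qed (rule UNIV_I)
  then obtain k where k: "\<exists>i<8. k i \<noteq> 0" "(\<Sum>i<8. k i *s ?f i) = 0" by blast
  have s: "k 0 *s a + k 1 *s b + k 2 *s c + k 3 *s d + (k 4 *s a' + k 5 *s b' + k 6 *s c' + k 7 *s d') = 0"
    using k(2) by (simp add: eval_nat_numeral lessThan_Suc algebra_simps)
  let ?l = "k 0 *s a + k 1 *s b + k 2 *s c + k 3 *s d"
  have "?l \<in> \<xi>" by (rule frame_mem[OF f])
  moreover have e: "?l = (- k 4) *s a' + (- k 5) *s b' + (- k 6) *s c' + (- k 7) *s d'"
  proof -
    have "(- k 4) *s a' + (- k 5) *s b' + (- k 6) *s c' + (- k 7) *s d' = - (k 4 *s a' + k 5 *s b' + k 6 *s c' + k 7 *s d')"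
      by (simp add: vec_eq_iff algebra_simps)
    with s show ?thesis by (metis eq_neg_iff_add_eq_0)
  qed
  moreover have "(- k 4) *s a' + (- k 5) *s b' + (- k 6) *s c' + (- k 7) *s d' \<in> \<eta>" by (rule frame_mem[OF g])
  ultimately have z: "?l = 0" using xe(3) by auto
  from frame_indep[OF f z] frame_indep[OF g z[unfolded e]]
  have "k 0 = 0 \<and> k 1 = 0 \<and> k 2 = 0 \<and> k 3 = 0 \<and> k 4 = 0 \<and> k 5 = 0 \<and> k 6 = 0 \<and> k 7 = 0" by simp
  moreover from k(1) obtain i where i: "i < 8" "k i \<noteq> 0" by blast
  moreover have "i = 0 \<or> i = 1 \<or> i = 2 \<or> i = 3 \<or> i = 4 \<or> i = 5 \<or> i = 6 \<or> i = 7" using i(1) by linarith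
  ultimately show False by auto
qed

text \<open>The tangent spaces at \<open>x\<close> and \<open>y\<close> share the independent
  vectors \<open>u\<close>, \<open>v\<close>, so the dimension is at most 5 + 5 - 2, and
  \<open>card_ge_8\<close> bounds it from below.\<close>

lemma card_8:
  assumes "Z \<noteq> {0}" "Z \<noteq> {}"
  shows "CARD('n) = 8"
proof -
  from assms obtain y where y: "y \<in> Z" "y \<noteq> 0" by blast
  from far_exists[OF y] obtain x p where fr: "far y x p" .
  have n: "\<not> x \<frown> y" using far_first[OF fr] coll_sym by blast
  have xZ: "x \<in> Z" by (rule coll_left[OF far_coll[OF fr]])
  from opp_frame[OF xZ y(1) n] obtain \<xi> u v where f: "frame Z \<xi> x u v y" by blast
  note fv = frame_vertices[OF f]
  have uv: "u \<in> tangent_space x \<inter> tangent_space y" "v \<in> tangent_space x \<inter> tangent_space y" using tangent_space_nbr fv coll_sym by blast+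
  have "2 \<le> vec.dim (tangent_space x \<inter> tangent_space y)"
  proof (rule ccontr)
    assume "\<not> ?thesis"
    then have l: "vec.dim (tangent_space x \<inter> tangent_space y) < 2" by linarith
    have "\<exists>g. (\<exists>i<2. g i \<noteq> 0) \<and> (\<Sum>i<2. g i *s ([u, v] ! i)) = 0"
    proof (rule family_dependent[OF _ l])
      show "[u, v] ! i \<in> tangent_space x \<inter> tangent_space y" if "i < 2" for i
        using less_2_cases[OF that] uv by (elim disjE) simp_all
    qed
    then obtain g where g: "\<exists>i<2. g i \<noteq> 0" "(\<Sum>i<2. g i *s ([u, v] ! i)) = 0" by blast
    then have "0 *s x + g 0 *s u + g 1 *s v + 0 *s y = 0" by (simp add: eval_nat_numeral lessThan_Suc algebra_simps)
    from frame_indep[OF f this] g(1) show False by (auto simp: less_2_cases_iff)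
  qed
  with tangent_space_dims[OF xZ y(1) n] card_ge_8[OF fr] show ?thesis by linarith
qed

lemma tangent_space_inter:
  assumes "\<xi> \<in> \<Xi>" and f: "frame Z \<xi> x u v y" and s: "s \<in> tangent_space x" "s \<in> tangent_space y"
  shows "\<exists>a b. s = a *s u + b *s v"
proof -
  note fv = frame_vertices[OF f]
  have "CARD('n) = 8" using card_8 fv(5,9) by blast
  with tangent_space_dims[OF fv(5,8,17)] have d: "vec.dim (tangent_space x \<inter> tangent_space y) \<le> 2" by linarith
  have m: "s \<in> tangent_space x \<inter> tangent_space y" "u \<in> tangent_space x \<inter> tangent_space y" "v \<in> tangent_space x \<inter> tangent_space y" using s tangent_space_nbr fv coll_sym by blast+
  from three_dependent[OF d m(2,3,1)] obtain a b c where e: "a *s u + b *s v + c *s s = 0" "\<not> (a = 0 \<and> b = 0 \<and> c = 0)" .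
  have c: "c \<noteq> 0"
  proof
    assume "c = 0"
    with e(1) have "0 *s x + a *s u + b *s v + 0 *s y = 0" by simp
    from frame_indep[OF f this] e(2) \<open>c = 0\<close> show False by blast
  qed
  have "s = inverse c *s (c *s s)" using c by (simp add: vec_eq_iff mult.assoc[symmetric])
  also have "c *s s = - (a *s u + b *s v)" using e(1) by (metis add.commute eq_neg_iff_add_eq_0)
  also have "inverse c *s \<dots> = (- (inverse c * a)) *s u + (- (inverse c * b)) *s v"
    by (simp add: vec_eq_iff algebra_simps)
  finally show ?thesis by blast
qed

end

section \<open>Linear functionals and dual bases\<close>

definition lin_functional :: "('a::field ^ 'n \<Rightarrow> 'a) \<Rightarrow> bool" where
  "lin_functional F \<longleftrightarrow> (\<forall>a b v w. F (a *s v + b *s w) = a * F v + b * F w)"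

lemma lin_functional_comb: "lin_functional F \<Longrightarrow> F (a *s v + b *s w) = a * F v + b * F w"
  unfolding lin_functional_def by blast

lemma lin_functional_add: "lin_functional F \<Longrightarrow> F (v + w) = F v + F w"
  using lin_functional_comb[of F 1 v 1 w] by simp

lemma lin_functional_scale: "lin_functional F \<Longrightarrow> F (a *s v) = a * F v"
  using lin_functional_comb[of F a v 0 0] by simp

lemmas lin_functional_simps = lin_functional_add lin_functional_scale

lemma lin_functional_sum:
  assumes "lin_functional F" "lin_functional G" shows "lin_functional (\<lambda>v. a * F v + b * G v)"
  unfolding lin_functional_def using assms by (simp add: lin_functional_simps algebra_simps)

lemma lin_functional_kernel: "lin_functional F \<Longrightarrow> vec.subspace {v. F v = 0}"
  unfolding vec.subspace_def using lin_functional_scale[of F 0 0] by (simp add: lin_functional_simps)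

text \<open>A spanning list whose length is the dimension is distinct and independent, so its
  coordinate functions can be indexed by position.\<close>

lemma dual_basis:
  fixes xs :: "('a::field ^ 'n) list"
  assumes "length xs = CARD('n)" and "vec.span (set xs) = UNIV"
  obtains \<phi> :: "nat \<Rightarrow> 'a ^ 'n \<Rightarrow> 'a" where "\<And>i. lin_functional (\<phi> i)"
    and "\<And>i j. i < length xs \<Longrightarrow> j < length xs \<Longrightarrow> \<phi> i (xs ! j) = (if i = j then 1 else 0)"
proof -
  have ind: "vec.independent (set xs)"
    by (rule vec.card_le_dim_spanning[of _ UNIV]) (use assms card_length[of xs] in \<open>auto simp: vec_dim_card simp del: vec.dim_UNIV\<close>)
  have "vec.dim (UNIV :: ('a ^ 'n) set) \<le> card (set xs)"
    by (rule vec.dim_le_card) (use assms(2) in auto)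
  then have "card (set xs) = length xs" using assms(1) card_length[of xs] unfolding vec_dim_card by linarith
  then have d: "distinct xs" by (rule card_distinct)
  define \<phi> where "\<phi> i v = vec.representation (set xs) v (xs ! i)" for i v
  have sp: "v \<in> vec.span (set xs)" for v using assms(2) by simp
  show thesis
  proof (rule that[of \<phi>])
    show "lin_functional (\<phi> i)" for i
      unfolding lin_functional_def \<phi>_def using ind sp by (simp add: vec.representation_add vec.representation_scale)
    show "\<phi> i (xs ! j) = (if i = j then 1 else 0)" if "i < length xs" "j < length xs" for i j
      unfolding \<phi>_def using vec.representation_basis[OF ind, of "xs ! j"] that d by (auto simp: nth_eq_iff_index_eq)
  qed
qed

context arc_cone
begin

text \<open>Six points of a line far from \<open>y\<close>, each with two common neighbours with
  \<open>y\<close>.\<close>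

lemma many_nbrs:
  assumes "y \<in> Z" "y \<noteq> 0"
  obtains f :: "nat \<Rightarrow> 'a ^ 'n" where "\<And>i. i < 12 \<Longrightarrow> y \<frown> f i" "\<And>i j. i < 12 \<Longrightarrow> j < 12 \<Longrightarrow> i \<noteq> j \<Longrightarrow> \<not> f i \<frown> f j"
proof -
  from far_exists[OF assms] obtain x p where fr: "far y x p" .
  from five_scalars assms obtain c1 c2 c3 c4 :: 'a where c: "distinct [0, c1, c2, c3, c4]" by blast
  \<comment> \<open>Homogeneous coordinates of six points of the line \<open>x p\<close>: the two
    base points and four given by the nonzero scalars.\<close>
  define r where "r k = [1, 0, 1, 1, 1, 1 :: 'a] ! k" for k :: nat
  define s where "s k = [0, 1, c1, c2, c3, c4] ! k" for k :: nat
  have cases6: "k = 0 \<or> k = 1 \<or> k = 2 \<or> k = 3 \<or> k = 4 \<or> k = 5" if "k < 6" for k :: nat using that by linarith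
  have det: "r k * s l - r l * s k \<noteq> 0" if "k < 6" "l < 6" "k \<noteq> l" for k l
    using cases6[OF that(1)] cases6[OF that(2)] that(3) c unfolding r_def s_def by (elim disjE) auto
  have nz: "r k \<noteq> 0 \<or> s k \<noteq> 0" if "k < 6" for k
    using cases6[OF that] unfolding r_def s_def by (elim disjE) auto
  have "\<forall>k. \<exists>uv. k < 6 \<longrightarrow> fst uv \<frown> y \<and> fst uv \<frown> r k *s x + s k *s p \<and> snd uv \<frown> y \<and> snd uv \<frown> r k *s x + s k *s p \<and>
      \<not> fst uv \<frown> snd uv \<and> fst uv \<noteq> 0 \<and> snd uv \<noteq> 0"
  proof
    fix k
    show "\<exists>uv. k < 6 \<longrightarrow> fst uv \<frown> y \<and> fst uv \<frown> r k *s x + s k *s p \<and> snd uv \<frown> y \<and> snd uv \<frown> r k *s x + s k *s p \<and>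
      \<not> fst uv \<frown> snd uv \<and> fst uv \<noteq> 0 \<and> snd uv \<noteq> 0"
    proof (cases "k < 6")
      case True
      from far_nbrs[OF fr nz[OF True]] obtain u v where "u \<frown> y" "u \<frown> r k *s x + s k *s p" "v \<frown> y" "v \<frown> r k *s x + s k *s p" "\<not> u \<frown> v" "u \<noteq> 0" "v \<noteq> 0" .
      then show ?thesis by (intro exI[of _ "(u, v)"]) simp
    qed simp
  qed
  from choice[OF this] obtain h where h: "\<And>k. k < 6 \<Longrightarrow> fst (h k) \<frown> y \<and> fst (h k) \<frown> r k *s x + s k *s p \<and>
      snd (h k) \<frown> y \<and> snd (h k) \<frown> r k *s x + s k *s p \<and> \<not> fst (h k) \<frown> snd (h k) \<and> fst (h k) \<noteq> 0 \<and> snd (h k) \<noteq> 0" by blast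
  have off: "\<not> u \<frown> v" if "k < 6" "l < 6" "k \<noteq> l" "u = fst (h k) \<or> u = snd (h k)" "v = fst (h l) \<or> v = snd (h l)" for k l u v
    using far_pairs[OF fr _ _ _ _ _ _ det[OF that(1-3)]] h[OF that(1)] h[OF that(2)] that(4,5) by blast
  define f where "f i = (if i < 6 then fst (h i) else snd (h (i - 6)))" for i :: nat
  show thesis
  proof (rule that[of f])
    show "y \<frown> f i" if i: "i < 12" for i
    proof (cases "i < 6")
      case True
      then have "fst (h i) \<frown> y" using h by blast
      from coll_sym[OF this] True show ?thesis unfolding f_def by simp
    next
      case False
      with i have "i - 6 < 6" by simp
      then have "snd (h (i - 6)) \<frown> y" using h by blast
      from coll_sym[OF this] False show ?thesis unfolding f_def by simp
    qed
    show "\<not> f i \<frown> f j" if ij: "i < 12" "j < 12" "i \<noteq> j" for i j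
    proof -
      define k where "k = (if i < 6 then i else i - 6)"
      define l where "l = (if j < 6 then j else j - 6)"
      have kl: "k < 6" "l < 6" unfolding k_def l_def using ij by auto
      have fi: "f i = fst (h k) \<or> f i = snd (h k)" "f j = fst (h l) \<or> f j = snd (h l)" unfolding f_def k_def l_def by auto
      show ?thesis
      proof (cases "k = l")
        case False
        show ?thesis by (rule off[OF kl False fi])
      next
        case True
        then have "f i = fst (h k) \<and> f j = snd (h k) \<or> f i = snd (h k) \<and> f j = fst (h k)"
          using ij unfolding f_def k_def l_def by (auto split: if_splits)
        then show ?thesis using h[OF kl(1)] coll_sym by metis
      qed
    qed
  qed
qed

text \<open>Each of the classes of \<open>u\<close> and \<open>v\<close> contains at most one of
  twelve lines, so enough lines remain.\<close>

lemma four_nbrs: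
  assumes "x \<noteq> 0" "x \<frown> u" "x \<frown> v" "\<not> u \<frown> v"
  obtains a b where "x \<frown> a" "x \<frown> b" "\<not> u \<frown> a" "\<not> u \<frown> b" "\<not> v \<frown> a" "\<not> v \<frown> b" "\<not> a \<frown> b"
proof -
  obtain f :: "nat \<Rightarrow> 'a ^ 'n" where f: "\<And>i. i < 12 \<Longrightarrow> x \<frown> f i" "\<And>i j. i < 12 \<Longrightarrow> j < 12 \<Longrightarrow> i \<noteq> j \<Longrightarrow> \<not> f i \<frown> f j"
    by (rule many_nbrs[OF coll_left[OF assms(2)] assms(1)]) (rule that)
  have one: "i = j" if "i < 12" "j < 12" "w \<frown> f i" "w \<frown> f j" "w = u \<or> w = v" for i j w
  proof -
    have npu: "\<not> par x u" "\<not> par x v"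
      using par_coll_all[OF _ assms(3)] par_coll_all[OF _ assms(2)] assms(4) coll_sym by blast+
    have w: "x \<frown> w" "\<not> par x w" using that(5) assms(2,3) npu by blast+
    from coll_trans[OF f(1)[OF that(1)] w(1) f(1)[OF that(2)] coll_sym[OF that(3)] that(4) w(2) assms(1)] f(2)[OF that(1,2)]
    show ?thesis by blast
  qed
  define A where "A = {i\<in>{..<12}. u \<frown> f i}"
  define B where "B = {i\<in>{..<12}. v \<frown> f i}"
  have "card A \<le> Suc 0" unfolding A_def by (subst card_le_Suc0_iff_eq) (simp, use one[of _ _ u] in blast)
  moreover have "card B \<le> Suc 0" unfolding B_def by (subst card_le_Suc0_iff_eq) (simp, use one[of _ _ v] in blast)
  ultimately have ab: "card (A \<union> B) \<le> 2" using card_Un_le[of A B] by linarith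
  have "finite (A \<union> B)" unfolding A_def B_def by simp
  from diff_card_le_card_Diff[OF this, of "{..<12}"] ab have "3 \<le> card ({..<12} - (A \<union> B))" by simp
  then obtain T where T: "T \<subseteq> {..<12} - (A \<union> B)" "card T = 3" by (rule obtain_subset_with_card_n)
  then obtain i j k where "T = {i, j, k}" "i \<noteq> j" unfolding card_3_iff by blast
  with T(1) have "i < 12" "j < 12" "\<not> u \<frown> f i" "\<not> u \<frown> f j" "\<not> v \<frown> f i" "\<not> v \<frown> f j" "i \<noteq> j"
    unfolding A_def B_def by auto
  then show thesis using that f by blast
qed

text \<open>A tangent space of dimension 5 and a quadric space of dimension 4 meet in dimension 8.
  The work lies in passing from a common vector \<open>w\<close> to a point of the quadric. The
  formula is the parametrization of the points of \<open>\<eta>\<close> not collinear with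
  \<open>x\<close>, scaled to have coefficient 1 at \<open>c\<close>.\<close>

lemma nbr_in_space:
  assumes xi: "\<xi> \<in> \<Xi>" and f: "frame Z \<xi> x u v y" and eta: "\<eta> \<in> \<Xi>" and g: "frame Z \<eta> x j t c"
    and out: "j \<notin> \<xi>" "t \<notin> \<xi>"
  shows "\<exists>\<beta> \<gamma>. y \<frown> c + \<beta> *s j + \<gamma> *s t + (\<beta> * \<gamma>) *s x"
proof -
  note fv = frame_vertices[OF f] and gv = frame_vertices[OF g]
  have fj: "far y x j" and ft: "far y x t"
    using far_intro[OF xi fv(1,4,8,17)] gv(13,14) out by blast+
  have c8: "CARD('n) = 8" using card_8 fv(5,9) by blast
  from four_nbrs[OF fv(12) coll_sym[OF fv(15)] coll_sym[OF fv(16)] fv(18)] obtain a b where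
    ab: "y \<frown> a" "y \<frown> b" "\<not> u \<frown> a" "\<not> u \<frown> b" "\<not> v \<frown> a" "\<not> v \<frown> b" "\<not> a \<frown> b" .
  let ?f = "\<lambda>i::nat. [y, u, v, a, b, x, j, t, c] ! i"
  have "\<exists>g. (\<exists>i<9. g i \<noteq> 0) \<and> (\<Sum>i<9. g i *s ?f i) = 0"
  proof (rule family_dependent)
    show "vec.dim (UNIV :: ('a ^ 'n) set) < 9" unfolding vec_dim_card c8 by simp
  qed (rule UNIV_I)
  then obtain k where k: "\<exists>i<9. k i \<noteq> 0" "(\<Sum>i<9. k i *s ?f i) = 0" by blast
  define \<alpha> \<beta> \<gamma> \<delta> where "\<alpha> = k 5" and "\<beta> = k 6" and "\<gamma> = k 7" and "\<delta> = k 8"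
  define w where "w = \<alpha> *s x + \<beta> *s j + \<gamma> *s t + \<delta> *s c"
  have s: "k 0 *s y + k 1 *s u + k 2 *s v + k 3 *s a + k 4 *s b + w = 0"
    using k(2) unfolding w_def \<alpha>_def \<beta>_def \<gamma>_def \<delta>_def by (simp add: eval_nat_numeral lessThan_Suc algebra_simps)
  have we: "w = (- 1) *s (k 0 *s y + k 1 *s u + k 2 *s v + k 3 *s a + k 4 *s b)"
  proof -
    have "(- 1) *s (k 0 *s y + k 1 *s u + k 2 *s v + k 3 *s a + k 4 *s b) = - (k 0 *s y + k 1 *s u + k 2 *s v + k 3 *s a + k 4 *s b)"
      by (simp add: vec_eq_iff)
    with s show ?thesis by (metis add.commute eq_neg_iff_add_eq_0)
  qed
  have wy: "w \<in> tangent_space y" unfolding we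
    using tangent_space_self[OF fv(8)] tangent_space_nbr[OF coll_sym[OF fv(15)]] tangent_space_nbr[OF coll_sym[OF fv(16)]] tangent_space_nbr[OF ab(1)] tangent_space_nbr[OF ab(2)]
    by (intro vec.subspace_scale[OF tangent_space_subspace] vec.subspace_add[OF tangent_space_subspace])
  have nz: "\<not> (\<alpha> = 0 \<and> \<beta> = 0 \<and> \<gamma> = 0 \<and> \<delta> = 0)"
  proof
    assume z: "\<alpha> = 0 \<and> \<beta> = 0 \<and> \<gamma> = 0 \<and> \<delta> = 0"
    then have "w = 0" unfolding w_def by simp
    with s have "k 0 *s y + k 1 *s u + k 2 *s v + k 3 *s a + k 4 *s b = 0" by simp
    from class_coeffs[OF fv(12) coll_sym[OF fv(15)] coll_sym[OF fv(16)] ab(1,2) fv(18) ab(3-7) this]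
    have z2: "k 0 = 0 \<and> k 1 = 0 \<and> k 2 = 0 \<and> k 3 = 0 \<and> k 4 = 0" .
    from k(1) obtain i where i: "i < 9" "k i \<noteq> 0" by blast
    have "i = 0 \<or> i = 1 \<or> i = 2 \<or> i = 3 \<or> i = 4 \<or> i = 5 \<or> i = 6 \<or> i = 7 \<or> i = 8" using i(1) by linarith
    with z z2 i(2) show False unfolding \<alpha>_def \<beta>_def \<gamma>_def \<delta>_def by auto
  qed
  \<comment> \<open>If not, \<open>w\<close> lies on the line \<open>x j\<close> and in both tangent
    spaces, hence in \<open>\<xi>\<close>, while \<open>j\<close> is outside
    \<open>\<xi>\<close>.\<close>
  have gd: "\<gamma> \<noteq> 0 \<or> \<delta> \<noteq> 0"
  proof (rule ccontr)
    assume n: "\<not> ?thesis"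
    then have w: "w = \<alpha> *s x + \<beta> *s j" unfolding w_def by simp
    have "w \<in> tangent_space x" unfolding w by (rule tangent_space_lin[OF tangent_space_self[OF fv(5)] tangent_space_nbr[OF gv(13)]])
    from tangent_space_inter[OF xi f this wy] obtain m n where mn: "w = m *s u + n *s v" by blast
    have win: "w \<in> \<xi>" unfolding mn by (rule mem_lin[OF xi fv(2,3)])
    have "\<beta> = 0"
    proof (rule ccontr)
      assume "\<beta> \<noteq> 0"
      from solve_second[OF w this] mem_lin[OF xi fv(1) win] out(1) show False by metis
    qed
    with w mn have "\<alpha> *s x = m *s u + n *s v" by simp
    then have "\<alpha> *s x + (- m) *s u + (- n) *s v + 0 *s y = 0" by (simp add: vec_eq_iff)
    from frame_indep[OF f this] \<open>\<beta> = 0\<close> nz n show False by blast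
  qed
  \<comment> \<open>With \<open>p\<close> on \<open>x j\<close> and \<open>w'\<close> the
    corresponding point of the opposite side \<open>t c\<close>, the vector \<open>w\<close> is
    tangent at \<open>p\<close> as well as at \<open>y\<close>, so it lies in the span of their
    common neighbours \<open>u1\<close>, \<open>v1\<close>.\<close>
  define p where "p = \<gamma> *s x + \<delta> *s j"
  define w' where "w' = \<gamma> *s t + \<delta> *s c"
  have ww: "w = \<alpha> *s x + \<beta> *s j + w'" unfolding w_def w'_def by (simp add: algebra_simps)
  have p0: "p \<noteq> 0" unfolding p_def by (rule far_nonzero[OF fj gd])
  have nyp: "\<not> y \<frown> p" unfolding p_def by (rule farD[OF fj gd])
  have px: "p \<frown> x" "p \<frown> j" unfolding p_def using coll_lin[OF gv(13), of \<gamma> \<delta> 1 0] coll_lin[OF gv(13), of \<gamma> \<delta> 0 1] by simp_all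
  have pw': "p \<frown> w'" unfolding p_def w'_def using frame_coll_iff[OF g, of \<gamma> 0 \<delta> 0 0 \<delta> 0 \<gamma>] by simp
  have wp: "w \<in> tangent_space p" unfolding ww
    using tangent_space_nbr px pw' by (intro vec.subspace_add[OF tangent_space_subspace] vec.subspace_scale[OF tangent_space_subspace]) auto
  from opp_frame[OF fv(8) coll_left[OF px(1)] nyp] obtain \<zeta> u1 v1 where ze: "\<zeta> \<in> \<Xi>" and h: "frame Z \<zeta> y u1 v1 p" .
  note hv = frame_vertices[OF h]
  from tangent_space_inter[OF ze h wy wp] obtain a1 b1 where ab1: "w = a1 *s u1 + b1 *s v1" by blast
  \<comment> \<open>The second point \<open>q\<close> on the line \<open>x j\<close> is
    \<open>x\<close>, or \<open>j\<close> if \<open>p\<close> is a multiple of \<open>x\<close>. The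
    relation between \<open>p\<close>, \<open>w'\<close>, \<open>q\<close>, \<open>u1\<close>,
    \<open>v1\<close> then forces two of the classes to agree.\<close>
  obtain q k m where q: "p \<frown> q" "\<not> w' \<frown> q" "\<not> q \<frown> u1" "\<not> q \<frown> v1" "\<alpha> *s x + \<beta> *s j = k *s p + m *s q"
  proof (cases "\<delta> = 0")
    case False
    have "\<not> x \<frown> w'" unfolding w'_def using frame_coll_iff[OF g, of 1 0 0 0 0 \<delta> 0 \<gamma>] False by simp
    moreover have "\<not> u1 \<frown> x"
      using far_nbr_ncoll[OF fj coll_sym[OF hv(13)] hv(15)[unfolded p_def] hv(10), where r' = 1 and s' = 0] False by simp
    moreover have "\<not> v1 \<frown> x"
      using far_nbr_ncoll[OF fj coll_sym[OF hv(14)] hv(16)[unfolded p_def] hv(11), where r' = 1 and s' = 0] False by simp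
    moreover have "\<alpha> *s x + \<beta> *s j = (\<beta> / \<delta>) *s p + (\<alpha> - \<beta> / \<delta> * \<gamma>) *s x"
      unfolding p_def using False by (simp add: vec_eq_iff algebra_simps)
    ultimately show thesis using that px(1) coll_sym by blast
  next
    case True
    then have g0: "\<gamma> \<noteq> 0" using gd by blast
    have "\<not> j \<frown> w'" unfolding w'_def using frame_coll_iff[OF g, of 0 0 1 0 0 \<delta> 0 \<gamma>] g0 by simp
    moreover have "\<not> u1 \<frown> j"
      using far_nbr_ncoll[OF fj coll_sym[OF hv(13)] hv(15)[unfolded p_def] hv(10), where r' = 0 and s' = 1] g0 by simp
    moreover have "\<not> v1 \<frown> j"
      using far_nbr_ncoll[OF fj coll_sym[OF hv(14)] hv(16)[unfolded p_def] hv(11), where r' = 0 and s' = 1] g0 by simp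
    moreover have "\<alpha> *s x + \<beta> *s j = (\<alpha> / \<gamma>) *s p + \<beta> *s j"
      unfolding p_def True using g0 by (simp add: vec_eq_iff)
    ultimately show thesis using that px(2) coll_sym by blast
  qed
  have "w' \<frown> u1 \<or> w' \<frown> v1"
  proof (rule ccontr)
    assume n: "\<not> ?thesis"
    have "k *s p + 1 *s w' + m *s q + (- a1) *s u1 + (- b1) *s v1 = 0"
      using ab1 unfolding ww q(5) by (simp add: vec_eq_iff algebra_simps)
    from class_coeffs[OF p0 pw' q(1) coll_sym[OF hv(15)] coll_sym[OF hv(16)] q(2) _ _ q(3,4) hv(18) this] n
    show False by simp
  qed
  then obtain e where e: "w' \<frown> e" "e \<frown> y" "e \<frown> p" "e \<noteq> 0" using hv coll_sym by blast
  have "\<not> par p w'" using par_coll_all[OF _ q(1)] q(2) coll_sym by blast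
  from no_plane[OF p0 pw' coll_sym[OF e(3)] e(1) this] obtain k m where km: "e = k *s p + m *s w'" by blast
  have d0: "\<delta> \<noteq> 0"
  proof
    assume d: "\<delta> = 0"
    have "e = (k * \<gamma>) *s x + (m * \<gamma>) *s t" unfolding km p_def w'_def d by (simp add: vec_eq_iff algebra_simps)
    with far_nbr_off_line[OF ft e(2,4)] show False by blast
  qed
  have m0: "m \<noteq> 0"
  proof
    assume "m = 0"
    then have "e = (k * \<gamma>) *s x + (k * \<delta>) *s j" unfolding km p_def by (simp add: vec_eq_iff algebra_simps)
    with far_nbr_off_line[OF fj e(2,4)] show False by blast
  qed
  \<comment> \<open>Dividing by the coefficient \<open>m \<delta>\<close> of \<open>c\<close>; both
    factors are nonzero because the lines \<open>x t\<close> and \<open>x j\<close> are far from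
    \<open>y\<close>.\<close>
  have "c + (k / m) *s j + (\<gamma> / \<delta>) *s t + ((k / m) * (\<gamma> / \<delta>)) *s x = (1 / (m * \<delta>)) *s e"
    unfolding km p_def w'_def using m0 d0 by (simp add: vec_eq_iff field_simps)
  moreover have "y \<frown> (1 / (m * \<delta>)) *s e" by (rule coll_scale_right[OF coll_sym[OF e(2)]])
  ultimately show ?thesis by metis
qed

text \<open>Equal \<open>\<beta>\<close> places the two neighbours on one line of
  \<open>\<eta>\<close>, opposite the line \<open>y u\<close> in a common quadric
  \<open>\<theta>\<close>. The point where that line meets the neighbours of \<open>x\<close> is
  then collinear with a point of \<open>y u\<close>, which draws it into
  \<open>\<xi>\<close>.\<close>

lemma nbr_in_space_inj:
  assumes xi: "\<xi> \<in> \<Xi>" and f: "frame Z \<xi> x u v y" and eta: "\<eta> \<in> \<Xi>" and g: "frame Z \<eta> x j t c"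
    and out: "j \<notin> \<xi>" "t \<notin> \<xi>" and B: "B \<noteq> B'"
    and z: "y + B *s u \<frown> c + \<beta> *s j + \<gamma> *s t + (\<beta> * \<gamma>) *s x"
    and z': "y + B' *s u \<frown> c + \<beta> *s j + \<gamma>' *s t + (\<beta> * \<gamma>') *s x"
  shows False
proof -
  note fv = frame_vertices[OF f] and gv = frame_vertices[OF g]
  let ?y = "y + B *s u" and ?y' = "y + B' *s u"
  let ?z = "c + \<beta> *s j + \<gamma> *s t + (\<beta> * \<gamma>) *s x" and ?z' = "c + \<beta> *s j + \<gamma>' *s t + (\<beta> * \<gamma>') *s x"
  have ye: "?y = 1 *s y + B *s u" "?y' = 1 *s y + B' *s u" by simp_all
  have yy: "?y \<frown> ?y'" unfolding ye by (rule coll_lin[OF coll_sym[OF fv(15)]])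
  have y_in: "?y \<in> \<xi>" "?y' \<in> \<xi>" unfolding ye by (rule mem_lin[OF xi fv(4,2)])+
  have ze: "?z = (\<beta> * \<gamma>) *s x + \<beta> *s j + \<gamma> *s t + 1 *s c" "?z' = (\<beta> * \<gamma>') *s x + \<beta> *s j + \<gamma>' *s t + 1 *s c"
    by (simp_all add: algebra_simps)
  have z_in: "?z \<in> \<eta>" "?z' \<in> \<eta>" unfolding ze by (rule frame_mem[OF g])+
  have zz: "?z \<frown> ?z'" unfolding ze by (subst frame_coll_iff[OF g]) (simp_all add: algebra_simps)
  have nzx: "\<not> x \<frown> ?z" "\<not> x \<frown> ?z'" unfolding ze by (subst frame_first_coll[OF g]; simp)+
  have nyx: "\<not> x \<frown> ?y"
    using frame_first_coll[OF f, of 0 1 B 0] unfolding ye by (simp add: add.commute)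
  have y0: "?y \<noteq> 0" using nyx coll_zero[OF fv(5)] by metis
  have zout: "q \<notin> \<xi>" if "q \<in> \<eta>" "\<not> x \<frown> q" "q \<in> Z" for q
  proof
    assume "q \<in> \<xi>"
    from space_unique[OF fv(5) that(3,2) xi eta fv(1) this gv(1) that(1)] gv(2) out(1) show False by blast
  qed
  have npy: "\<not> par ?y ?y'"
  proof
    assume "par ?y ?y'"
    then obtain k where "?y' = k *s ?y" unfolding par_def by blast
    then have "0 *s x + (B' - k * B) *s u + 0 *s v + (1 - k) *s y = 0" by (simp add: vec_eq_iff algebra_simps)
    from frame_indep[OF f this] have "k = 1" "B' = k * B" by auto
    with B show False by simp
  qed
  have both: False if "?y \<frown> q" "?y' \<frown> q" "q \<in> \<eta>" "\<not> x \<frown> q" for q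
  proof -
    from no_plane[OF y0 yy that(1,2) npy] obtain k l where "q = k *s ?y + l *s ?y'" by blast
    then have "q \<in> \<xi>" using mem_lin[OF xi y_in] by simp
    with zout[OF that(3,4)] coll_right[OF that(1)] show False by blast
  qed
  have nyz': "\<not> ?y \<frown> ?z'" using both[of ?z'] z' z_in nzx by blast
  from opp_frame[OF coll_left[OF yy] coll_right[OF z'] nyz'] obtain \<theta> k1 k2 where th: "\<theta> \<in> \<Xi>" and h: "frame Z \<theta> ?y k1 k2 ?z'" .
  note hv = frame_vertices[OF h]
  have y'_th: "?y' \<in> \<theta>" by (rule nbr_mem[OF coll_sym[OF yy] z' nyz' th hv(1,4)])
  have z_th: "?z \<in> \<theta>" by (rule nbr_mem[OF coll_sym[OF z] zz nyz' th hv(1,4)])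
  have gg: "\<gamma> \<noteq> \<gamma>'" using z nyz' by blast
  \<comment> \<open>The point of the line \<open>?z ?z'\<close> that is collinear with
    \<open>x\<close>, obtained by eliminating \<open>c\<close>.\<close>
  define q where "q = t + \<beta> *s x"
  define i where "i = inverse (\<gamma> - \<gamma>')"
  have i: "i * (\<gamma> - \<gamma>') = 1" unfolding i_def using gg by simp
  have "i *s ?z + (- i) *s ?z' = (i * (\<gamma> - \<gamma>')) *s t + (\<beta> * (i * (\<gamma> - \<gamma>'))) *s x"
    by (simp add: vec_eq_iff algebra_simps)
  then have qe: "q = i *s ?z + (- i) *s ?z'" unfolding q_def i by simp
  have q_th: "q \<in> \<theta>" unfolding qe by (rule mem_lin[OF th z_th hv(4)])
  have xq: "x \<frown> q" unfolding q_def using coll_lin[OF gv(14), of 1 0 \<beta> 1] by (simp add: add.commute)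
  have q_out: "q \<notin> \<xi>"
  proof
    assume "q \<in> \<xi>"
    then have "1 *s q + (- \<beta>) *s x \<in> \<xi>" by (rule mem_lin[OF xi _ fv(1)])
    then show False using out(2) unfolding q_def by (simp add: vec_eq_iff)
  qed
  from line_meets[OF th q_th hv(1) y'_th coll_right[OF xq] yy] obtain k l where kl: "k \<noteq> 0 \<or> l \<noteq> 0" "q \<frown> k *s ?y + l *s ?y'" .
  let ?d = "k *s ?y + l *s ?y'"
  have de: "?d = 0 *s x + (k * B + l * B') *s u + 0 *s v + (k + l) *s y" by (simp add: vec_eq_iff algebra_simps)
  have d_in: "?d \<in> \<xi>" by (rule mem_lin[OF xi y_in])
  show False
  proof (cases "k + l = 0")
    case False
    then have "\<not> x \<frown> ?d" unfolding de using frame_first_coll[OF f, of 0 "k + l" "k * B + l * B'" 0] by simp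
    from nbr_mem[OF coll_sym[OF xq] kl(2) this xi fv(1) d_in] q_out show False by blast
  next
    case True
    then have l: "l = - k" by (simp add: eq_neg_iff_add_eq_0 add.commute)
    have dd: "?d = (k * (B - B')) *s u" unfolding l by (simp add: vec_eq_iff algebra_simps)
    have k0: "k * (B - B') \<noteq> 0" using kl(1) l B by auto
    have "q \<frown> u" using kl(2) coll_unscale_right[OF _ k0] unfolding dd by blast
    have npu: "\<not> par x u" using par_coll_all[OF _ fv(14)] fv(18) coll_sym by blast
    from no_plane[OF fv(9,13) xq coll_sym[OF \<open>q \<frown> u\<close>] npu] obtain k l where "q = k *s x + l *s u" by blast
    then have "q \<in> \<xi>" using mem_lin[OF xi fv(1,2)] by simp
    with q_out show False by blast
  qed
qed

end

section \<open>Excluding arcs\<close>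

text \<open>The cross difference factors as
  \<open>(B - B') (\<rho>1 + \<rho>2 (B + B') + k B B')\<close>, so the second factor has no zero
  off the diagonal. The second alternative, with \<open>\<rho>2\<close> nonzero, is the Frobenius
  phenomenon of characteristic 2.\<close>

lemma injective_quadratic_ratio:
  fixes \<tau> \<Delta> \<rho>1 \<rho>2 :: "'a::field"
  assumes five: "distinct [0, c1, c2, c3, c4 :: 'a]"
    and nz: "\<And>B. 1 + \<tau> * B + \<Delta> * B^2 \<noteq> 0"
    and inj: "\<And>B B'. B \<noteq> B' \<Longrightarrow>
      (\<rho>1 * B + \<rho>2 * B^2) * (1 + \<tau> * B' + \<Delta> * B'^2) \<noteq> (\<rho>1 * B' + \<rho>2 * B'^2) * (1 + \<tau> * B + \<Delta> * B^2)"
  shows "\<tau> = 0 \<and> (\<rho>1 \<noteq> 0 \<or> \<rho>2 \<noteq> 0) \<and> (\<rho>2 = 0 \<and> \<Delta> = 0 \<or> \<rho>1 = 0)"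
proof -
  define k where "k = \<rho>2 * \<tau> - \<rho>1 * \<Delta>"
  have e: "\<rho>1 + \<rho>2 * (B + B') + k * B * B' \<noteq> 0" if "B \<noteq> B'" for B B'
  proof
    assume h: "\<rho>1 + \<rho>2 * (B + B') + k * B * B' = 0"
    have "(\<rho>1 * B + \<rho>2 * B^2) * (1 + \<tau> * B' + \<Delta> * B'^2) - (\<rho>1 * B' + \<rho>2 * B'^2) * (1 + \<tau> * B + \<Delta> * B^2)
      = (B - B') * (\<rho>1 + \<rho>2 * (B + B') + k * B * B')"
      unfolding k_def by (simp add: algebra_simps power2_eq_square)
    with h inj[OF that] show False by simp
  qed
  have k0: "k = 0"
  proof (rule ccontr)
    assume k: "k \<noteq> 0"
    \<comment> \<open>Unless \<open>\<rho>2 + k B = 0\<close>, the equation for \<open>B'\<close> is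
      solvable and its solution must be \<open>B\<close> itself. So this cubic vanishes on the whole
      field, which has at least five elements.\<close>
    define p where "p = [:\<rho>2, k:] * [:\<rho>1, 2 * \<rho>2, k:]"
    have p0: "p \<noteq> 0" unfolding p_def using k by simp
    have pe: "poly p B = (\<rho>2 + k * B) * (\<rho>1 + 2 * \<rho>2 * B + k * B * B)" for B
      unfolding p_def by (simp add: algebra_simps)
    have root: "poly p B = 0" for B
    proof (cases "\<rho>2 + k * B = 0")
      case True
      then show ?thesis unfolding pe by simp
    next
      case False
      define B' where "B' = - (\<rho>1 + \<rho>2 * B) / (\<rho>2 + k * B)"
      have m: "B' * (\<rho>2 + k * B) = - (\<rho>1 + \<rho>2 * B)" unfolding B'_def using False by simp
      have "\<rho>1 + \<rho>2 * (B + B') + k * B * B' = \<rho>1 + \<rho>2 * B + B' * (\<rho>2 + k * B)" by (simp add: algebra_simps)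
      then have "\<rho>1 + \<rho>2 * (B + B') + k * B * B' = 0" using m by simp
      then have BB: "B' = B" using e[of B B'] by metis
      have mB: "B * (\<rho>2 + k * B) = - (\<rho>1 + \<rho>2 * B)" using m unfolding BB .
      have "\<rho>1 + 2 * \<rho>2 * B + k * B * B = (\<rho>1 + \<rho>2 * B) + B * (\<rho>2 + k * B)" by (simp add: algebra_simps)
      then have "\<rho>1 + 2 * \<rho>2 * B + k * B * B = 0" unfolding mB by simp
      then show ?thesis unfolding pe by simp
    qed
    have "degree p \<le> 3" unfolding p_def by (rule order_trans[OF degree_mult_le]) simp
    moreover have "card {x. poly p x = 0} \<le> degree p" by (rule card_poly_roots_bound[OF p0])
    moreover have "card {0, c1, c2, c3, c4} \<le> card {x. poly p x = 0}"
      by (rule card_mono[OF poly_roots_finite[OF p0]]) (use root in auto)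
    moreover have "card {0, c1, c2, c3, c4} = 5" using five by simp
    ultimately show False by linarith
  qed
  show ?thesis
  proof (cases "\<rho>2 = 0")
    case True
    with e[of 0 1] k0 have r1: "\<rho>1 \<noteq> 0" by simp
    with True k0 have d: "\<Delta> = 0" unfolding k_def by simp
    have "\<tau> = 0"
    proof (rule ccontr)
      assume "\<tau> \<noteq> 0"
      then have "1 + \<tau> * (- 1 / \<tau>) + \<Delta> * (- 1 / \<tau>)^2 = 0" using d by simp
      with nz show False by blast
    qed
    with True r1 d show ?thesis by blast
  next
    case False
    \<comment> \<open>For \<open>k = 0\<close> the right-hand side is the solution
      \<open>B'\<close>, so it may not differ from \<open>B\<close>.\<close>
    have s: "B = - \<rho>1 / \<rho>2 - B" for B
    proof (rule ccontr)
      assume "B \<noteq> - \<rho>1 / \<rho>2 - B"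
      from e[OF this] k0 False show False by (simp add: algebra_simps)
    qed
    from s[of 0] False have "\<rho>1 = 0" by simp
    moreover from this k0 False have "\<tau> = 0" unfolding k_def by simp
    ultimately show ?thesis using False by blast
  qed
qed

text \<open>In matrix terms \<open>(1 + B a) r = g\<close> and
  \<open>h + \<beta> e + \<gamma> f = B b r\<close>. The cross product with \<open>f\<close> removes
  \<open>\<gamma>\<close>, and the inverse of \<open>1 + B a\<close> is \<open>1 + B adj a\<close>
  over the determinant. So \<open>\<beta>\<close> is, up to an affine change, a quotient of the kind
  in \<open>injective_quadratic_ratio\<close>, with trace and determinant of \<open>a\<close> in the
  denominator.\<close>

lemma pair_condition:
  fixes a11 a12 a21 a22 b11 b12 b21 b22 :: "'a::field"
  assumes five: "distinct [0, c1, c2, c3, c4 :: 'a]"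
    and D: "\<And>B. (1 + B * a11) * (1 + B * a22) - B * a12 * (B * a21) \<noteq> 0"
    and inj: "inj \<beta>" and ind: "e1 * f2 - e2 * f1 \<noteq> 0"
    and E: "\<And>B. \<exists>r1 r2. r1 + B * (a11 * r1 + a12 * r2) = g1 \<and> r2 + B * (a21 * r1 + a22 * r2) = g2 \<and>
       h1 + \<beta> B * e1 + \<gamma> B * f1 = B * (b11 * r1 + b12 * r2) \<and> h2 + \<beta> B * e2 + \<gamma> B * f2 = B * (b21 * r1 + b22 * r2)"
  defines "\<rho>1 \<equiv> (b11 * g1 + b12 * g2) * f2 - (b21 * g1 + b22 * g2) * f1"
    and "\<rho>2 \<equiv> (b11 * (a22 * g1 - a12 * g2) + b12 * (a11 * g2 - a21 * g1)) * f2
      - (b21 * (a22 * g1 - a12 * g2) + b22 * (a11 * g2 - a21 * g1)) * f1"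
  shows "a11 + a22 = 0 \<and> (\<rho>1 \<noteq> 0 \<or> \<rho>2 \<noteq> 0) \<and> (\<rho>2 = 0 \<and> a11 * a22 - a12 * a21 = 0 \<or> \<rho>1 = 0)"
proof (rule injective_quadratic_ratio[OF five])
  let ?d = "\<lambda>B. 1 + (a11 + a22) * B + (a11 * a22 - a12 * a21) * B^2"
  have d: "(1 + B * a11) * (1 + B * a22) - B * a12 * (B * a21) = ?d B" for B
    by (simp add: algebra_simps power2_eq_square)
  show nz: "?d B \<noteq> 0" for B using D[of B] unfolding d .
  define G where "G = e1 * f2 - e2 * f1"
  define H where "H = h1 * f2 - h2 * f1"
  have key: "?d B * (\<beta> B * G + H) = \<rho>1 * B + \<rho>2 * B^2" for B
  proof -
    from E[of B] obtain r1 r2 where x: "r1 + B * (a11 * r1 + a12 * r2) = g1" "r2 + B * (a21 * r1 + a22 * r2) = g2"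
      "h1 + \<beta> B * e1 + \<gamma> B * f1 = B * (b11 * r1 + b12 * r2)" "h2 + \<beta> B * e2 + \<gamma> B * f2 = B * (b21 * r1 + b22 * r2)" by blast
    note r = x(1,2)[symmetric]
    have h: "h1 = B * (b11 * r1 + b12 * r2) - \<beta> B * e1 - \<gamma> B * f1" "h2 = B * (b21 * r1 + b22 * r2) - \<beta> B * e2 - \<gamma> B * f2"
      unfolding x(3,4)[symmetric] by simp_all
    have "\<beta> B * G + H = B * ((b11 * r1 + b12 * r2) * f2 - (b21 * r1 + b22 * r2) * f1)"
      unfolding G_def H_def h by (simp add: algebra_simps)
    moreover have "?d B * (B * ((b11 * r1 + b12 * r2) * f2 - (b21 * r1 + b22 * r2) * f1)) = \<rho>1 * B + \<rho>2 * B^2"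
      unfolding \<rho>1_def \<rho>2_def r by algebra
    ultimately show ?thesis by simp
  qed
  fix B B' :: 'a assume ne: "B \<noteq> B'"
  show "(\<rho>1 * B + \<rho>2 * B^2) * ?d B' \<noteq> (\<rho>1 * B' + \<rho>2 * B'^2) * ?d B"
  proof
    assume "(\<rho>1 * B + \<rho>2 * B^2) * ?d B' = (\<rho>1 * B' + \<rho>2 * B'^2) * ?d B"
    then have "?d B * (\<beta> B * G + H) * ?d B' = ?d B' * (\<beta> B' * G + H) * ?d B" unfolding key .
    then have "?d B * ?d B' * (\<beta> B * G + H) = ?d B * ?d B' * (\<beta> B' * G + H)" by (simp only: ac_simps)
    then have "\<beta> B * G + H = \<beta> B' * G + H" using nz[of B] nz[of B'] by (metis mult_eq_0_iff mult_left_cancel)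
    then have "\<beta> B = \<beta> B'" using ind unfolding G_def by simp
    with inj ne show False unfolding inj_def by blast
  qed
qed

lemma cross_zero:
  fixes p1 p2 :: "'a::field"
  assumes "p1 * f2 - p2 * f1 = 0" "p1 * e2 - p2 * e1 = 0" "e1 * f2 - e2 * f1 \<noteq> 0"
  shows "p1 = 0 \<and> p2 = 0"
proof -
  have 1: "p1 * (e1 * f2 - e2 * f1) = e1 * (p1 * f2 - p2 * f1) - f1 * (p1 * e2 - p2 * e1)" by (simp add: algebra_simps)
  have 2: "p2 * (e1 * f2 - e2 * f1) = e2 * (p1 * f2 - p2 * f1) - f2 * (p1 * e2 - p2 * e1)" by (simp add: algebra_simps)
  have "p1 * (e1 * f2 - e2 * f1) = 0" unfolding 1 assms(1,2) by simp
  moreover have "p2 * (e1 * f2 - e2 * f1) = 0" unfolding 2 assms(1,2) by simp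
  ultimately show ?thesis using assms(3) by (metis mult_eq_0_iff)
qed

text \<open>A nonzero singular matrix has rank one and is a column times a row.\<close>

lemma nilpotent_factor:
  fixes a11 a12 a21 a22 :: "'a::field"
  assumes "a11 * a22 - a12 * a21 = 0" "\<not> (a11 = 0 \<and> a12 = 0 \<and> a21 = 0 \<and> a22 = 0)"
  obtains q1 q2 k1 k2 where "a11 = q1 * k1" "a12 = q1 * k2" "a21 = q2 * k1" "a22 = q2 * k2"
    "q1 \<noteq> 0 \<or> q2 \<noteq> 0" "k1 \<noteq> 0 \<or> k2 \<noteq> 0"
proof -
  consider "a11 \<noteq> 0" | "a21 \<noteq> 0" | "a11 = 0" "a21 = 0" by blast
  then show thesis
  proof cases
    case 1
    then have "a22 = a21 * (a12 / a11)" using assms(1) by (simp add: field_simps)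
    with 1 show thesis by (intro that[of a11 1 "a12 / a11" a21]) simp_all
  next
    case 2
    then have "a12 = a11 * (a22 / a21)" using assms(1) by (simp add: field_simps)
    with 2 show thesis by (intro that[of a11 1 "a22 / a21" a21]) simp_all
  next
    case 3
    with assms(2) show thesis by (intro that[of a12 0 1 a22]) auto
  qed
qed

lemma three_distinct:
  assumes "card S \<ge> 3" obtains a b c where "a \<in> S" "b \<in> S" "c \<in> S" "a \<noteq> b" "a \<noteq> c" "b \<noteq> c"
proof -
  obtain T where "T \<subseteq> S" "card T = 3" by (rule obtain_subset_with_card_n[OF assms])
  then obtain a b c where "T = {a, b, c}" "a \<noteq> b" "b \<noteq> c" "a \<noteq> c" unfolding card_3_iff by blast
  with \<open>T \<subseteq> S\<close> show thesis by (intro that[of a b c]) auto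
qed

text \<open>Here \<open>a\<close> and \<open>b\<close> are coordinate blocks of the two fourth vertices on \<open>u\<close>, \<open>y\<close> and a further
  neighbour of \<open>y\<close>, \<open>e j\<close> belongs to a line through \<open>x\<close>, and \<open>g j t\<close> to the fourth vertex of the quadrangle
  on \<open>x\<close> and the lines \<open>j\<close>, \<open>t\<close>. The functions \<open>\<beta>\<close>, \<open>\<gamma>\<close> give the point collinear with \<open>y + B u\<close> in the space
  of that quadrangle.\<close>

lemma no_configuration:
  fixes a11 a12 a21 a22 b11 b12 b21 b22 :: "'a::field" and e1 e2 :: "nat \<Rightarrow> 'a" and g1 g2 :: "nat \<Rightarrow> nat \<Rightarrow> 'a"
  assumes five: "distinct [0, c1, c2, c3, c4 :: 'a]"
    and D: "\<And>B. (1 + B * a11) * (1 + B * a22) - B * a12 * (B * a21) \<noteq> 0"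
    and E: "\<And>j t. j < 10 \<Longrightarrow> t < 10 \<Longrightarrow> j \<noteq> t \<Longrightarrow> \<exists>h1 h2 \<beta> \<gamma>. inj \<beta> \<and> inj \<gamma> \<and> (\<forall>B. \<exists>r1 r2.
       r1 + B * (a11 * r1 + a12 * r2) = g1 j t \<and> r2 + B * (a21 * r1 + a22 * r2) = g2 j t \<and>
       h1 + \<beta> B * e1 j + \<gamma> B * e1 t = B * (b11 * r1 + b12 * r2) \<and> h2 + \<beta> B * e2 j + \<gamma> B * e2 t = B * (b21 * r1 + b22 * r2))"
    and ind: "\<And>j t. j < 10 \<Longrightarrow> t < 10 \<Longrightarrow> j \<noteq> t \<Longrightarrow> e1 j * e2 t - e2 j * e1 t \<noteq> 0"
    and R1: "\<And>j t1 t2 t3 k1 k2. j < 10 \<Longrightarrow> t1 < 10 \<Longrightarrow> t2 < 10 \<Longrightarrow> t3 < 10 \<Longrightarrow> distinct [j, t1, t2, t3] \<Longrightarrow>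
       k1 * g1 j t1 + k2 * g2 j t1 = 0 \<Longrightarrow> k1 * g1 j t2 + k2 * g2 j t2 = 0 \<Longrightarrow> k1 * g1 j t3 + k2 * g2 j t3 = 0 \<Longrightarrow> k1 = 0 \<and> k2 = 0"
    and R2: "\<And>q1 q2. a11 * q1 + a12 * q2 = 0 \<Longrightarrow> a21 * q1 + a22 * q2 = 0 \<Longrightarrow> b11 * q1 + b12 * q2 = 0 \<Longrightarrow>
       b21 * q1 + b22 * q2 = 0 \<Longrightarrow> q1 = 0 \<and> q2 = 0"
    and R3: "\<not> (a11 = 0 \<and> a12 = 0 \<and> a21 = 0 \<and> a22 = 0)"
  shows False
proof -
  define bg1 bg2 where "bg1 j t = b11 * g1 j t + b12 * g2 j t" and "bg2 j t = b21 * g1 j t + b22 * g2 j t" for j t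
  define cg1 cg2 where "cg1 j t = a22 * g1 j t - a12 * g2 j t" and "cg2 j t = a11 * g2 j t - a21 * g1 j t" for j t
  define bc1 bc2 where "bc1 j t = b11 * cg1 j t + b12 * cg2 j t" and "bc2 j t = b21 * cg1 j t + b22 * cg2 j t" for j t
  note defs = bg1_def bg2_def cg1_def cg2_def bc1_def bc2_def
  \<comment> \<open>The two choices of \<open>i\<close> come from eliminating either
    \<open>\<gamma>\<close> or \<open>\<beta>\<close>; exchanging the roles of \<open>j\<close> and
    \<open>t\<close> reduces the second to the first.\<close>
  have P: "a11 + a22 = 0 \<and> (bg1 j t * e2 i - bg2 j t * e1 i \<noteq> 0 \<or> bc1 j t * e2 i - bc2 j t * e1 i \<noteq> 0) \<and>
     (bc1 j t * e2 i - bc2 j t * e1 i = 0 \<and> a11 * a22 - a12 * a21 = 0 \<or> bg1 j t * e2 i - bg2 j t * e1 i = 0)"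
    if jt: "j < 10" "t < 10" "j \<noteq> t" "i = t \<or> i = j" for j t i
  proof -
    from E[OF jt(1-3)] obtain h1 h2 \<beta> \<gamma> where inj: "inj \<beta>" "inj \<gamma>" and e: "\<And>B. \<exists>r1 r2.
       r1 + B * (a11 * r1 + a12 * r2) = g1 j t \<and> r2 + B * (a21 * r1 + a22 * r2) = g2 j t \<and>
       h1 + \<beta> B * e1 j + \<gamma> B * e1 t = B * (b11 * r1 + b12 * r2) \<and> h2 + \<beta> B * e2 j + \<gamma> B * e2 t = B * (b21 * r1 + b22 * r2)"
      by blast
    have e': "\<exists>r1 r2.
       r1 + B * (a11 * r1 + a12 * r2) = g1 j t \<and> r2 + B * (a21 * r1 + a22 * r2) = g2 j t \<and>
       h1 + \<gamma> B * e1 t + \<beta> B * e1 j = B * (b11 * r1 + b12 * r2) \<and> h2 + \<gamma> B * e2 t + \<beta> B * e2 j = B * (b21 * r1 + b22 * r2)" for B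
      using e[of B] by (simp only: add.assoc add.commute[of "\<beta> B * e1 j"] add.commute[of "\<beta> B * e2 j"])
    show ?thesis
    proof (cases "i = t")
      case True
      then show ?thesis unfolding defs using pair_condition[OF five D inj(1) ind[OF jt(1-3)] e] by blast
    next
      case False
      then have i: "i = j" using jt(4) by blast
      show ?thesis unfolding defs i using pair_condition[OF five D inj(2) ind[OF jt(2,1) jt(3)[symmetric]] e'] by blast
    qed
  qed
  have tr: "a11 + a22 = 0" using P[of 0 1 1] by simp
  have bz: "bg1 j t = 0 \<and> bg2 j t = 0"
    if "j < 10" "t < 10" "j \<noteq> t" "bg1 j t * e2 t - bg2 j t * e1 t = 0" "bg1 j t * e2 j - bg2 j t * e1 j = 0" for j t
    by (rule cross_zero[OF that(4,5) ind[OF that(1-3)]])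
  show False
  proof (cases "a11 * a22 - a12 * a21 = 0")
    \<comment> \<open>A nonzero determinant leaves only the alternative that the linear coefficients
      vanish. Then \<open>b\<close> annihilates the vectors \<open>g\<close>, so
      \<open>b = 0\<close>, and the quadratic coefficients vanish too.\<close>
    case False
    have z: "bg1 0 t = 0 \<and> bg2 0 t = 0" if "t \<in> {1, 2, 3}" for t
    proof -
      have "t < 10" "0 \<noteq> t" using that by auto
      with bz[of 0 t] P[of 0 t t] P[of 0 t 0] False show ?thesis by simp
    qed
    have "b11 = 0 \<and> b12 = 0" by (rule R1[of 0 1 2 3]) (use z in \<open>simp_all add: bg1_def\<close>)
    moreover have "b21 = 0 \<and> b22 = 0" by (rule R1[of 0 1 2 3]) (use z in \<open>simp_all add: bg2_def\<close>)
    ultimately show False using P[of 0 1 1] by (simp add: defs)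
  next
    case True
    from nilpotent_factor[OF this R3] obtain q1 q2 k1 k2 where
      a: "a11 = q1 * k1" "a12 = q1 * k2" "a21 = q2 * k1" "a22 = q2 * k2"
      and q: "q1 \<noteq> 0 \<or> q2 \<noteq> 0" and k: "k1 \<noteq> 0 \<or> k2 \<noteq> 0" .
    define bq1 bq2 where "bq1 = b11 * q1 + b12 * q2" and "bq2 = b21 * q1 + b22 * q2"
    have kq: "k1 * q1 + k2 * q2 = 0" using tr unfolding a by (simp add: algebra_simps)
    have "q1 * (k1 * q1 + k2 * q2) = 0" "q2 * (k1 * q1 + k2 * q2) = 0" using kq by simp_all
    then have "a11 * q1 + a12 * q2 = 0" "a21 * q1 + a22 * q2 = 0" unfolding a by (simp_all add: algebra_simps)
    then have bq: "bq1 \<noteq> 0 \<or> bq2 \<noteq> 0" using R2[of q1 q2] q unfolding bq1_def bq2_def by blast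
    \<comment> \<open>Trace 0 makes the adjugate of \<open>a\<close> equal to \<open>- a\<close>,
      and \<open>a\<close> is the column \<open>q\<close> times the row \<open>k\<close>.\<close>
    have cg: "cg1 j t = - q1 * (k1 * g1 j t + k2 * g2 j t)" "cg2 j t = - q2 * (k1 * g1 j t + k2 * g2 j t)" for j t
    proof -
      have t: "q2 * k2 = - (q1 * k1)" "q1 * k1 = - (q2 * k2)" using tr unfolding a by (simp_all add: eq_neg_iff_add_eq_0 add.commute)
      show "cg1 j t = - q1 * (k1 * g1 j t + k2 * g2 j t)"
        unfolding cg1_def a t(1) by (simp add: algebra_simps)
      show "cg2 j t = - q2 * (k1 * g1 j t + k2 * g2 j t)"
        unfolding cg2_def a t(2) by (simp add: algebra_simps)
    qed
    have bc: "bc1 j t * e2 i - bc2 j t * e1 i = - (k1 * g1 j t + k2 * g2 j t) * (bq1 * e2 i - bq2 * e1 i)" for j t i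
      unfolding bc1_def bc2_def cg bq1_def bq2_def by (simp add: algebra_simps)
    \<comment> \<open>At most one line has its vector \<open>e\<close> proportional to
      \<open>b q\<close>. If there is none, 10 serves as an index out of range.\<close>
    obtain m where m: "\<And>i. i < 10 \<Longrightarrow> i \<noteq> m \<Longrightarrow> bq1 * e2 i - bq2 * e1 i \<noteq> 0"
    proof (cases "\<exists>m<10. bq1 * e2 m - bq2 * e1 m = 0")
      case True
      then obtain m where m: "m < 10" "bq1 * e2 m - bq2 * e1 m = 0" by blast
      have "bq1 * e2 i - bq2 * e1 i \<noteq> 0" if "i < 10" "i \<noteq> m" for i
        using cross_zero[OF _ m(2) ind[OF m(1) that(1) that(2)[symmetric]]] bq by blast
      then show thesis by (rule that)
    next
      case False
      then show thesis using that[of 10] by blast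
    qed
    define j :: nat where "j = (if m = 0 then 1 else 0)"
    have j: "j < 10" "j \<noteq> m" unfolding j_def by auto
    define S where "S = {..<10} - {m, j}"
    have S: "finite S" "card S \<ge> 8"
    proof -
      show "finite S" unfolding S_def by simp
      have "card ({..<10::nat} - {m, j}) \<ge> card {..<10::nat} - card {m, j}" by (rule diff_card_le_card_Diff) simp
      moreover have "card {m, j} \<le> 2" by (simp add: card_insert_if)
      ultimately show "card S \<ge> 8" unfolding S_def by simp
    qed
    \<comment> \<open>A nonzero \<open>k \<sqdot> g\<close> makes the quadratic coefficients nonzero
      for \<open>i = t\<close> and \<open>i = j\<close>, so both linear ones vanish and
      \<open>b g\<close> is zero by \<open>cross_zero\<close>.\<close>
    have alt: "k1 * g1 j t + k2 * g2 j t = 0 \<or> bg1 j t = 0 \<and> bg2 j t = 0" if t: "t \<in> S" for t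
    proof -
      have t': "t < 10" "t \<noteq> m" "j \<noteq> t" using t unfolding S_def by auto
      have "bg1 j t = 0 \<and> bg2 j t = 0" if nk: "k1 * g1 j t + k2 * g2 j t \<noteq> 0"
      proof -
        have "bc1 j t * e2 i - bc2 j t * e1 i \<noteq> 0" if "bq1 * e2 i - bq2 * e1 i \<noteq> 0" for i
          unfolding bc using that nk by (metis mult_eq_0_iff neg_equal_0_iff_equal)
        with m[OF t'(1,2)] m[OF j] show ?thesis
          using P[OF j(1) t'(1,3), of t] P[OF j(1) t'(1,3), of j] bz[OF j(1) t'(1,3)] by blast
      qed
      then show ?thesis by blast
    qed
    \<comment> \<open>Any nonzero row of \<open>b\<close> serves. Each of the functionals
      \<open>k\<close> and \<open>l\<close> vanishes for at most two of the at least eight indices,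
      so they cannot cover \<open>S\<close>.\<close>
    obtain l1 l2 where l: "l1 \<noteq> 0 \<or> l2 \<noteq> 0" "\<And>t. bg1 j t = 0 \<and> bg2 j t = 0 \<Longrightarrow> l1 * g1 j t + l2 * g2 j t = 0"
    proof (cases "b11 \<noteq> 0 \<or> b12 \<noteq> 0")
      case True
      then show thesis using that[of b11 b12] unfolding bg1_def by blast
    next
      case False
      then have "b21 \<noteq> 0 \<or> b22 \<noteq> 0" using bq unfolding bq1_def bq2_def by auto
      then show thesis using that[of b21 b22] unfolding bg2_def by blast
    qed
    have small: "card {t\<in>S. n1 * g1 j t + n2 * g2 j t = 0} \<le> 2" if n: "n1 \<noteq> 0 \<or> n2 \<noteq> 0" for n1 n2
    proof (rule ccontr)
      assume "\<not> ?thesis"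
      then have "3 \<le> card {t\<in>S. n1 * g1 j t + n2 * g2 j t = 0}" by simp
      from three_distinct[OF this] obtain t1 t2 t3 where t0: "t1 \<in> {t\<in>S. n1 * g1 j t + n2 * g2 j t = 0}"
        "t2 \<in> {t\<in>S. n1 * g1 j t + n2 * g2 j t = 0}" "t3 \<in> {t\<in>S. n1 * g1 j t + n2 * g2 j t = 0}"
        "t1 \<noteq> t2" "t1 \<noteq> t3" "t2 \<noteq> t3" .
      then have t: "t1 \<in> S" "t2 \<in> S" "t3 \<in> S" "t1 \<noteq> t2" "t1 \<noteq> t3" "t2 \<noteq> t3"
        "n1 * g1 j t1 + n2 * g2 j t1 = 0" "n1 * g1 j t2 + n2 * g2 j t2 = 0" "n1 * g1 j t3 + n2 * g2 j t3 = 0" by simp_all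
      have "n1 = 0 \<and> n2 = 0" by (rule R1[OF j(1) _ _ _ _ t(7-9)]) (use t(1-6) in \<open>auto simp: S_def\<close>)
      with n show False by blast
    qed
    have "S \<subseteq> {t\<in>S. k1 * g1 j t + k2 * g2 j t = 0} \<union> {t\<in>S. l1 * g1 j t + l2 * g2 j t = 0}"
    proof
      fix t assume t: "t \<in> S"
      from alt[OF t] l(2)[of t] t show "t \<in> {t\<in>S. k1 * g1 j t + k2 * g2 j t = 0} \<union> {t\<in>S. l1 * g1 j t + l2 * g2 j t = 0}"
        by blast
    qed
    then have "card S \<le> card ({t\<in>S. k1 * g1 j t + k2 * g2 j t = 0} \<union> {t\<in>S. l1 * g1 j t + l2 * g2 j t = 0})"
      using S(1) by (intro card_mono) auto
    also have "\<dots> \<le> card {t\<in>S. k1 * g1 j t + k2 * g2 j t = 0} + card {t\<in>S. l1 * g1 j t + l2 * g2 j t = 0}" by (rule card_Un_le)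
    also have "\<dots> \<le> 4" using small[OF k] small[OF l(1)] by linarith
    finally show False using S(2) by linarith
  qed
qed

lemma singular_rows:
  fixes p q r s :: "'a::field"
  assumes "p * s - q * r = 0"
  obtains k1 k2 where "k1 \<noteq> 0 \<or> k2 \<noteq> 0" "k1 * p + k2 * r = 0" "k1 * q + k2 * s = 0"
proof -
  consider "s \<noteq> 0 \<or> q \<noteq> 0" | "s = 0" "q = 0" "r \<noteq> 0 \<or> p \<noteq> 0" | "s = 0" "q = 0" "r = 0" "p = 0" by blast
  then show thesis
  proof cases
    case 1
    then show thesis using assms by (intro that[of s "- q"]) (auto simp: algebra_simps)
  next
    case 2
    then show thesis by (intro that[of r "- p"]) (auto simp: algebra_simps)
  next
    case 3
    then show thesis by (intro that[of 1 0]) auto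
  qed
qed

section \<open>The geometric data of the excluded configuration\<close>

context arc_cone
begin

lemma functional_tangent_space:
  assumes "lin_functional F" "\<And>u. x \<frown> u \<Longrightarrow> F u = 0" "s \<in> tangent_space x"
  shows "F s = 0"
proof -
  have "tangent_space x \<subseteq> {v. F v = 0}"
    unfolding tangent_space_def using assms(2) by (intro vec.span_minimal lin_functional_kernel[OF assms(1)]) auto
  with assms(3) show ?thesis by blast
qed

text \<open>A tangent space is spanned by its point and four pairwise non-collinear neighbours, so
  five values decide.\<close>

lemma functional_four:
  assumes F: "lin_functional F" and x: "x \<noteq> 0" "x \<frown> a" "x \<frown> b" "x \<frown> c" "x \<frown> d"
    "\<not> a \<frown> b" "\<not> a \<frown> c" "\<not> a \<frown> d" "\<not> b \<frown> c" "\<not> b \<frown> d" "\<not> c \<frown> d"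
    and z: "F x = 0" "F a = 0" "F b = 0" "F c = 0" "F d = 0" and s: "s \<in> tangent_space x"
  shows "F s = 0"
proof (rule functional_tangent_space[OF F _ s])
  fix u assume "x \<frown> u"
  from four_classes_span[OF x this] obtain k k1 k2 k3 k4 where "u = k *s x + k1 *s a + k2 *s b + k3 *s c + k4 *s d" .
  then show "F u = 0" using z by (simp add: lin_functional_simps[OF F])
qed

lemma functional_zero:
  assumes F: "lin_functional F" and "x \<in> Z" "y \<in> Z" "\<not> x \<frown> y"
    and "\<And>s. s \<in> tangent_space x \<Longrightarrow> F s = 0" "\<And>s. s \<in> tangent_space y \<Longrightarrow> F s = 0"
  shows "F v = 0"
proof -
  have "v \<in> tangent_sum x y" using tangent_sum_UNIV[OF assms(2-4)] by simp
  then obtain s t where "v = s + t" "s \<in> tangent_space x" "t \<in> tangent_space y" unfolding tangent_sum_def by blast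
  then show ?thesis using assms(5,6) lin_functional_add[OF F] by simp
qed

text \<open>The common neighbours of \<open>y\<close> with \<open>x\<close> and with
  \<open>p\<close> are four different classes at \<open>y\<close> on which \<open>F\<close>
  vanishes. With \<open>F y = 0\<close> this covers the tangent space at \<open>y\<close>, and the
  tangent spaces at \<open>x\<close> and \<open>y\<close> span everything.\<close>

lemma functional_line_zero:
  assumes F: "lin_functional F" and fr: "far y x p"
    and zx: "\<And>s. s \<in> tangent_space x \<Longrightarrow> F s = 0" and zp: "\<And>s. s \<in> tangent_space p \<Longrightarrow> F s = 0" and zy: "F y = 0"
  shows "F v = 0"
proof -
  have xp: "x \<frown> p" by (rule far_coll[OF fr])
  have y0: "y \<noteq> 0" using far_first[OF fr] coll_zero[OF coll_left[OF xp]] coll_sym by blast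
  from far_nbrs[OF fr, of 1 0] obtain u v where u: "u \<frown> y" "u \<frown> 1 *s x + 0 *s p" "v \<frown> y" "v \<frown> 1 *s x + 0 *s p" "\<not> u \<frown> v" "u \<noteq> 0" "v \<noteq> 0"
    by auto
  from far_nbrs[OF fr, of 0 1] obtain u' v' where u': "u' \<frown> y" "u' \<frown> 0 *s x + 1 *s p" "v' \<frown> y" "v' \<frown> 0 *s x + 1 *s p" "\<not> u' \<frown> v'" "u' \<noteq> 0" "v' \<noteq> 0"
    by auto
  have nc: "\<not> u \<frown> u'" "\<not> u \<frown> v'" "\<not> v \<frown> u'" "\<not> v \<frown> v'"
    using far_pairs[OF fr u(1,2,6) u'(1,2,6)] far_pairs[OF fr u(1,2,6) u'(3,4,7)]
      far_pairs[OF fr u(3,4,7) u'(1,2,6)] far_pairs[OF fr u(3,4,7) u'(3,4,7)] by simp_all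
  have "x \<frown> u" "x \<frown> v" using coll_sym[OF u(2)] coll_sym[OF u(4)] by simp_all
  then have zu: "F u = 0" "F v = 0" using zx tangent_space_nbr by blast+
  have "p \<frown> u'" "p \<frown> v'" using coll_sym[OF u'(2)] coll_sym[OF u'(4)] by simp_all
  then have zu': "F u' = 0" "F v' = 0" using zp tangent_space_nbr by blast+
  have "F s = 0" if "s \<in> tangent_space y" for s
    by (rule functional_four[OF F y0 coll_sym[OF u(1)] coll_sym[OF u(3)] coll_sym[OF u'(1)] coll_sym[OF u'(3)]
        u(5) nc u'(5) zy zu zu' that])
  then show ?thesis
    using functional_zero[OF F coll_left[OF xp] far_Z[OF fr] _ zx] far_first[OF fr] coll_sym by blast
qed

lemma arc_contradiction:
  assumes "Z \<noteq> {0}" "Z \<noteq> {}"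
  shows False
proof -
  from assms obtain x where x: "x \<in> Z" "x \<noteq> 0" by blast
  obtain l :: "nat \<Rightarrow> 'a ^ 'n" where l: "\<And>i. i < 12 \<Longrightarrow> x \<frown> l i" "\<And>i j. i < 12 \<Longrightarrow> j < 12 \<Longrightarrow> i \<noteq> j \<Longrightarrow> \<not> l i \<frown> l j"
    by (rule many_nbrs[OF x]) (rule that)
  from five_scalars[OF assms] obtain c1 c2 c3 c4 :: 'a where five: "distinct [0, c1, c2, c3, c4]" .
  define u v where "u = l 10" and "v = l 11"
  have xu: "x \<frown> u" and xv: "x \<frown> v" and uv: "\<not> u \<frown> v" unfolding u_def v_def using l(1)[of 10] l(1)[of 11] l(2)[of 10 11] by simp_all
  have lu: "\<not> l j \<frown> u" "\<not> l j \<frown> v" if "j < 10" for j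
    unfolding u_def v_def using l(2)[of j 10] l(2)[of j 11] that by simp_all
  have xl: "x \<frown> l j" if "j < 10" for j using l(1)[of j] that by simp
  have ll: "\<not> l j \<frown> l t" if "j < 10" "t < 10" "j \<noteq> t" for j t using l(2)[of j t] that by simp
  from nbr_frame[OF xu xv uv x(2)] obtain \<xi> y where xi: "\<xi> \<in> \<Xi>" and f: "frame Z \<xi> x u v y" .
  note fv = frame_vertices[OF f]
  have lout: "l j \<notin> \<xi>" if "j < 10" for j
    using frame_nbr_coll[OF f _ xl[OF that]] lu[OF that] by blast
  from four_nbrs[OF fv(12) coll_sym[OF fv(15)] coll_sym[OF fv(16)] uv] obtain n1 n2 where
    n: "y \<frown> n1" "y \<frown> n2" "\<not> u \<frown> n1" "\<not> u \<frown> n2" "\<not> v \<frown> n1" "\<not> v \<frown> n2" "\<not> n1 \<frown> n2" .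
  from nbr_frame[OF coll_sym[OF fv(15)] n(1,3) fv(12)] obtain \<zeta>1 n1' where z1: "\<zeta>1 \<in> \<Xi>" and h1: "frame Z \<zeta>1 y u n1 n1'" .
  from nbr_frame[OF coll_sym[OF fv(15)] n(2,4) fv(12)] obtain \<zeta>2 n2' where z2: "\<zeta>2 \<in> \<Xi>" and h2: "frame Z \<zeta>2 y u n2 n2'" .
  note h1v = frame_vertices[OF h1] and h2v = frame_vertices[OF h2]
  have fy: "frame Z \<xi> y u v x" by (rule frame_rev[OF f])
  have nout: "n1 \<notin> \<xi>" "n2 \<notin> \<xi>"
    using frame_nbr_coll[OF fy _ n(1)] frame_nbr_coll[OF fy _ n(2)] n(3-6) coll_sym by blast+
  have zx1: "\<zeta>1 \<noteq> \<xi>" and zx2: "\<zeta>2 \<noteq> \<xi>" using nout h1v(3) h2v(3) by blast+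
  have z12: "\<zeta>1 \<noteq> \<zeta>2"
  proof
    assume "\<zeta>1 = \<zeta>2"
    then have "n2 \<in> \<zeta>1" using h2v(3) by blast
    from frame_nbr_coll[OF h1 this n(2)] n(4,7) coll_sym show False by blast
  qed
  \<comment> \<open>These vectors and \<open>u\<close> span the tangent space at the moving point
    \<open>y + B u\<close>: the three quadrics on the line \<open>y u\<close> are sheared
    simultaneously.\<close>
  let ?y = "\<lambda>B. y + B *s u" and ?v = "\<lambda>B. v + B *s x" and ?m1 = "\<lambda>B. n1 + B *s n1'" and ?m2 = "\<lambda>B. n2 + B *s n2'"
  have fB: "frame Z \<xi> x u (?v B) (?y B)" for B by (rule frame_rev[OF frame_shear[OF fy]])
  have hB1: "frame Z \<zeta>1 (?y B) u (?m1 B) n1'" for B by (rule frame_shear[OF h1])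
  have hB2: "frame Z \<zeta>2 (?y B) u (?m2 B) n2'" for B by (rule frame_shear[OF h2])
  have uout: "q \<notin> \<xi>'" if "q \<in> \<zeta>" "\<not> u \<frown> q" "q \<in> Z" "\<zeta> \<in> \<Xi>" "\<xi>' \<in> \<Xi>" "\<zeta> \<noteq> \<xi>'" "u \<in> \<zeta>" "u \<in> \<xi>'" for q \<zeta> \<xi>'
    using space_unique[OF fv(6) that(3,2) that(4,5,7,1,8)] that(6) by blast
  have nbB: "?y B \<frown> u" "?y B \<frown> ?v B" "?y B \<frown> ?m1 B" "?y B \<frown> ?m2 B" "\<not> u \<frown> ?v B" "\<not> u \<frown> ?m1 B" "\<not> u \<frown> ?m2 B"
    "?y B \<noteq> 0" "?y B \<in> Z" "\<not> x \<frown> ?y B" for B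
    using frame_vertices[OF fB[of B]] frame_vertices[OF hB1[of B]] frame_vertices[OF hB2[of B]] coll_sym by blast+
  have ncB: "\<not> p \<frown> q" if "\<zeta> \<in> \<Xi>" "\<xi>' \<in> \<Xi>" "\<zeta> \<noteq> \<xi>'" "u \<in> \<zeta>" "u \<in> \<xi>'" "?y B \<in> \<zeta>" "p \<in> \<zeta>" "q \<in> \<xi>'" "\<not> u \<frown> p" "\<not> u \<frown> q" "?y B \<frown> p" "?y B \<frown> q" for p q \<zeta> \<xi>' B
  proof
    assume h: "p \<frown> q"
    have "\<not> par (?y B) p" using par_coll_all[OF _ nbB(1)] that(9) by blast
    from no_plane[OF nbB(8) that(11,12) h this] obtain k m where "q = k *s ?y B + m *s p" by blast
    then have "q \<in> \<zeta>" using mem_lin[OF that(1,6,7)] by simp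
    with uout[OF that(8,10) coll_right[OF that(12)] that(2,1)] that(3-5) show False by blast
  qed
  have ncs: "\<not> ?v B \<frown> ?m1 B" "\<not> ?v B \<frown> ?m2 B" "\<not> ?m1 B \<frown> ?m2 B" for B
    using ncB[OF xi z1 zx1[symmetric] fv(2) h1v(2) frame_vertices(4)[OF fB] frame_vertices(3)[OF fB] frame_vertices(3)[OF hB1] nbB(5,6,2,3)]
      ncB[OF xi z2 zx2[symmetric] fv(2) h2v(2) frame_vertices(4)[OF fB] frame_vertices(3)[OF fB] frame_vertices(3)[OF hB2] nbB(5,7,2,4)]
      ncB[OF z1 z2 z12 h1v(2) h2v(2) frame_vertices(1)[OF hB1] frame_vertices(3)[OF hB1] frame_vertices(3)[OF hB2] nbB(6,7,3,4)] by blast+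
  have n'out: "n1' \<notin> \<xi>" "n2' \<notin> \<xi>"
    using space_unique[OF fv(8) h1v(8) h1v(17) z1 xi h1v(1,4) fv(4)] space_unique[OF fv(8) h2v(8) h2v(17) z2 xi h2v(1,4) fv(4)] zx1 zx2 by blast+
  have x_n': "\<not> x \<frown> n1'" "\<not> x \<frown> n2'"
  proof -
    have npu: "\<not> par u x" using par_coll_all[OF _ fv(15)] fv(17) coll_sym by blast
    have "p \<in> \<xi>" if "u \<frown> p" "x \<frown> p" for p
      using no_plane[OF fv(10) coll_sym[OF fv(13)] that npu] mem_lin[OF xi fv(2,1)] by blast
    then show "\<not> x \<frown> n1'" "\<not> x \<frown> n2'" using n'out h1v(15) h2v(15) by blast+
  qed
  have n'n': "\<not> n1' \<frown> n2'"
  proof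
    assume h: "n1' \<frown> n2'"
    have "\<not> par u n1'" using par_coll_all[OF _ coll_sym[OF fv(13)]] x_n' by blast
    from no_plane[OF fv(10) h1v(15) h2v(15) h this] obtain k m where "n2' = k *s u + m *s n1'" by blast
    then have "n2' \<in> \<zeta>1" using mem_lin[OF z1 h1v(2,4)] by simp
    with space_unique[OF fv(8) h2v(8) h2v(17) z2 z1 h2v(1,4) h1v(1)] z12 show False by blast
  qed
  have c8: "CARD('n) = 8" by (rule card_8[OF assms])
  define p q where "p = l 0" and "q = l 1"
  \<comment> \<open>A basis adapted to both tangent spaces: \<open>x\<close>, \<open>u\<close>,
    \<open>v\<close>, \<open>p\<close>, \<open>q\<close> span the one at \<open>x\<close>, and
    \<open>y\<close>, \<open>u\<close>, \<open>v\<close>, \<open>n1\<close>, \<open>n2\<close> the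
    one at \<open>y\<close>.\<close>
  define xs where "xs = [x, u, v, y, n1, n2, p, q]"
  have sx: "w \<in> vec.span {x, u, v, p, q}" if "x \<frown> w" for w
  proof -
    have x01: "x \<frown> p" "x \<frown> q" unfolding p_def q_def using xl by simp_all
    have "\<not> u \<frown> p" "\<not> u \<frown> q" "\<not> v \<frown> p" "\<not> v \<frown> q" "\<not> p \<frown> q"
      unfolding p_def q_def using lu[of 0] lu[of 1] ll[of 0 1] coll_sym by auto
    from four_classes_span[OF x(2) xu xv x01 uv this that] obtain k k1 k2 k3 k4 where
      "w = k *s x + k1 *s u + k2 *s v + k3 *s p + k4 *s q" .
    then show ?thesis by (simp add: vec.span_add vec.span_scale vec.span_base)
  qed
  have sy: "w \<in> vec.span {y, u, v, n1, n2}" if "y \<frown> w" for w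
  proof -
    from four_classes_span[OF fv(12) coll_sym[OF fv(15)] coll_sym[OF fv(16)] n(1,2) uv n(3-7) that] obtain k k1 k2 k3 k4 where
      "w = k *s y + k1 *s u + k2 *s v + k3 *s n1 + k4 *s n2" .
    then show ?thesis by (simp add: vec.span_add vec.span_scale vec.span_base)
  qed
  have "w \<in> vec.span (set xs)" for w
  proof -
    have "w \<in> tangent_sum x y" using tangent_sum_UNIV[OF fv(5,8,17)] by simp
    then obtain s t where st: "w = s + t" "s \<in> tangent_space x" "t \<in> tangent_space y" unfolding tangent_sum_def by blast
    have "tangent_space x \<subseteq> vec.span (set xs)" unfolding tangent_space_def
      using sx vec.span_mono[of "{x, u, v, p, q}" "set xs"] by (intro vec.span_minimal) (auto simp: xs_def)
    moreover have "tangent_space y \<subseteq> vec.span (set xs)" unfolding tangent_space_def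
      using sy vec.span_mono[of "{y, u, v, n1, n2}" "set xs"] by (intro vec.span_minimal) (auto simp: xs_def)
    ultimately show ?thesis using st vec.span_add by blast
  qed
  then have spxs: "vec.span (set xs) = UNIV" by blast
  have len: "length xs = 8" by (simp add: xs_def)
  from dual_basis[OF len[folded c8] spxs] obtain \<phi> where \<phi>0: "\<And>i. lin_functional (\<phi> i)"
    "\<And>i j. i < length xs \<Longrightarrow> j < length xs \<Longrightarrow> \<phi> i (xs ! j) = (if i = j then 1 else 0)" by blast
  note \<phi> = \<phi>0(1) \<phi>0(2)[unfolded len]
  \<comment> \<open>Coordinates at \<open>n1\<close>, \<open>n2\<close>, vanishing on the tangent
    space at \<open>x\<close>, and at \<open>p\<close>, \<open>q\<close>, vanishing on that at
    \<open>y\<close>. Their common kernel is \<open>\<xi>\<close>.\<close>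
  define N1 N2 M1 M2 where "N1 = \<phi> 4" and "N2 = \<phi> 5" and "M1 = \<phi> 6" and "M2 = \<phi> 7"
  have lin: "lin_functional N1" "lin_functional N2" "lin_functional M1" "lin_functional M2"
    unfolding N1_def N2_def M1_def M2_def by (rule \<phi>)+
  note ls = lin_functional_simps[OF lin(1)] lin_functional_simps[OF lin(2)] lin_functional_simps[OF lin(3)] lin_functional_simps[OF lin(4)]
  have vals: "N1 x = 0" "N1 u = 0" "N1 v = 0" "N1 y = 0" "N1 n1 = 1" "N1 n2 = 0" "N1 (p) = 0" "N1 (q) = 0"
    "N2 x = 0" "N2 u = 0" "N2 v = 0" "N2 y = 0" "N2 n1 = 0" "N2 n2 = 1" "N2 (p) = 0" "N2 (q) = 0"
    "M1 x = 0" "M1 u = 0" "M1 v = 0" "M1 y = 0" "M1 n1 = 0" "M1 n2 = 0" "M1 (p) = 1" "M1 (q) = 0"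
    "M2 x = 0" "M2 u = 0" "M2 v = 0" "M2 y = 0" "M2 n1 = 0" "M2 n2 = 0" "M2 (p) = 0" "M2 (q) = 1"
    using \<phi>(2)[of 4 0] \<phi>(2)[of 4 1] \<phi>(2)[of 4 2] \<phi>(2)[of 4 3] \<phi>(2)[of 4 4] \<phi>(2)[of 4 5] \<phi>(2)[of 4 6] \<phi>(2)[of 4 7]
     \<phi>(2)[of 5 0] \<phi>(2)[of 5 1] \<phi>(2)[of 5 2] \<phi>(2)[of 5 3] \<phi>(2)[of 5 4] \<phi>(2)[of 5 5] \<phi>(2)[of 5 6] \<phi>(2)[of 5 7]
     \<phi>(2)[of 6 0] \<phi>(2)[of 6 1] \<phi>(2)[of 6 2] \<phi>(2)[of 6 3] \<phi>(2)[of 6 4] \<phi>(2)[of 6 5] \<phi>(2)[of 6 6] \<phi>(2)[of 6 7]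
     \<phi>(2)[of 7 0] \<phi>(2)[of 7 1] \<phi>(2)[of 7 2] \<phi>(2)[of 7 3] \<phi>(2)[of 7 4] \<phi>(2)[of 7 5] \<phi>(2)[of 7 6] \<phi>(2)[of 7 7]
    unfolding N1_def N2_def M1_def M2_def xs_def by simp_all
  have Nx: "N1 w = 0 \<and> N2 w = 0" if "x \<frown> w" for w
  proof -
    have "vec.span {x, u, v, p, q} \<subseteq> {w. N1 w = 0}" "vec.span {x, u, v, p, q} \<subseteq> {w. N2 w = 0}"
      using vals by (intro vec.span_minimal lin_functional_kernel lin; simp)+
    with sx[OF that] show ?thesis by blast
  qed
  have kerxi: "w \<in> \<xi>" if z: "N1 w = 0" "N2 w = 0" "M1 w = 0" "M2 w = 0" for w
  proof -
    have "w \<in> vec.span (set xs)" using spxs by simp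
    then obtain a b c d e f g h where
      "w - a *s x - b *s u - c *s v - d *s y - e *s n1 - f *s n2 - g *s p - h *s q = 0"
      unfolding xs_def by (auto simp: vec.span_insert)
    then have w: "w = a *s x + b *s u + c *s v + d *s y + e *s n1 + f *s n2 + g *s p + h *s q"
      by (simp add: vec_eq_iff algebra_simps)
    have "e = 0" "f = 0" "g = 0" "h = 0" using z unfolding w by (simp_all add: ls vals)
    then show ?thesis unfolding w using frame_mem[OF f] by simp
  qed
  have "\<forall>j t. \<exists>\<eta>c. j < 10 \<and> t < 10 \<and> j \<noteq> t \<longrightarrow> fst \<eta>c \<in> \<Xi> \<and> frame Z (fst \<eta>c) x (l j) (l t) (snd \<eta>c)"
  proof (intro allI)
    fix j t
    show "\<exists>\<eta>c. j < 10 \<and> t < 10 \<and> j \<noteq> t \<longrightarrow> fst \<eta>c \<in> \<Xi> \<and> frame Z (fst \<eta>c) x (l j) (l t) (snd \<eta>c)"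
    proof (cases "j < 10 \<and> t < 10 \<and> j \<noteq> t")
      case True
      then have jt: "j < 10" "t < 10" "j \<noteq> t" by auto
      from nbr_frame[OF xl[OF jt(1)] xl[OF jt(2)] ll[OF jt] x(2)] obtain \<eta> c where "\<eta> \<in> \<Xi>" "frame Z \<eta> x (l j) (l t) c" .
      then show ?thesis by (intro exI[of _ "(\<eta>, c)"]) simp
    qed blast
  qed
  then obtain \<eta>c where \<eta>c: "\<And>j t. j < 10 \<and> t < 10 \<and> j \<noteq> t \<longrightarrow> fst (\<eta>c j t) \<in> \<Xi> \<and> frame Z (fst (\<eta>c j t)) x (l j) (l t) (snd (\<eta>c j t))"
    by metis
  define \<eta> c where "\<eta> j t = fst (\<eta>c j t)" and "c j t = snd (\<eta>c j t)" for j t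
  have eta: "\<eta> j t \<in> \<Xi>" "frame Z (\<eta> j t) x (l j) (l t) (c j t)" if "j < 10" "t < 10" "j \<noteq> t" for j t
    using \<eta>c that unfolding \<eta>_def c_def by blast+
  define F where "F k1 k2 w = k1 * N1 w + k2 * N2 w" for k1 k2 w
  have linF: "lin_functional (F k1 k2)" for k1 k2
    using lin_functional_sum[OF lin(1,2)] unfolding F_def[abs_def] .
  have Fx: "F k1 k2 s = 0" if "s \<in> tangent_space x" for k1 k2 s
    by (rule functional_tangent_space[OF linF _ that]) (use Nx in \<open>simp add: F_def\<close>)
  have Fn: "k1 = 0 \<and> k2 = 0" if "\<And>w. F k1 k2 w = 0" for k1 k2
    using that[of n1] that[of n2] unfolding F_def by (simp add: vals)
  have fl: "far y x (l j)" if "j < 10" for j by (rule far_intro[OF xi fv(1,4,8,17) xl[OF that] lout[OF that]])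
  \<comment> \<open>With both coefficients nonzero the combination is a vector of
    \<open>\<theta>\<close> and \<open>\<xi>\<close> outside \<open>Z\<close>, so the spaces would
    agree.\<close>
  have in_xi: "k1 = 0 \<and> k2 = 0" if w: "k1 *s p + k2 *s q \<in> \<xi>" "p \<notin> \<xi>" "q \<notin> \<xi>" "\<not> p \<frown> q" "p \<in> \<theta>" "q \<in> \<theta>" "\<theta> \<in> \<Xi>" "p \<in> Z" "q \<in> Z"
    for k1 k2 p q \<theta>
  proof -
    have "k1 = 0 \<or> k2 = 0"
    proof (rule ccontr)
      assume "\<not> ?thesis"
      then have "k1 *s p + k2 *s q \<notin> Z" using sum_notin[OF w(8,9,4)] by blast
      moreover have "k1 *s p + k2 *s q \<in> \<theta>" by (rule mem_lin[OF w(7,5,6)])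
      ultimately have "\<theta> = \<xi>" using meet[OF w(7) xi] w(1) by blast
      with w(2,5) show False by blast
    qed
    moreover have False if "k *s r \<in> \<xi>" "r \<notin> \<xi>" "k \<noteq> 0" for k r
    proof -
      have "inverse k *s (k *s r) \<in> \<xi>" by (rule mem_scale[OF xi that(1)])
      with that(2,3) show False by (simp add: vec_eq_iff)
    qed
    ultimately show ?thesis using w(1-3) by force
  qed
  show False
  proof (rule no_configuration[OF five, where ?a11.0 = "N1 n1'" and ?a12.0 = "N1 n2'" and ?a21.0 = "N2 n1'" and ?a22.0 = "N2 n2'"
      and ?b11.0 = "M1 n1'" and ?b12.0 = "M1 n2'" and ?b21.0 = "M2 n1'" and ?b22.0 = "M2 n2'"
      and ?e1.0 = "\<lambda>j. M1 (l j)" and ?e2.0 = "\<lambda>j. M2 (l j)" and ?g1.0 = "\<lambda>j t. N1 (c j t)" and ?g2.0 = "\<lambda>j t. N2 (c j t)"])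
    \<comment> \<open>A vector annihilating the rows of a singular matrix gives a nonzero functional
      that vanishes on the tangent spaces at \<open>x\<close> and at \<open>y + B u\<close>, which
      span everything.\<close>
    show "(1 + B * N1 n1') * (1 + B * N2 n2') - B * N1 n2' * (B * N2 n1') \<noteq> 0" for B
    proof
      assume "(1 + B * N1 n1') * (1 + B * N2 n2') - B * N1 n2' * (B * N2 n1') = 0"
      from singular_rows[OF this] obtain k1 k2 where k: "k1 \<noteq> 0 \<or> k2 \<noteq> 0"
        "k1 * (1 + B * N1 n1') + k2 * (B * N2 n1') = 0" "k1 * (B * N1 n2') + k2 * (1 + B * N2 n2') = 0" .
      have z: "F k1 k2 (?y B) = 0" "F k1 k2 u = 0" "F k1 k2 (?v B) = 0" "F k1 k2 (?m1 B) = 0" "F k1 k2 (?m2 B) = 0"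
        using k(2,3) unfolding F_def by (simp_all add: ls vals)
      have zB: "F k1 k2 s = 0" if "s \<in> tangent_space (?y B)" for s
        by (rule functional_four[OF linF nbB(8) nbB(1-7) ncs z that])
      have "F k1 k2 w = 0" for w by (rule functional_zero[OF linF x(1) nbB(9,10) Fx zB])
      from Fn[OF this] k(1) show False by blast
    qed
    show "\<exists>h1 h2 \<beta> \<gamma>. inj \<beta> \<and> inj \<gamma> \<and> (\<forall>B. \<exists>r1 r2.
       r1 + B * (N1 n1' * r1 + N1 n2' * r2) = N1 (c j t) \<and> r2 + B * (N2 n1' * r1 + N2 n2' * r2) = N2 (c j t) \<and>
       h1 + \<beta> B * M1 (l j) + \<gamma> B * M1 (l t) = B * (M1 n1' * r1 + M1 n2' * r2) \<and>
       h2 + \<beta> B * M2 (l j) + \<gamma> B * M2 (l t) = B * (M2 n1' * r1 + M2 n2' * r2))"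
      if jt: "j < 10" "t < 10" "j \<noteq> t" for j t
    proof -
      note et = eta[OF jt]
      have "\<forall>B. \<exists>\<beta> \<gamma>. ?y B \<frown> c j t + \<beta> *s l j + \<gamma> *s l t + (\<beta> * \<gamma>) *s x"
        using nbr_in_space[OF xi fB et lout[OF jt(1)] lout[OF jt(2)]] by blast
      then obtain \<beta> where "\<forall>B. \<exists>\<gamma>. ?y B \<frown> c j t + \<beta> B *s l j + \<gamma> *s l t + (\<beta> B * \<gamma>) *s x" by metis
      then obtain \<gamma> where z: "\<And>B. ?y B \<frown> c j t + \<beta> B *s l j + \<gamma> B *s l t + (\<beta> B * \<gamma> B) *s x" by metis
      have z': "?y B \<frown> c j t + \<gamma> B *s l t + \<beta> B *s l j + (\<gamma> B * \<beta> B) *s x" for B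
        using z[of B] by (simp add: algebra_simps)
      have "inj \<beta>"
      proof (rule injI, rule ccontr)
        fix B B' assume e: "\<beta> B = \<beta> B'" "B \<noteq> B'"
        show False by (rule nbr_in_space_inj[OF xi f et lout[OF jt(1)] lout[OF jt(2)] e(2) z z[of B', folded e(1)]])
      qed
      moreover have "inj \<gamma>"
      proof (rule injI, rule ccontr)
        fix B B' assume e: "\<gamma> B = \<gamma> B'" "B \<noteq> B'"
        show False by (rule nbr_in_space_inj[OF xi f et(1) frame_swap[OF et(2)] lout[OF jt(2)] lout[OF jt(1)] e(2) z' z'[of B', folded e(1)]])
      qed
      moreover have "\<exists>r1 r2.
         r1 + B * (N1 n1' * r1 + N1 n2' * r2) = N1 (c j t) \<and> r2 + B * (N2 n1' * r1 + N2 n2' * r2) = N2 (c j t) \<and>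
         M1 (c j t) + \<beta> B * M1 (l j) + \<gamma> B * M1 (l t) = B * (M1 n1' * r1 + M1 n2' * r2) \<and>
         M2 (c j t) + \<beta> B * M2 (l j) + \<gamma> B * M2 (l t) = B * (M2 n1' * r1 + M2 n2' * r2)" for B
      proof -
        have Nl: "N1 (l j) = 0" "N1 (l t) = 0" "N2 (l j) = 0" "N2 (l t) = 0" using Nx xl jt by blast+
        \<comment> \<open>The neighbour of \<open>y + B u\<close> in \<open>\<eta> j t\<close> is
          expanded in the tangent space; applying the four functionals yields the four equations,
          with \<open>r1\<close>, \<open>r2\<close> the coefficients at the sheared
          \<open>n1\<close>, \<open>n2\<close>.\<close>
        from four_classes_span[OF nbB(8) nbB(1-7) ncs z] obtain k k1 k2 r1 r2 where
          e: "c j t + \<beta> B *s l j + \<gamma> B *s l t + (\<beta> B * \<gamma> B) *s x = k *s ?y B + k1 *s u + k2 *s ?v B + r1 *s ?m1 B + r2 *s ?m2 B" .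
        show ?thesis
        proof (intro exI conjI)
          show "r1 + B * (N1 n1' * r1 + N1 n2' * r2) = N1 (c j t)"
            using arg_cong[OF e, of N1] by (simp add: ls vals Nl algebra_simps)
          show "r2 + B * (N2 n1' * r1 + N2 n2' * r2) = N2 (c j t)"
            using arg_cong[OF e, of N2] by (simp add: ls vals Nl algebra_simps)
          show "M1 (c j t) + \<beta> B * M1 (l j) + \<gamma> B * M1 (l t) = B * (M1 n1' * r1 + M1 n2' * r2)"
            using arg_cong[OF e, of M1] by (simp add: ls vals algebra_simps)
          show "M2 (c j t) + \<beta> B * M2 (l j) + \<gamma> B * M2 (l t) = B * (M2 n1' * r1 + M2 n2' * r2)"
            using arg_cong[OF e, of M2] by (simp add: ls vals algebra_simps)
        qed
      qed
      ultimately show ?thesis by blast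
    qed
    show "M1 (l j) * M2 (l t) - M2 (l j) * M1 (l t) \<noteq> 0" if jt: "j < 10" "t < 10" "j \<noteq> t" for j t
    proof
      note et = eta[OF jt] and ev = frame_vertices[OF eta(2)[OF jt]]
      assume "M1 (l j) * M2 (l t) - M2 (l j) * M1 (l t) = 0"
      from singular_rows[OF this] obtain k1 k2 where k: "k1 \<noteq> 0 \<or> k2 \<noteq> 0"
        "k1 * M1 (l j) + k2 * M1 (l t) = 0" "k1 * M2 (l j) + k2 * M2 (l t) = 0" .
      have Nl: "N1 (l j) = 0" "N1 (l t) = 0" "N2 (l j) = 0" "N2 (l t) = 0" using Nx xl jt by blast+
      have "k1 *s l j + k2 *s l t \<in> \<xi>" by (rule kerxi) (simp_all add: ls Nl k(2,3))
      from in_xi[OF this lout[OF jt(1)] lout[OF jt(2)] ll[OF jt] ev(2,3) et(1) ev(6,7)] k(1) show False by blast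
    qed
    \<comment> \<open>The tangent space at \<open>l j\<close> is spanned by \<open>l j\<close>,
      \<open>x\<close> and the three vertices \<open>c j t\<close>. A functional vanishing there, at
      \<open>y\<close> and on the tangent space at \<open>x\<close> is zero, since the line
      \<open>x (l j)\<close> is far from \<open>y\<close>.\<close>
    show "k1 = 0 \<and> k2 = 0"
      if t: "j < 10" "t1 < 10" "t2 < 10" "t3 < 10" "distinct [j, t1, t2, t3]"
        "k1 * N1 (c j t1) + k2 * N2 (c j t1) = 0" "k1 * N1 (c j t2) + k2 * N2 (c j t2) = 0" "k1 * N1 (c j t3) + k2 * N2 (c j t3) = 0"
      for j t1 t2 t3 k1 k2
    proof -
      have d: "j \<noteq> t1" "j \<noteq> t2" "j \<noteq> t3" "t1 \<noteq> t2" "t1 \<noteq> t3" "t2 \<noteq> t3" using t(5) by auto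
      have nc: "\<not> c j t \<frown> c j t'" if tt: "t < 10" "t' < 10" "j \<noteq> t" "j \<noteq> t'" "t \<noteq> t'" for t t'
      proof
        assume h: "c j t \<frown> c j t'"
        note g1 = eta[OF t(1) tt(1,3)] and g2 = eta[OF t(1) tt(2,4)]
        note w1 = frame_vertices[OF g1(2)] and w2 = frame_vertices[OF g2(2)]
        have "\<not> par (l j) (c j t)" using par_coll_all[OF _ coll_sym[OF w1(13)]] w1(17) by blast
        from no_plane[OF w1(10,15) w2(15) h this] obtain k m where "c j t' = k *s l j + m *s c j t" by blast
        then have "c j t' \<in> \<eta> j t" using mem_lin[OF g1(1) w1(2,4)] by simp
        from space_unique[OF w2(5,8,17) g2(1) g1(1) w2(1,4) w1(1) this] have "l t' \<in> \<eta> j t" using w2(3) by simp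
        from frame_nbr_coll[OF g1(2) this xl[OF tt(2)]] ll[OF tt(2) t(1)] ll[OF tt(2,1)] tt show False by blast
      qed
      note g1 = frame_vertices[OF eta(2)[OF t(1,2) d(1)]] and g2 = frame_vertices[OF eta(2)[OF t(1,3) d(2)]]
        and g3 = frame_vertices[OF eta(2)[OF t(1,4) d(3)]]
      have "F k1 k2 s = 0" if "s \<in> tangent_space (l j)" for s
      proof (rule functional_four[OF linF g1(10) coll_sym[OF g1(13)] g1(15) g2(15) g3(15) g1(17) g2(17) g3(17)
            nc[OF t(2,3) d(1,2,4)] nc[OF t(2,4) d(1,3,5)] nc[OF t(3,4) d(2,3,6)] _ _ _ _ _ that])
        show "F k1 k2 (l j) = 0" "F k1 k2 x = 0" using Nx[OF xl[OF t(1)]] unfolding F_def by (simp_all add: vals)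
        show "F k1 k2 (c j t1) = 0" "F k1 k2 (c j t2) = 0" "F k1 k2 (c j t3) = 0" using t(6-8) unfolding F_def by simp_all
      qed
      moreover have "F k1 k2 y = 0" unfolding F_def by (simp add: vals)
      ultimately have "F k1 k2 w = 0" for w using functional_line_zero[OF linF fl[OF t(1)] Fx] by blast
      then show ?thesis by (rule Fn)
    qed
    show "q1 = 0 \<and> q2 = 0"
      if "N1 n1' * q1 + N1 n2' * q2 = 0" "N2 n1' * q1 + N2 n2' * q2 = 0" "M1 n1' * q1 + M1 n2' * q2 = 0" "M2 n1' * q1 + M2 n2' * q2 = 0" for q1 q2
    proof -
      have "q1 *s n1' + q2 *s n2' \<in> \<xi>" by (rule kerxi) (use that in \<open>simp_all add: ls mult.commute\<close>)
      moreover from nbr_frame[OF h1v(15) h2v(15) n'n' fv(10)] obtain \<theta> e where th: "\<theta> \<in> \<Xi>" and k: "frame Z \<theta> u n1' n2' e" .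
      ultimately show ?thesis using in_xi[OF _ n'out n'n' _ _ th h1v(8) h2v(8)] frame_vertices(2,3)[OF k] by blast
    qed
    \<comment> \<open>Otherwise both \<open>N\<close> vanish on the tangent space at
      \<open>u\<close>. A combination that also vanishes at \<open>c 0 1\<close>, from which the
      line \<open>x u\<close> is far, would be zero.\<close>
    show "\<not> (N1 n1' = 0 \<and> N1 n2' = 0 \<and> N2 n1' = 0 \<and> N2 n2' = 0)"
    proof
      assume z: "N1 n1' = 0 \<and> N1 n2' = 0 \<and> N2 n1' = 0 \<and> N2 n2' = 0"
      have e01: "\<eta> 0 1 \<in> \<Xi>" "frame Z (\<eta> 0 1) x (l 0) (l 1) (c 0 1)" using eta[of 0 1] by simp_all
      note ev = frame_vertices[OF e01(2)]
      have "u \<notin> \<eta> 0 1" using frame_nbr_coll[OF e01(2) _ xu] lu[of 0] lu[of 1] coll_sym by auto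
      then have fr: "far (c 0 1) x u" by (rule far_intro[OF e01(1) ev(1,4,8,17) xu])
      obtain k1 k2 where k: "k1 \<noteq> 0 \<or> k2 \<noteq> 0" "F k1 k2 (c 0 1) = 0"
      proof (cases "N1 (c 0 1) = 0")
        case True
        then show thesis using that[of 1 0] unfolding F_def by simp
      next
        case False
        then show thesis using that[of "N2 (c 0 1)" "- N1 (c 0 1)"] unfolding F_def by (simp add: mult.commute)
      qed
      have "F k1 k2 s = 0" if "s \<in> tangent_space u" for s
        by (rule functional_four[OF linF fv(10) coll_sym[OF fv(13)] fv(15) h1v(15) h2v(15) fv(17) x_n' h1v(17) h2v(17) n'n' _ _ _ _ _ that])
          (use z in \<open>simp_all add: F_def vals\<close>)
      then have "F k1 k2 w = 0" for w using functional_line_zero[OF linF fr Fx _ k(2)] by blast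
      from Fn[OF this] k(1) show False by blast
    qed
  qed
qed

end

context grid_cone
begin

lemma all_two_classes:
  assumes "vec.span Z = UNIV" "x \<in> Z" "x \<noteq> 0"
  shows "two_classes x"
proof (rule ccontr)
  assume n: "\<not> two_classes x"
  have none: "\<not> two_classes p" if "p \<in> Z" "p \<noteq> 0" for p
    using two_classes_all[OF _ that assms(2,3)] n by blast
  interpret arc_cone Z \<Xi>
  proof unfold_locales
    show "\<exists>p q. b = p *s x + q *s a" if "x \<noteq> 0" "x \<frown> a" "x \<frown> b" "a \<frown> b" "\<not> par x a" for x a b
      by (rule no_planes[OF none that])
    show "\<exists>w. x \<frown> w \<and> \<not> w \<frown> u \<and> \<not> w \<frown> v" if "x \<noteq> 0" "x \<frown> u" "x \<frown> v" "\<not> u \<frown> v" for x u v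
      using none[OF coll_left[OF that(2)] that(1)] that unfolding two_classes_def by blast
    show "vec.span Z = UNIV" by (rule assms(1))
  qed
  show False by (rule arc_contradiction) (use assms(2,3) in blast)+
qed

text \<open>The space and the common neighbours of \<open>a\<close> and \<open>b\<close> determine
  \<open>c\<close> up to a scalar, and the scalar is fixed because \<open>x + a + b + c\<close> lies
  on the quadric.\<close>

lemma frame_unique:
  assumes "\<xi> \<in> \<Xi>" "frame Z \<xi> x a b c" "\<xi>' \<in> \<Xi>" "frame Z \<xi>' x a b c'"
  shows "c = c'"
proof -
  note f = assms(2) and g = assms(4)
  note fv = frame_vertices[OF f] and gv = frame_vertices[OF g]
  have "\<xi> = \<xi>'" by (rule space_unique[OF fv(6,7,18) assms(1,3) fv(2,3) gv(2,3)])
  then obtain p q r s where c': "c' = p *s x + q *s a + r *s b + s *s c"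
    using frame_ex[OF f] gv(4) by metis
  have z: "p * s = q * r" using gv(8) unfolding c' frame_Z[OF f] .
  have "r = 0" using frame_coll_iff[OF f _ z, of 0 0 1 0] gv(15) unfolding c' by simp
  moreover have "q = 0" using frame_coll_iff[OF f _ z, of 0 0 0 1] gv(16) unfolding c' by simp
  moreover have s: "s \<noteq> 0" using frame_first_coll[OF f z] gv(17) unfolding c' by simp
  ultimately have cs: "c' = s *s c" using z unfolding c' by simp
  have "1 *s x + 1 *s a + 1 *s b + 1 *s c' \<in> Z" using frame_Z[OF g, of 1 1 1 1] by simp
  then have "1 *s x + 1 *s a + 1 *s b + s *s c \<in> Z" unfolding cs by simp
  then have "s = 1" unfolding frame_Z[OF f] by simp
  with cs show ?thesis by simp
qed

end

section \<open>Points with two classes\<close>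

text \<open>\<open>A\<close> and \<open>B\<close> are the two classes at \<open>x\<close> together
  with the multiples of \<open>x\<close>, in which alone they overlap. The assumptions are
  symmetric, so statements about \<open>B\<close> come from those about \<open>A\<close> through
  \<open>swapped\<close>.\<close>

locale two_cone = grid_cone Z \<Xi> for Z :: "('a::field ^ 'n) set" and \<Xi> +
  fixes x :: "'a ^ 'n" and A B :: "('a ^ 'n) set"
  assumes two: "p \<in> Z \<Longrightarrow> p \<noteq> 0 \<Longrightarrow> two_classes p"
    and x0: "x \<noteq> 0" and xA: "x \<in> A" and xB: "x \<in> B"
    and A_coll: "a \<in> A \<Longrightarrow> a' \<in> A \<Longrightarrow> a \<frown> a'" and B_coll: "b \<in> B \<Longrightarrow> b' \<in> B \<Longrightarrow> b \<frown> b'"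
    and AB: "a \<in> A \<Longrightarrow> b \<in> B \<Longrightarrow> \<not> par x a \<Longrightarrow> \<not> par x b \<Longrightarrow> \<not> a \<frown> b"
    and nbrs: "x \<frown> w \<Longrightarrow> w \<in> A \<or> w \<in> B"
    and A_sub: "vec.subspace A" and B_sub: "vec.subspace B"
begin

lemma swapped: "two_cone Z \<Xi> x B A"
  by unfold_locales (use two x0 xA xB A_coll B_coll AB nbrs A_sub B_sub coll_sym in blast)+

text \<open>The fourth vertex of the quadrangle on \<open>x\<close>, \<open>a\<close>, \<open>b\<close>, scaled such that \<open>x + a + b + corner a b\<close> is in \<open>Z\<close>.
  The junk value 0 on multiples of \<open>x\<close> is what makes it bilinear on complements of \<open>x\<close> in \<open>A\<close> and \<open>B\<close>.\<close>

definition corner :: "'a ^ 'n \<Rightarrow> 'a ^ 'n \<Rightarrow> 'a ^ 'n" where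
  "corner a b = (if par x a \<or> par x b then 0 else THE c. \<exists>\<xi>\<in>\<Xi>. frame Z \<xi> x a b c)"

lemma corner_eqI: assumes "\<xi> \<in> \<Xi>" "frame Z \<xi> x a b c" shows "corner a b = c"
proof -
  note fv = frame_vertices[OF assms(2)]
  have "\<not> par x a" "\<not> par x b" using par_coll_all fv(13,14,18) coll_sym by blast+
  moreover have "(THE c. \<exists>\<xi>\<in>\<Xi>. frame Z \<xi> x a b c) = c"
    by (rule the_equality) (use assms frame_unique in blast)+
  ultimately show ?thesis unfolding corner_def by simp
qed

lemma corner_frame:
  assumes "a \<in> A" "b \<in> B" "\<not> par x a" "\<not> par x b"
  obtains \<xi> where "\<xi> \<in> \<Xi>" "frame Z \<xi> x a b (corner a b)"
proof -
  from nbr_frame[OF A_coll[OF xA assms(1)] B_coll[OF xB assms(2)] AB[OF assms] x0] obtain \<xi> c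
    where "\<xi> \<in> \<Xi>" "frame Z \<xi> x a b c" .
  with corner_eqI that show thesis by blast
qed

lemma corner_scale:
  assumes "a \<in> A" "b \<in> B" shows "corner (k *s a) b = k *s corner a b"
proof (cases "k = 0 \<or> par x a \<or> par x b")
  case True
  then have "par x (k *s a) \<or> par x b" using par_lin[of x a a k 0] par_zero by auto
  moreover have "k *s corner a b = 0" using True unfolding corner_def by auto
  ultimately show ?thesis unfolding corner_def by auto
next
  case False
  then have k: "k \<noteq> 0" and np: "\<not> par x a" "\<not> par x b" by auto
  from corner_frame[OF assms np] obtain \<xi> where xi: "\<xi> \<in> \<Xi>" and f: "frame Z \<xi> x a b (corner a b)" .
  have "frame Z \<xi> x (k *s a) b (k *s corner a b)"
    by (rule frame_rot[OF frame_swap[OF frame_scale[OF frame_swap[OF frame_rot[OF f]] k]]])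
  from corner_eqI[OF xi this] show ?thesis .
qed

lemma corner_shift:
  assumes "a \<in> A" "b \<in> B" "\<not> par x a" "\<not> par x b"
  shows "corner (a + k *s x) b = corner a b + k *s b"
proof -
  from corner_frame[OF assms] obtain \<xi> where xi: "\<xi> \<in> \<Xi>" and f: "frame Z \<xi> x a b (corner a b)" .
  from corner_eqI[OF xi frame_rot[OF frame_shear[OF frame_rot[OF f]]]] show ?thesis .
qed

text \<open>The vertex for \<open>a1 + a2\<close> is located as a common neighbour of
  \<open>b\<close> and \<open>a1 + a2\<close>, which fixes it only up to a scalar. The independence
  statement allows the scalars to be compared afterwards.\<close>

lemma corner_add_proportional:
  assumes a: "a1 \<in> A" "a2 \<in> A" and b: "b \<in> B" "\<not> par x b"
    and ind: "\<not> par x a1" "\<forall>p q. a2 \<noteq> p *s x + q *s a1"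
  shows "\<exists>m n. corner (a1 + a2) b = m *s (corner a1 b + n *s corner a2 b)"
    and "r *s b + p *s corner a1 b + q *s corner a2 b = 0 \<Longrightarrow> r = 0 \<and> p = 0 \<and> q = 0"
proof -
  have np2: "\<not> par x a2"
  proof
    assume "par x a2"
    then obtain k where "a2 = k *s x" unfolding par_def by blast
    then have "a2 = k *s x + 0 *s a1" by simp
    with ind(2) show False by blast
  qed
  have np3: "\<not> par x (a1 + a2)" using indep_par[OF ind(2), of 1 1] by simp
  have a3: "a1 + a2 \<in> A" by (rule vec.subspace_add[OF A_sub a])
  from corner_frame[OF a(1) b(1) ind(1) b(2)] obtain \<xi>1 where x1: "\<xi>1 \<in> \<Xi>" and f1: "frame Z \<xi>1 x a1 b (corner a1 b)" .
  from corner_frame[OF a(2) b(1) np2 b(2)] obtain \<xi>2 where x2: "\<xi>2 \<in> \<Xi>" and f2: "frame Z \<xi>2 x a2 b (corner a2 b)" .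
  from corner_frame[OF a3 b(1) np3 b(2)] obtain \<xi>3 where x3: "\<xi>3 \<in> \<Xi>" and f3: "frame Z \<xi>3 x (a1 + a2) b (corner (a1 + a2) b)" .
  note v1 = frame_vertices[OF f1] and v2 = frame_vertices[OF f2]
  let ?c1 = "corner a1 b" and ?c2 = "corner a2 b" and ?c3 = "corner (a1 + a2) b"
  have ne: "\<xi>1 \<noteq> \<xi>2"
  proof
    assume "\<xi>1 = \<xi>2"
    then have "a2 \<in> \<xi>1" using v2(2) by simp
    from frame_nbr[OF f1 this v2(13)] show False
    proof cases
      case (1 p q)
      with ind(2) show False by blast
    next
      case (2 p q)
      then have "a2 \<frown> b" using coll_lin_mixed[OF v1(14)] coll_sym by blast
      with v2(18) show False by blast
    qed
  qed
  have c2out: "?c2 \<notin> \<xi>1" using space_unique[OF v2(5,8,17) x2 x1 v2(1,4) v1(1)] ne by blast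
  show "r = 0 \<and> p = 0 \<and> q = 0" if e: "r *s b + p *s ?c1 + q *s ?c2 = 0" for r p q
  proof -
    have "q = 0"
    proof (rule ccontr)
      assume q: "q \<noteq> 0"
      have "q *s ?c2 = - (r *s b + p *s ?c1)" using e by (metis add.commute eq_neg_iff_add_eq_0)
      then have "inverse q *s (q *s ?c2) = inverse q *s (- (r *s b + p *s ?c1))" by simp
      then have "?c2 = (- inverse q * r) *s b + (- inverse q * p) *s ?c1"
        using q by (simp add: vec_eq_iff algebra_simps)
      with mem_lin[OF x1 v1(3,4)] c2out show False by metis
    qed
    with e have "0 *s x + 0 *s a1 + r *s b + p *s ?c1 = 0" by simp
    from frame_indep[OF f1 this] \<open>q = 0\<close> show ?thesis by blast
  qed
  note indep = this
  \<comment> \<open>At \<open>b\<close> there are only two classes, and neither of these neighbours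
    is in the class of \<open>x\<close>.\<close>
  have c12: "?c2 \<frown> ?c1"
    using two_classes_any[OF two[OF v1(7,11)] v1(11) coll_sym[OF v1(14)] v1(16) v1(17) v2(16)] v2(17) coll_sym by blast
  have n12: "\<not> a1 \<frown> ?c2"
  proof
    assume h: "a1 \<frown> ?c2"
    have "a1 \<in> \<xi>2" by (rule nbr_mem[OF coll_sym[OF v1(13)] h v2(17) x2 v2(1,4)])
    with space_unique[OF v1(6,7,18) x1 x2 v1(2,3) this v2(3)] ne show False by blast
  qed
  from nbr_frame[OF A_coll[OF a(2,1)] v2(15) n12 v2(10)] obtain \<zeta> d where ze: "\<zeta> \<in> \<Xi>" and g: "frame Z \<zeta> a2 a1 ?c2 d" .
  obtain k where k: "?c1 = k *s d"
  proof -
    from common_nbr[OF ze frame_rot[OF g] coll_sym[OF v1(15)] coll_sym[OF c12]]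
    show thesis
    proof
      assume "\<exists>k. ?c1 = k *s a2"
      then obtain k where "?c1 = k *s a2" by blast
      then have "x \<frown> ?c1" using coll_scale_right[OF v2(13)] by simp
      with v1(17) show thesis by blast
    qed (use that in blast)
  qed
  have k0: "k \<noteq> 0" using k v1(12) by auto
  have g2: "frame Z \<zeta> a2 a1 (k *s ?c2) ?c1"
    unfolding k using frame_rev[OF frame_swap[OF frame_scale[OF frame_swap[OF frame_rev[OF g]] k0]]] by (rule frame_swap[OF frame_swap])
  \<comment> \<open>In the quadric on the lines \<open>a1 a2\<close> and \<open>?c1 ?c2\<close> this
    is the point collinear with \<open>a1 + a2\<close>.\<close>
  let ?w = "?c1 + k *s ?c2"
  have wa: "?w \<frown> a1 + a2"
  proof -
    have "1 *s a2 + 1 *s a1 + 0 *s (k *s ?c2) + 0 *s ?c1 \<frown> 0 *s a2 + 0 *s a1 + 1 *s (k *s ?c2) + 1 *s ?c1"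
      by (subst frame_coll_iff[OF g2]) simp_all
    then show ?thesis using coll_sym by (simp add: add.commute)
  qed
  have wb: "?w \<frown> b" using coll_sym[OF coll_add[OF v1(11,16) v2(16) coll_sym[OF c12], of 1 k]] by simp
  have w0: "?w \<noteq> 0" using indep[of 0 1 k] by auto
  have wx: "?w \<noteq> m *s x" for m
  proof
    assume e: "?w = m *s x"
    then have m: "m \<noteq> 0" using w0 by auto
    have "?c1 \<frown> 1 *s ?c1 + k *s ?c2" by (rule coll_lin_right[OF coll_sym[OF c12]])
    then have "?c1 \<frown> m *s x" using e by simp
    from coll_unscale_right[OF this m] v1(17) coll_sym show False by blast
  qed
  from common_nbr[OF x3 frame_rot[OF f3] wa wb] wx obtain m where m: "?w = m *s ?c3" by blast
  then have m0: "m \<noteq> 0" using w0 by auto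
  have "?c3 = inverse m *s ?w" unfolding m using m0 by (simp add: vec_eq_iff)
  then show "\<exists>m n. ?c3 = m *s (?c1 + n *s ?c2)" by blast
qed

text \<open>Replacing \<open>a1\<close> by \<open>a1 + x\<close> adds \<open>b\<close> to both \<open>corner (a1 + a2) b\<close> and \<open>corner a1 b\<close>, which fixes the
  factor of proportionality.\<close>

lemma corner_add_independent:
  assumes a: "a1 \<in> A" "a2 \<in> A" and b: "b \<in> B" "\<not> par x b"
    and ind: "\<not> par x a1" "\<forall>p q. a2 \<noteq> p *s x + q *s a1"
  shows "corner (a1 + a2) b = corner a1 b + corner a2 b"
proof -
  have half: "\<exists>n. corner (a1 + a2) b = corner a1 b + n *s corner a2 b"
    if a: "a1 \<in> A" "a2 \<in> A" and ind: "\<not> par x a1" "\<forall>p q. a2 \<noteq> p *s x + q *s a1" for a1 a2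
  proof -
    have a3: "a1 + a2 \<in> A" by (rule vec.subspace_add[OF A_sub a])
    have np3: "\<not> par x (a1 + a2)" using indep_par[OF ind(2), of 1 1] by simp
    have a1x: "a1 + 1 *s x \<in> A" using vec.subspace_add[OF A_sub a(1) xA] by simp
    have np1: "\<not> par x (a1 + 1 *s x)"
    proof
      assume "par x (a1 + 1 *s x)"
      from par_lin[OF this par_self, of 1 "-1"] ind(1) show False by simp
    qed
    have ind1: "\<forall>p q. a2 \<noteq> p *s x + q *s (a1 + 1 *s x)"
    proof (intro allI notI)
      fix p q assume "a2 = p *s x + q *s (a1 + 1 *s x)"
      then have "a2 = (p + q) *s x + q *s a1" by (simp add: vec_eq_iff algebra_simps)
      with ind(2) show False by blast
    qed
    from corner_add_proportional(1)[OF a b ind] obtain m n where 1: "corner (a1 + a2) b = m *s (corner a1 b + n *s corner a2 b)" by blast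
    from corner_add_proportional(1)[OF a1x a(2) b np1 ind1] obtain m' n' where
      2: "corner (a1 + 1 *s x + a2) b = m' *s (corner (a1 + 1 *s x) b + n' *s corner a2 b)" by blast
    have e: "a1 + 1 *s x + a2 = (a1 + a2) + 1 *s x" by simp
    have "corner (a1 + a2) b + 1 *s b = m' *s (corner a1 b + 1 *s b + n' *s corner a2 b)"
      by (rule 2[unfolded e corner_shift[OF a3 b(1) np3 b(2)] corner_shift[OF a(1) b(1) ind(1) b(2)]])
    then have "(1 - m') *s b + (m - m') *s corner a1 b + (m * n - m' * n') *s corner a2 b = 0"
      unfolding 1 by (simp add: vec_eq_iff algebra_simps)
    from corner_add_proportional(2)[OF a b ind this] have "m = 1" by simp
    with 1 show ?thesis by auto
  qed
  have ind': "\<not> par x a2" "\<forall>p q. a1 \<noteq> p *s x + q *s a2"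
  proof -
    show np: "\<not> par x a2"
    proof
      assume "par x a2"
      then obtain k where "a2 = k *s x" unfolding par_def by blast
      then have "a2 = k *s x + 0 *s a1" by simp
      with ind(2) show False by blast
    qed
    show "\<forall>p q. a1 \<noteq> p *s x + q *s a2"
    proof (intro allI notI)
      fix p q assume e: "a1 = p *s x + q *s a2"
      show False
      proof (cases "q = 0")
        case True
        with e have "a1 = p *s x" by simp
        with ind(1) par_scale show False by blast
      next
        case False
        from solve_second[OF e this] ind(2) show False by blast
      qed
    qed
  qed
  from half[OF a ind] obtain n where 1: "corner (a1 + a2) b = corner a1 b + n *s corner a2 b" by blast
  from half[OF a(2,1) ind'] obtain n' where 2: "corner (a2 + a1) b = corner a2 b + n' *s corner a1 b" by blast
  \<comment> \<open>Both orders of the sum have the same vertex, so the remaining factors are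
    1.\<close>
  have "0 *s b + (1 - n') *s corner a1 b + (n - 1) *s corner a2 b = 0"
    using 1 2 by (simp add: add.commute vec_eq_iff algebra_simps)
  from corner_add_proportional(2)[OF a b ind this] 1 show ?thesis by simp
qed

text \<open>On a subspace of \<open>A\<close> avoiding \<open>x\<close>, the only multiple of
  \<open>x\<close> is 0 and dependence modulo \<open>x\<close> is proportionality. So additivity
  comes from \<open>corner_add_independent\<close> or, for proportional vectors, from
  \<open>corner_scale\<close>.\<close>

lemma corner_linear:
  assumes A': "vec.subspace A'" "A' \<subseteq> A" "x \<notin> A'" and a: "a1 \<in> A'" "a2 \<in> A'" and b: "b \<in> B"
  shows "corner (p *s a1 + q *s a2) b = p *s corner a1 b + q *s corner a2 b"
proof (cases "par x b")
  case True
  then show ?thesis unfolding corner_def by simp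
next
  case False
  have npar: "a = 0" if "par x a" "a \<in> A'" for a
  proof (rule ccontr)
    assume "a \<noteq> 0"
    from par_sym[OF that(1) this] obtain k where "x = k *s a" unfolding par_def by blast
    with vec.subspace_scale[OF A'(1) that(2)] A'(3) show False by metis
  qed
  have add: "corner (a + a') b = corner a b + corner a' b" if aa: "a \<in> A'" "a' \<in> A'" for a a'
  proof (cases "par x a \<or> (\<exists>p q. a' = p *s x + q *s a)")
    case True
    show ?thesis
    proof (cases "par x a")
      case True
      then show ?thesis using npar[OF True aa(1)] unfolding corner_def by simp
    next
      case False
      with True obtain p q where e: "a' = p *s x + q *s a" by blast
      have "p *s x \<in> A'"
      proof -
        have "p *s x = a' - q *s a" unfolding e by simp
        then show ?thesis using vec.subspace_diff[OF A'(1) aa(2) vec.subspace_scale[OF A'(1) aa(1)]] by simp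
      qed
      from npar[OF par_scale this] have e': "a' = q *s a" unfolding e by simp
      have "a + a' = (1 + q) *s a" unfolding e' by (simp add: vec_eq_iff algebra_simps)
      then have "corner (a + a') b = (1 + q) *s corner a b" using corner_scale[of a b "1 + q"] aa A'(2) b by auto
      moreover have "corner a' b = q *s corner a b" unfolding e' using corner_scale[of a b q] aa A'(2) b by auto
      ultimately show ?thesis by (simp add: vec_eq_iff algebra_simps)
    qed
  next
    case n: False
    show ?thesis by (rule corner_add_independent) (use n aa A'(2) b False in blast)+
  qed
  have "p *s a1 \<in> A'" "q *s a2 \<in> A'" using vec.subspace_scale[OF A'(1)] a by blast+
  moreover have "a1 \<in> A" "a2 \<in> A" using a A'(2) by blast+
  ultimately show ?thesis using add corner_scale[OF _ b] by simp
qed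

lemma corner_swap:
  assumes "a \<in> A" "b \<in> B" shows "two_cone.corner Z \<Xi> x b a = corner a b"
proof -
  interpret sw: two_cone Z \<Xi> x B A by (rule swapped)
  show ?thesis
  proof (cases "par x a \<or> par x b")
    case True
    then show ?thesis unfolding corner_def sw.corner_def by auto
  next
    case False
    then have np: "\<not> par x a" "\<not> par x b" by auto
    from corner_frame[OF assms np] obtain \<xi> where "\<xi> \<in> \<Xi>" "frame Z \<xi> x a b (corner a b)" .
    with sw.corner_eqI[OF _ frame_swap] show ?thesis by blast
  qed
qed

lemma corner_linear_right:
  assumes B': "vec.subspace B'" "B' \<subseteq> B" "x \<notin> B'" and b: "b1 \<in> B'" "b2 \<in> B'" and a: "a \<in> A"
  shows "corner a (p *s b1 + q *s b2) = p *s corner a b1 + q *s corner a b2"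
proof -
  interpret sw: two_cone Z \<Xi> x B A by (rule swapped)
  have "p *s b1 + q *s b2 \<in> B" using b B'(1,2) vec.subspace_add vec.subspace_scale by blast
  then have s: "sw.corner (p *s b1 + q *s b2) a = corner a (p *s b1 + q *s b2)" "sw.corner b1 a = corner a b1" "sw.corner b2 a = corner a b2"
    using corner_swap[OF a] b B'(2) by blast+
  show ?thesis using sw.corner_linear[OF B' b a, of p q] unfolding s .
qed

section \<open>Parametrization of the cone by pairs from the two classes\<close>

definition x_coord :: "'a ^ 'n \<Rightarrow> 'a" where
  "x_coord v = v $ (SOME i. x $ i \<noteq> 0) / x $ (SOME i. x $ i \<noteq> 0)"

definition x_proj :: "'a ^ 'n \<Rightarrow> 'a ^ 'n" where
  "x_proj v = v - x_coord v *s x"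

text \<open>The image of \<open>a \<otimes> b\<close> when \<open>x \<otimes> x\<close>, \<open>a' \<otimes> x\<close> and \<open>x \<otimes> b'\<close> are identified with \<open>x\<close>, \<open>a'\<close> and \<open>b'\<close>.\<close>

definition segre_pt :: "'a ^ 'n \<Rightarrow> 'a ^ 'n \<Rightarrow> 'a ^ 'n" where
  "segre_pt a b = (x_coord a * x_coord b) *s x + x_coord b *s x_proj a + x_coord a *s x_proj b + corner (x_proj a) (x_proj b)"

lemma x_coord_x: "x_coord x = 1"
proof -
  have "\<exists>i. x $ i \<noteq> 0" using x0 by (auto simp: vec_eq_iff)
  from someI_ex[OF this] show ?thesis unfolding x_coord_def by simp
qed

lemma x_coord_lin: "x_coord (p *s u + q *s v) = p * x_coord u + q * x_coord v"
  unfolding x_coord_def by (simp add: add_divide_distrib)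

lemma x_proj_lin: "x_proj (p *s u + q *s v) = p *s x_proj u + q *s x_proj v"
  unfolding x_proj_def x_coord_lin by (simp add: vec_eq_iff algebra_simps)

lemma x_proj_x: "x_proj x = 0"
  unfolding x_proj_def x_coord_x by simp

lemma x_coord_x_proj: "x_coord (x_proj v) = 0"
  using x_coord_lin[of 1 v "- x_coord v" x] unfolding x_proj_def x_coord_x by (simp add: vec_eq_iff algebra_simps)

lemma x_proj_decomp: "v = x_coord v *s x + x_proj v"
  unfolding x_proj_def by simp

lemma x_proj_zero: "x_proj a = 0 \<longleftrightarrow> par x a"
proof
  assume "x_proj a = 0"
  with x_proj_decomp[of a] have "a = x_coord a *s x" by simp
  then show "par x a" unfolding par_def by blast
next
  assume "par x a"
  then obtain k where "a = k *s x" unfolding par_def by blast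
  with x_proj_lin[of k x 0 x] show "x_proj a = 0" by (simp add: x_proj_x)
qed

lemma par_x_proj: "par x (x_proj a) \<longleftrightarrow> par x a"
proof
  assume "par x (x_proj a)"
  then have "x_proj (x_proj a) = 0" using x_proj_zero by blast
  then have "x_proj a = 0" unfolding x_proj_def[of "x_proj a"] x_coord_x_proj by simp
  with x_proj_zero show "par x a" by blast
next
  assume "par x a"
  then have "x_proj a = 0" using x_proj_zero by blast
  with par_zero show "par x (x_proj a)" by simp
qed

lemma x_proj_sub: assumes "vec.subspace S" "x \<in> S" "a \<in> S" shows "x_proj a \<in> S"
  unfolding x_proj_def using vec.subspace_diff[OF assms(1,3) vec.subspace_scale[OF assms(1,2)]] .

text \<open>\<open>x_coord\<close> is a functional with value 1 at \<open>x\<close>, so its kernel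
  cuts complements of \<open>x\<close> out of both classes; on these \<open>corner\<close> is
  bilinear.\<close>

lemma kernel_sub: assumes "vec.subspace S" shows "vec.subspace {v \<in> S. x_coord v = 0}"
proof (rule vec.subspaceI)
  show "0 \<in> {v \<in> S. x_coord v = 0}" using vec.subspace_0[OF assms] x_coord_lin[of 0 0 0 0] by simp
  show "u + v \<in> {v \<in> S. x_coord v = 0}" if "u \<in> {v \<in> S. x_coord v = 0}" "v \<in> {v \<in> S. x_coord v = 0}" for u v
    using vec.subspace_add[OF assms] that x_coord_lin[of 1 u 1 v] by simp
  show "c *s v \<in> {v \<in> S. x_coord v = 0}" if "v \<in> {v \<in> S. x_coord v = 0}" for c v
    using vec.subspace_scale[OF assms] that x_coord_lin[of c v 0 v] by simp
qed

lemma segre_pt_lin_left: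
  assumes a: "a1 \<in> A" "a2 \<in> A" and b: "b \<in> B"
  shows "segre_pt (p *s a1 + q *s a2) b = p *s segre_pt a1 b + q *s segre_pt a2 b"
proof -
  have "corner (p *s x_proj a1 + q *s x_proj a2) (x_proj b) = p *s corner (x_proj a1) (x_proj b) + q *s corner (x_proj a2) (x_proj b)"
    by (rule corner_linear[OF kernel_sub[OF A_sub]]) (use x_proj_sub[OF A_sub xA] x_proj_sub[OF B_sub xB] a b x_coord_x_proj x_coord_x in auto)
  then show ?thesis unfolding segre_pt_def x_coord_lin x_proj_lin by (simp add: vec_eq_iff algebra_simps)
qed

lemma segre_pt_lin_right:
  assumes b: "b1 \<in> B" "b2 \<in> B" and a: "a \<in> A"
  shows "segre_pt a (p *s b1 + q *s b2) = p *s segre_pt a b1 + q *s segre_pt a b2"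
proof -
  have "corner (x_proj a) (p *s x_proj b1 + q *s x_proj b2) = p *s corner (x_proj a) (x_proj b1) + q *s corner (x_proj a) (x_proj b2)"
    by (rule corner_linear_right[OF kernel_sub[OF B_sub]]) (use x_proj_sub[OF A_sub xA] x_proj_sub[OF B_sub xB] a b x_coord_x_proj x_coord_x in auto)
  then show ?thesis unfolding segre_pt_def x_coord_lin x_proj_lin by (simp add: vec_eq_iff algebra_simps)
qed

lemma corner_zero: "corner a 0 = 0" "corner 0 b = 0"
  unfolding corner_def using par_zero by auto

lemma segre_pt_par_left: assumes "x_proj a = 0" shows "segre_pt a b = x_coord a *s b"
proof -
  have "segre_pt a b = x_coord a *s (x_coord b *s x + x_proj b)" unfolding segre_pt_def assms corner_zero by (simp add: vec_eq_iff algebra_simps)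
  then show ?thesis using x_proj_decomp[of b] by simp
qed

lemma segre_pt_par_right: assumes "x_proj b = 0" shows "segre_pt a b = x_coord b *s a"
proof -
  have "segre_pt a b = x_coord b *s (x_coord a *s x + x_proj a)" unfolding segre_pt_def assms corner_zero by (simp add: vec_eq_iff algebra_simps)
  then show ?thesis using x_proj_decomp[of a] by simp
qed

lemma segre_pt_x_right: "segre_pt a x = a"
  using segre_pt_par_right[OF x_proj_x] x_coord_x by simp

lemma segre_pt_frame:
  assumes "a \<in> A" "b \<in> B" "\<not> par x a" "\<not> par x b"
  obtains \<xi> where "\<xi> \<in> \<Xi>" "frame Z \<xi> x (x_proj a) (x_proj b) (corner (x_proj a) (x_proj b))"
    "segre_pt a b = (x_coord a * x_coord b) *s x + x_coord b *s x_proj a + x_coord a *s x_proj b + 1 *s corner (x_proj a) (x_proj b)"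
proof -
  have "\<not> par x (x_proj a)" "\<not> par x (x_proj b)" using assms(3,4) par_x_proj by blast+
  from corner_frame[OF x_proj_sub[OF A_sub xA assms(1)] x_proj_sub[OF B_sub xB assms(2)] this] obtain \<xi> where
    "\<xi> \<in> \<Xi>" "frame Z \<xi> x (x_proj a) (x_proj b) (corner (x_proj a) (x_proj b))" .
  then show thesis by (rule that) (simp add: segre_pt_def)
qed

lemma A_Z: "a \<in> A \<Longrightarrow> a \<in> Z" and B_Z: "b \<in> B \<Longrightarrow> b \<in> Z"
  using coll_left[OF A_coll] coll_left[OF B_coll] by blast+

lemma segre_pt_Z: assumes "a \<in> A" "b \<in> B" shows "segre_pt a b \<in> Z"
proof (cases "par x a \<or> par x b")
  case True
  then show ?thesis
  proof
    assume "par x a"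
    with segre_pt_par_left x_proj_zero have "segre_pt a b = x_coord a *s b" by blast
    with Z_scale[OF B_Z[OF assms(2)]] show ?thesis by simp
  next
    assume "par x b"
    with segre_pt_par_right x_proj_zero have "segre_pt a b = x_coord b *s a" by blast
    with Z_scale[OF A_Z[OF assms(1)]] show ?thesis by simp
  qed
next
  case False
  then have "\<not> par x a" "\<not> par x b" by auto
  from segre_pt_frame[OF assms this] obtain \<xi> where f: "frame Z \<xi> x (x_proj a) (x_proj b) (corner (x_proj a) (x_proj b))"
    and e: "segre_pt a b = (x_coord a * x_coord b) *s x + x_coord b *s x_proj a + x_coord a *s x_proj b + 1 *s corner (x_proj a) (x_proj b)" .
  show ?thesis unfolding e frame_Z[OF f] by (simp add: mult.commute)
qed

lemma segre_pt_zero: assumes "a \<in> A" "b \<in> B" "segre_pt a b = 0" shows "a = 0 \<or> b = 0"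
proof (cases "par x a \<or> par x b")
  case True
  then show ?thesis
  proof
    assume "par x a"
    then have z: "x_proj a = 0" using x_proj_zero by blast
    from segre_pt_par_left[OF z] assms(3) have "x_coord a = 0 \<or> b = 0" by simp
    with x_proj_decomp[of a] z show ?thesis by auto
  next
    assume "par x b"
    then have z: "x_proj b = 0" using x_proj_zero by blast
    from segre_pt_par_right[OF z] assms(3) have "x_coord b = 0 \<or> a = 0" by simp
    with x_proj_decomp[of b] z show ?thesis by auto
  qed
next
  case False
  then have "\<not> par x a" "\<not> par x b" by auto
  from segre_pt_frame[OF assms(1,2) this] obtain \<xi> where f: "frame Z \<xi> x (x_proj a) (x_proj b) (corner (x_proj a) (x_proj b))"
    and e: "segre_pt a b = (x_coord a * x_coord b) *s x + x_coord b *s x_proj a + x_coord a *s x_proj b + 1 *s corner (x_proj a) (x_proj b)" .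
  from frame_indep[OF f e[symmetric, unfolded assms(3)]] show ?thesis by simp
qed

lemma segre_pt_nbr: assumes "a \<in> A" "b \<in> B" "x \<frown> segre_pt a b" shows "par x a \<or> par x b"
proof (rule ccontr)
  assume "\<not> ?thesis"
  then have "\<not> par x a" "\<not> par x b" by auto
  from segre_pt_frame[OF assms(1,2) this] obtain \<xi> where f: "frame Z \<xi> x (x_proj a) (x_proj b) (corner (x_proj a) (x_proj b))"
    and e: "segre_pt a b = (x_coord a * x_coord b) *s x + x_coord b *s x_proj a + x_coord a *s x_proj b + 1 *s corner (x_proj a) (x_proj b)" .
  from assms(3) show False unfolding e by (subst (asm) frame_first_coll[OF f]) (simp_all add: mult.commute)
qed

lemma segre_pt_coll_left: assumes "a \<in> A" "a' \<in> A" "b \<in> B" shows "segre_pt a b \<frown> segre_pt a' b"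
  unfolding coll_def segre_pt_lin_left[OF assms, symmetric]
  using segre_pt_Z[OF vec.subspace_add[OF A_sub vec.subspace_scale[OF A_sub assms(1)] vec.subspace_scale[OF A_sub assms(2)]] assms(3)]
  by blast

lemma segre_pt_coll_right: assumes "a \<in> A" "b \<in> B" "b' \<in> B" shows "segre_pt a b \<frown> segre_pt a b'"
  unfolding coll_def segre_pt_lin_right[OF assms(2,3,1), symmetric]
  using segre_pt_Z[OF assms(1) vec.subspace_add[OF B_sub vec.subspace_scale[OF B_sub assms(2)] vec.subspace_scale[OF B_sub assms(3)]]]
  by blast

lemma segre_pt_par_cancel_right:
  assumes "a \<in> A" "a \<noteq> 0" "b \<in> B" "b' \<in> B" "par (segre_pt a b) (segre_pt a b')" shows "par b b'"
proof -
  from assms(5) obtain k where "segre_pt a b' = k *s segre_pt a b" unfolding par_def by blast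
  then have "segre_pt a (1 *s b' + (- k) *s b) = 0"
    unfolding segre_pt_lin_right[OF assms(4,3,1)] by (simp add: vec_eq_iff)
  moreover have "1 *s b' + (- k) *s b \<in> B"
    using vec.subspace_add[OF B_sub vec.subspace_scale[OF B_sub assms(4)] vec.subspace_scale[OF B_sub assms(3)]] .
  ultimately have "1 *s b' + (- k) *s b = 0" using segre_pt_zero[OF assms(1)] assms(2) by blast
  then have "b' = k *s b" by (simp add: vec_eq_iff)
  then show ?thesis unfolding par_def by blast
qed

text \<open>This is the case \<open>t = x\<close> of the next lemma, since \<open>s'\<close> is
  \<open>segre_pt s' x\<close>. Transitivity at \<open>s\<close> would carry the collinearity over
  to \<open>x\<close>, whose neighbours are known.\<close>

lemma segre_pt_not_coll_x:
  assumes s: "s \<in> A" "s' \<in> A" "s \<noteq> 0" "\<not> par s s'" and t: "t' \<in> B" "\<not> par x t'"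
  shows "\<not> s' \<frown> segre_pt s t'"
proof
  assume h: "s' \<frown> segre_pt s t'"
  show False
  proof (cases "par x s")
    case True
    then obtain k where k: "s = k *s x" unfolding par_def by blast
    with s(3) have k0: "k \<noteq> 0" by auto
    have "x_coord s = k" using x_coord_lin[of k x 0 x] unfolding k x_coord_x by simp
    moreover have "x_proj s = 0" using True x_proj_zero by blast
    ultimately have "segre_pt s t' = k *s t'" using segre_pt_par_left by metis
    with h have "s' \<frown> k *s t'" by simp
    from coll_unscale_right[OF this k0] have c: "s' \<frown> t'" .
    have "\<not> par x s'"
    proof
      assume "par x s'"
      then obtain m where "s' = m *s x" unfolding par_def by blast
      then have "s' = (m / k) *s s" unfolding k using k0 by simp
      with s(4) show False unfolding par_def by blast
    qed
    from AB[OF s(2) t(1) this t(2)] c show False by blast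
  next
    case False
    have "s \<frown> segre_pt s t'" using segre_pt_coll_right[OF s(1) xB t(1)] segre_pt_x_right by simp
    from coll_trans[OF A_coll[OF s(1) xA] A_coll[OF s(1,2)] this A_coll[OF xA s(2)] h s(4,3)]
    have "x \<frown> segre_pt s t'" .
    from segre_pt_nbr[OF s(1) t(1) this] False t(2) show False by blast
  qed
qed

text \<open>By transitivity at \<open>segre_pt s t\<close>, collinearity would make
  \<open>segre_pt s' t\<close> collinear with \<open>s\<close>; transitivity at \<open>s\<close>
  would then make \<open>s'\<close> collinear with \<open>segre_pt s t\<close>, which
  \<open>segre_pt_not_coll_x\<close> excludes.\<close>

lemma segre_pt_not_coll:
  assumes s: "s \<in> A" "s' \<in> A" "s \<noteq> 0" "\<not> par s s'" and t: "t \<in> B" "t' \<in> B" "t \<noteq> 0" "\<not> par t t'"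
  shows "\<not> segre_pt s' t \<frown> segre_pt s t'"
proof (cases "par x t")
  case True
  then obtain k where k: "t = k *s x" unfolding par_def by blast
  with t(3) have k0: "k \<noteq> 0" by auto
  have "\<not> par x t'"
  proof
    assume "par x t'"
    then obtain m where "t' = m *s x" unfolding par_def by blast
    then have "t' = (m / k) *s t" unfolding k using k0 by simp
    with t(4) show False unfolding par_def by blast
  qed
  note n = segre_pt_not_coll_x[OF s t(2) this]
  have "x_coord t = k" using x_coord_lin[of k x 0 x] unfolding k x_coord_x by simp
  moreover have "x_proj t = 0" using True x_proj_zero by blast
  ultimately have "segre_pt s' t = k *s s'" using segre_pt_par_right by metis
  with n coll_unscale_right[OF _ k0] coll_sym show ?thesis by metis
next
  case False
  show ?thesis
  proof
    assume h: "segre_pt s' t \<frown> segre_pt s t'"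
    note n = segre_pt_not_coll_x[OF s t(1) False]
    have z0: "segre_pt s t \<noteq> 0" using segre_pt_zero[OF s(1) t(1)] s(3) t(3) by blast
    have np: "\<not> par (segre_pt s t) (segre_pt s t')" using segre_pt_par_cancel_right[OF s(1,3) t(1,2)] t(4) by blast
    have sx: "segre_pt s b \<frown> s" if "b \<in> B" for b using segre_pt_coll_right[OF s(1) that xB] segre_pt_x_right by simp
    have c: "segre_pt s' t \<frown> s"
      by (rule coll_trans[OF segre_pt_coll_left[OF s(1,2) t(1)] segre_pt_coll_right[OF s(1) t(1,2)] sx[OF t(1)] h sx[OF t(2)] np z0])
    have c': "s' \<frown> segre_pt s' t" using coll_sym[OF segre_pt_coll_right[OF s(2) t(1) xB]] segre_pt_x_right by simp
    show False
    proof (cases "par s (segre_pt s' t)")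
      case False
      from coll_trans[OF A_coll[OF s(1,2)] coll_sym[OF c] coll_sym[OF sx[OF t(1)]] c' segre_pt_coll_left[OF s(2,1) t(1)] False s(3)] n
      show False by blast
    next
      \<comment> \<open>Here \<open>segre_pt s' t\<close> is a neighbour of \<open>x\<close>, so
        \<open>s'\<close> is a multiple of \<open>x\<close>. Then \<open>t\<close> is a multiple of
        \<open>s\<close> and lies in both classes.\<close>
      case True
      then obtain m where m: "segre_pt s' t = m *s s" unfolding par_def by blast
      have s'0: "s' \<noteq> 0" using s(4) par_zero by blast
      have "x \<frown> segre_pt s' t" unfolding m by (rule coll_scale_right[OF A_coll[OF xA s(1)]])
      from segre_pt_nbr[OF s(2) t(1) this] \<open>\<not> par x t\<close> have p: "par x s'" by blast
      then have z: "x_proj s' = 0" using x_proj_zero by blast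
      have "x_coord s' \<noteq> 0" using x_proj_decomp[of s'] z s'0 by auto
      moreover have "x_coord s' *s t = m *s s" using segre_pt_par_left[OF z] m by metis
      ultimately have "t = (m / x_coord s') *s s"
        by (metis (no_types, lifting) divide_inverse mult.commute vec.scale_left_imp_eq vector_ssub_ldistrib vector_smult_assoc vec.scale_scale left_inverse vec.scale_one)
      then have "t \<in> A" using vec.subspace_scale[OF A_sub s(1)] by simp
      from AB[OF this t(1) \<open>\<not> par x t\<close> \<open>\<not> par x t\<close>] A_coll[OF this this] show False by blast
    qed
  qed
qed

lemma segre_pt_sum_notin:
  assumes "s \<in> A" "s' \<in> A" "s' \<noteq> 0" "\<not> par s' s" "t \<in> B" "t' \<in> B" "t \<noteq> 0" "\<not> par t t'"
  shows "segre_pt s t + segre_pt s' t' \<notin> Z"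
  using sum_notin[OF segre_pt_Z[OF assms(1,5)] segre_pt_Z[OF assms(2,6)] segre_pt_not_coll[OF assms(2,1,3-8)], of 1 1] by simp

text \<open>The sum is 0 and hence in \<open>Z\<close>, so \<open>r1\<close> and \<open>r2\<close>
  are proportional and the tensor is pure; no nonzero pure tensor is mapped to 0.\<close>

lemma segre_pt_rank_two:
  assumes a: "a1 \<in> A" "a2 \<in> A" and ind: "\<And>p q. p *s a1 + q *s a2 = 0 \<Longrightarrow> p = 0 \<and> q = 0"
    and r: "r1 \<in> B" "r2 \<in> B" and e: "segre_pt a1 r1 + segre_pt a2 r2 = 0"
  shows "r1 = 0 \<and> r2 = 0"
proof -
  have a0: "a1 \<noteq> 0" "a2 \<noteq> 0" using ind[of 1 0] ind[of 0 1] by auto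
  have np: "\<not> par a2 a1"
  proof
    assume "par a2 a1"
    then obtain k where "a1 = k *s a2" unfolding par_def by blast
    then have "1 *s a1 + (- k) *s a2 = 0" by (simp add: vec_eq_iff)
    from ind[OF this] show False by simp
  qed
  have zz: "0 \<in> Z" using Z_scale[OF A_Z[OF xA], of 0] by simp
  have "r1 = 0 \<or> par r1 r2" using segre_pt_sum_notin[OF a a0(2) np r] e zz by metis
  then show ?thesis
  proof
    assume 1: "r1 = 0"
    have "segre_pt a1 0 = 0" using segre_pt_lin_right[OF xB xB a(1), of 0 0] by simp
    with e 1 have "segre_pt a2 r2 = 0" by simp
    from segre_pt_zero[OF a(2) r(2) this] a0 1 show ?thesis by blast
  next
    assume "par r1 r2"
    then obtain k where k: "r2 = k *s r1" unfolding par_def by blast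
    have "segre_pt a2 r2 = k *s segre_pt a2 r1" using segre_pt_lin_right[OF r(1) r(1) a(2), of k 0] unfolding k by simp
    then have "segre_pt (1 *s a1 + k *s a2) r1 = 0" using e unfolding segre_pt_lin_left[OF a r(1)] by simp
    moreover have "1 *s a1 + k *s a2 \<in> A"
      by (rule vec.subspace_add[OF A_sub vec.subspace_scale[OF A_sub a(1)] vec.subspace_scale[OF A_sub a(2)]])
    moreover have "1 *s a1 + k *s a2 \<noteq> 0" using ind[of 1 k] by auto
    ultimately have "r1 = 0" using segre_pt_zero r(1) by blast
    with k show ?thesis by simp
  qed
qed

text \<open>Moving one term to the other side shows that a sum of two pure tensors lies in
  \<open>Z\<close>, so \<open>r2\<close> and \<open>r3\<close> are multiples of \<open>r1\<close>.
  This use of a single remaining term is what restricts the argument to rank 3.\<close>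

lemma segre_pt_rank_three:
  assumes a: "a1 \<in> A" "a2 \<in> A" "a3 \<in> A"
    and ind: "\<And>p q r. p *s a1 + q *s a2 + r *s a3 = 0 \<Longrightarrow> p = 0 \<and> q = 0 \<and> r = 0"
    and r: "r1 \<in> B" "r2 \<in> B" "r3 \<in> B" and e: "segre_pt a1 r1 + segre_pt a2 r2 + segre_pt a3 r3 = 0"
  shows "r1 = 0 \<and> r2 = 0 \<and> r3 = 0"
proof -
  have a0: "a2 \<noteq> 0" "a3 \<noteq> 0" using ind[of 0 1 0] ind[of 0 0 1] by auto
  have np: "\<not> par a2 a1"
  proof
    assume "par a2 a1"
    then obtain k where "a1 = k *s a2" unfolding par_def by blast
    then have "1 *s a1 + (- k) *s a2 + 0 *s a3 = 0" by (simp add: vec_eq_iff)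
    from ind[OF this] show False by simp
  qed
  have np': "\<not> par a3 a1"
  proof
    assume "par a3 a1"
    then obtain k where "a1 = k *s a3" unfolding par_def by blast
    then have "1 *s a1 + 0 *s a2 + (- k) *s a3 = 0" by (simp add: vec_eq_iff)
    from ind[OF this] show False by simp
  qed
  show ?thesis
  proof (cases "r1 = 0")
    case True
    have "segre_pt a1 0 = 0" using segre_pt_lin_right[OF xB xB a(1), of 0 0] by simp
    with e True have "segre_pt a2 r2 + segre_pt a3 r3 = 0" by simp
    have i: "p = 0 \<and> q = 0" if "p *s a2 + q *s a3 = 0" for p q
      using ind[of 0 p q] that by simp
    from segre_pt_rank_two[OF a(2,3) i r(2,3) \<open>segre_pt a2 r2 + segre_pt a3 r3 = 0\<close>] True show ?thesis by blast
  next
    case False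
    have neg: "- segre_pt a r \<in> Z" if "a \<in> A" "r \<in> B" for a r using Z_scale[OF segre_pt_Z[OF that], of "- 1"] by (simp add: vec_eq_iff)
    have "segre_pt a1 r1 + segre_pt a2 r2 = - segre_pt a3 r3" using e by (metis add.commute eq_neg_iff_add_eq_0)
    then have "par r1 r2" using segre_pt_sum_notin[OF a(1,2) a0(1) np r(1,2) False] neg[OF a(3) r(3)] by fastforce
    then obtain k where k: "r2 = k *s r1" unfolding par_def by blast
    have "segre_pt a1 r1 + segre_pt a3 r3 = - segre_pt a2 r2" using e unfolding eq_neg_iff_add_eq_0 by (simp add: add_ac)
    then have "par r1 r3" using segre_pt_sum_notin[OF a(1,3) a0(2) np' r(1,3) False] neg[OF a(2) r(2)] by fastforce
    then obtain m where m: "r3 = m *s r1" unfolding par_def by blast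
    have a12: "1 *s a1 + k *s a2 \<in> A"
      by (rule vec.subspace_add[OF A_sub vec.subspace_scale[OF A_sub a(1)] vec.subspace_scale[OF A_sub a(2)]])
    have h2: "segre_pt a2 r2 = k *s segre_pt a2 r1"
      using segre_pt_lin_right[OF r(1) r(1) a(2), of k 0] by (simp add: k)
    have h3: "segre_pt a3 r3 = m *s segre_pt a3 r1" using segre_pt_lin_right[OF r(1) r(1) a(3), of m 0] unfolding m by simp
    have "segre_pt (1 *s (1 *s a1 + k *s a2) + m *s a3) r1 = 1 *s (1 *s segre_pt a1 r1 + k *s segre_pt a2 r1) + m *s segre_pt a3 r1"
      unfolding segre_pt_lin_left[OF a12 a(3) r(1)] segre_pt_lin_left[OF a(1,2) r(1)] ..
    also have "\<dots> = segre_pt a1 r1 + segre_pt a2 r2 + segre_pt a3 r3" unfolding h2 h3 by simp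
    finally have "segre_pt (1 *s (1 *s a1 + k *s a2) + m *s a3) r1 = 0" using e by (rule trans)
    moreover have "1 *s (1 *s a1 + k *s a2) + m *s a3 \<in> A"
      by (rule vec.subspace_add[OF A_sub vec.subspace_scale[OF A_sub a12] vec.subspace_scale[OF A_sub a(3)]])
    moreover have "1 *s (1 *s a1 + k *s a2) + m *s a3 \<noteq> 0" using ind[of 1 k m] by auto
    ultimately have "r1 = 0" using segre_pt_zero r(1) by blast
    with False show ?thesis by simp
  qed
qed

lemma segre_pt_onto: assumes "z \<in> Z" obtains a b where "a \<in> A" "b \<in> B" "z = segre_pt a b"
proof (cases "x \<frown> z")
  case True
  from nbrs[OF this] show thesis
  proof
    assume "z \<in> A"
    with that[OF this xB] segre_pt_x_right show thesis by metis
  next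
    assume "z \<in> B"
    moreover have "segre_pt x z = z" using segre_pt_par_left[OF x_proj_x] x_coord_x by simp
    ultimately show thesis using that[OF xA] by metis
  qed
next
  case False
  from opp_frame[OF A_Z[OF xA] assms False] obtain \<xi> u v where xi: "\<xi> \<in> \<Xi>" and f: "frame Z \<xi> x u v z" .
  note fv = frame_vertices[OF f]
  obtain u v where f: "frame Z \<xi> x u v z" and u: "u \<in> A" and v: "v \<in> B"
  proof (cases "u \<in> A")
    case True
    then have "v \<notin> A" using A_coll fv(18) by blast
    with nbrs[OF fv(14)] have "v \<in> B" by blast
    with that f True show thesis by blast
  next
    case False
    then have u: "u \<in> B" using nbrs[OF fv(13)] by blast
    then have "v \<notin> B" using B_coll fv(18) by blast
    with nbrs[OF fv(14)] have "v \<in> A" by blast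
    with that frame_swap[OF f] u show thesis by blast
  qed
  note fv = frame_vertices[OF f]
  have np: "\<not> par x u" "\<not> par x v" using par_coll_all fv(13,14,18) coll_sym by blast+
  have pu: "u = x_proj u + x_coord u *s x" and pv: "v = x_proj v + x_coord v *s x" using x_proj_decomp[of u] x_proj_decomp[of v] by (simp_all add: add.commute)
  from segre_pt_frame[OF u v np] obtain \<zeta> where ze: "\<zeta> \<in> \<Xi>" and g: "frame Z \<zeta> x (x_proj u) (x_proj v) (corner (x_proj u) (x_proj v))" .
  let ?c = "corner (x_proj u) (x_proj v)"
  note gv = frame_vertices[OF g]
  have "u \<in> \<zeta>" "v \<in> \<zeta>" using mem_lin[OF ze gv(2,1), of 1 "x_coord u"] mem_lin[OF ze gv(3,1), of 1 "x_coord v"] pu pv by simp_all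
  from space_unique[OF fv(6,7,18) xi ze fv(2,3) this] have "\<xi> = \<zeta>" .
  with fv(4) have "z \<in> \<zeta>" by simp
  from frame_ex[OF g this] obtain p q r s where z: "z = p *s x + q *s x_proj u + r *s x_proj v + s *s ?c" .
  have e: "p * s = q * r" using assms unfolding z frame_Z[OF g] .
  have s: "s \<noteq> 0" using False frame_first_coll[OF g e] unfolding z by simp
  \<comment> \<open>On the quadric the coordinate matrix has rank one; with \<open>s\<close> nonzero
    it is the product of \<open>(r, s)\<close> and \<open>(q / s, 1)\<close>.\<close>
  let ?a = "s *s x_proj u + r *s x" and ?b = "1 *s x_proj v + (q / s) *s x"
  have mem: "x_proj u \<in> A" "x_proj v \<in> B" using x_proj_sub[OF A_sub xA u] x_proj_sub[OF B_sub xB v] .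
  have H0: "segre_pt (x_proj u) (x_proj v) = ?c" unfolding segre_pt_def x_coord_x_proj x_proj_def[of "x_proj u"] x_proj_def[of "x_proj v"] by simp
  have H1: "segre_pt x x = x" "segre_pt x (x_proj v) = x_proj v" "segre_pt (x_proj u) x = x_proj u"
    using segre_pt_x_right segre_pt_par_left[OF x_proj_x, of "x_proj v"] x_coord_x by simp_all
  have b: "?b \<in> B" by (rule vec.subspace_add[OF B_sub vec.subspace_scale[OF B_sub mem(2)] vec.subspace_scale[OF B_sub xB]])
  have "segre_pt ?a ?b = z"
    unfolding segre_pt_lin_left[OF mem(1) xA b] segre_pt_lin_right[OF mem(2) xB mem(1)] segre_pt_lin_right[OF mem(2) xB xA] H0 H1 z
    using s e by (simp add: vec_eq_iff field_simps)
  moreover have "?a \<in> A" by (rule vec.subspace_add[OF A_sub vec.subspace_scale[OF A_sub mem(1)] vec.subspace_scale[OF A_sub xA]])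
  ultimately show thesis using that b by metis
qed

end

text \<open>Indexes a basis by a finite type of the right size, so that \<open>'a ^ 'm\<close>
  becomes the coordinate space of \<open>S\<close>.\<close>

lemma basis_family:
  fixes S :: "('a::field ^ 'n) set"
  assumes S: "vec.subspace S" and d: "vec.dim S = CARD('m::finite)"
  obtains a :: "'m::finite \<Rightarrow> 'a ^ 'n" where "S = range (\<lambda>s :: 'a ^ 'm. \<Sum>i\<in>UNIV. s $ i *s a i)"
    "\<And>s :: 'a ^ 'm. (\<Sum>i\<in>UNIV. s $ i *s a i) = 0 \<Longrightarrow> s = 0"
proof -
  from vec.basis_exists[of S] obtain B where B: "B \<subseteq> S" "vec.independent B" "S \<subseteq> vec.span B" "card B = vec.dim S" by blast
  have fin: "finite B" using B(4) d card.infinite[of B] by fastforce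
  have sp: "vec.span B = S" using vec.span_minimal[OF B(1) S] B(3) by blast
  obtain a :: "'m \<Rightarrow> 'a ^ 'n" where a: "bij_betw a UNIV B"
    using finite_same_card_bij[of "UNIV :: 'm set" B] fin B(4) d by auto
  then have inj: "inj a" and im: "range a = B" unfolding bij_betw_def by auto
  have re: "(\<Sum>i\<in>UNIV. u (a i) *s a i) = (\<Sum>v\<in>B. u v *s v)" for u
    using sum.reindex[OF inj, of "\<lambda>v. u v *s v"] unfolding im by simp
  have re': "(\<Sum>i\<in>UNIV. s $ i *s a i) = (\<Sum>v\<in>B. s $ inv a v *s v)" for s :: "'a ^ 'm"
    using re[of "\<lambda>v. s $ inv a v"] inv_f_f[OF inj] by simp
  show thesis
  proof (rule that)
    show "S = range (\<lambda>s :: 'a ^ 'm. \<Sum>i\<in>UNIV. s $ i *s a i)"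
    proof (intro subset_antisym subsetI)
      fix w assume "w \<in> S"
      then have "w \<in> range (\<lambda>u. \<Sum>v\<in>B. u v *s v)" unfolding sp[symmetric] vec.span_finite[OF fin] .
      then obtain u where "w = (\<Sum>v\<in>B. u v *s v)" by blast
      then have "w = (\<Sum>i\<in>UNIV. (\<chi> i. u (a i)) $ i *s a i)" using re[of u] by simp
      then show "w \<in> range (\<lambda>s :: 'a ^ 'm. \<Sum>i\<in>UNIV. s $ i *s a i)" by blast
    next
      fix w assume "w \<in> range (\<lambda>s :: 'a ^ 'm. \<Sum>i\<in>UNIV. s $ i *s a i)"
      then obtain s :: "'a ^ 'm" where w: "w = (\<Sum>i\<in>UNIV. s $ i *s a i)" by blast
      show "w \<in> S" unfolding w
      proof (rule vec.subspace_sum[OF S])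
        show "s $ i *s a i \<in> S" for i by (rule vec.subspace_scale[OF S]) (use im B(1) in blast)
      qed
    qed
    show "s = 0" if "(\<Sum>i\<in>UNIV. s $ i *s a i) = 0" for s :: "'a ^ 'm"
    proof -
      have z: "\<forall>v\<in>B. s $ inv a v = 0"
      proof (rule ccontr)
        assume "\<not> ?thesis"
        then have "(\<exists>v\<in>B. s $ inv a v \<noteq> 0) \<and> (\<Sum>v\<in>B. s $ inv a v *s v) = 0" using that[unfolded re'] by simp
        then have "vec.dependent B" unfolding vec.dependent_finite[OF fin] by (rule exI[of _ "\<lambda>v. s $ inv a v"])
        with B(2) show False by blast
      qed
      have "s $ i = 0" for i
      proof -
        have "a i \<in> B" using im by blast
        with z have "s $ inv a (a i) = 0" by blast
        then show ?thesis unfolding inv_f_f[OF inj] .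
      qed
      then show "s = 0" by (simp add: vec_eq_iff)
    qed
  qed
qed

context two_cone
begin

lemma segre_pt_sum_left:
  assumes "\<And>i. i \<in> I \<Longrightarrow> a i \<in> A" "b \<in> B" "finite I"
  shows "segre_pt (\<Sum>i\<in>I. s i *s a i) b = (\<Sum>i\<in>I. s i *s segre_pt (a i) b)"
  using assms(3,1)
proof (induction I)
  case empty
  show ?case using segre_pt_lin_left[OF xA xA assms(2), of 0 0] by simp
next
  case (insert j I)
  have "(\<Sum>i\<in>I. s i *s a i) \<in> A"
    by (rule vec.subspace_sum[OF A_sub], rule vec.subspace_scale[OF A_sub]) (use insert.prems in blast)
  from segre_pt_lin_left[OF insert.prems[of j] this assms(2), of "s j" 1] insert show ?case by simp
qed

lemma segre_param:
  assumes sp: "vec.span Z = UNIV"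
    and d: "vec.dim A = CARD('m::finite)" "vec.dim B = CARD('k::finite)" and m: "CARD('m) = 2 \<or> CARD('m) = 3"
  shows "\<exists>f :: 'a ^ ('m \<times> 'k) \<Rightarrow> 'a ^ 'n. Vector_Spaces.linear (*s) (*s) f \<and> bij f \<and> Z = {f (segre_map s t) | s t. True}"
proof -
  obtain a :: "'m \<Rightarrow> 'a ^ 'n" where
    a: "A = range (\<lambda>s :: 'a ^ 'm. \<Sum>i\<in>UNIV. s $ i *s a i)"
      "\<And>s :: 'a ^ 'm. (\<Sum>i\<in>UNIV. s $ i *s a i) = 0 \<Longrightarrow> s = 0"
    by (rule basis_family[OF A_sub d(1)]) (rule that)
  obtain b :: "'k \<Rightarrow> 'a ^ 'n" where
    b: "B = range (\<lambda>s :: 'a ^ 'k. \<Sum>i\<in>UNIV. s $ i *s b i)"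
      "\<And>s :: 'a ^ 'k. (\<Sum>i\<in>UNIV. s $ i *s b i) = 0 \<Longrightarrow> s = 0"
    by (rule basis_family[OF B_sub d(2)]) (rule that)
  have aA: "a i \<in> A" for i
  proof -
    have "a i = (\<Sum>j\<in>UNIV. axis i 1 $ j *s a j)" by (simp add: axis_def if_distrib[of "\<lambda>c. c *s _"] cong: if_cong)
    then show ?thesis unfolding a(1) by blast
  qed
  have bB: "b i \<in> B" for i
  proof -
    have "b i = (\<Sum>j\<in>UNIV. axis i 1 $ j *s b j)" by (simp add: axis_def if_distrib[of "\<lambda>c. c *s _"] cong: if_cong)
    then show ?thesis unfolding b(1) by blast
  qed
  \<comment> \<open>An element of \<open>'a ^ ('m \<times> 'k)\<close> is a matrix whose rows are
    read as vectors of \<open>B\<close>; \<open>f\<close> is the map on \<open>A \<otimes> B\<close>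
    induced by the bilinear \<open>segre_pt\<close>.\<close>
  define row where "row T i = (\<Sum>j\<in>UNIV. T $ (i, j) *s b j)" for T :: "'a ^ ('m \<times> 'k)" and i
  define f where "f T = (\<Sum>i\<in>UNIV. segre_pt (a i) (row T i))" for T :: "'a ^ ('m \<times> 'k)"
  have rowB: "row T i \<in> B" for T i
    unfolding row_def by (rule vec.subspace_sum[OF B_sub], rule vec.subspace_scale[OF B_sub bB])
  have f_lin: "f (p *s T + q *s T') = p *s f T + q *s f T'" for p q T T'
  proof -
    have "row (p *s T + q *s T') i = p *s row T i + q *s row T' i" for i
      unfolding row_def by (simp add: vec.scale_sum_right sum.distrib vec.scale_left_distrib)
    then have "f (p *s T + q *s T') = (\<Sum>i\<in>UNIV. p *s segre_pt (a i) (row T i) + q *s segre_pt (a i) (row T' i))"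
      unfolding f_def using segre_pt_lin_right[OF rowB rowB aA] by simp
    then show ?thesis unfolding f_def by (simp add: vec.scale_sum_right sum.distrib)
  qed
  have lin: "Vector_Spaces.linear (*s) (*s) f"
  proof -
    have "f (u + v) = f u + f v" for u v using f_lin[of 1 u 1 v] by simp
    moreover have "f (c *s u) = c *s f u" for c u using f_lin[of c u 0 u] by simp
    ultimately show ?thesis unfolding Vector_Spaces.linear_iff
      by (intro conjI allI vec.vector_space_axioms) simp_all
  qed
  have f_segre: "f (segre_map s t) = segre_pt (\<Sum>i\<in>UNIV. s $ i *s a i) (\<Sum>j\<in>UNIV. t $ j *s b j)" for s t
  proof -
    have tb: "(\<Sum>j\<in>UNIV. t $ j *s b j) \<in> B" unfolding b(1) by blast
    have "row (segre_map s t) i = s $ i *s (\<Sum>j\<in>UNIV. t $ j *s b j)" for i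
      unfolding row_def segre_map_def by (simp add: vec.scale_sum_right)
    then have "segre_pt (a i) (row (segre_map s t) i) = s $ i *s segre_pt (a i) (\<Sum>j\<in>UNIV. t $ j *s b j)" for i
      using segre_pt_lin_right[OF tb tb aA, where p = "s $ i" and q = 0] by simp
    then show ?thesis unfolding f_def using segre_pt_sum_left[OF aA tb, of UNIV "\<lambda>i. s $ i"] by simp
  qed
  have Z: "Z = {f (segre_map s t) | s t. True}"
  proof (intro subset_antisym subsetI)
    fix z assume "z \<in> Z"
    from segre_pt_onto[OF this] obtain u v where "u \<in> A" "v \<in> B" "z = segre_pt u v" .
    then show "z \<in> {f (segre_map s t) | s t. True}" unfolding a(1) b(1) f_segre by blast
  next
    fix z assume "z \<in> {f (segre_map s t) | s t. True}"
    then obtain s t where z: "z = f (segre_map s t)" by blast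
    show "z \<in> Z" unfolding z f_segre by (rule segre_pt_Z) (unfold a(1) b(1), blast+)
  qed
  have "surj f"
  proof -
    have "Z \<subseteq> range f" unfolding Z by blast
    from vec.span_minimal[OF this vec.linear_subspace_image[OF lin vec.subspace_UNIV]] sp show ?thesis by blast
  qed
  moreover have "inj f"
  proof (rule injI)
    fix T T' assume "f T = f T'"
    then have "f (1 *s T + (- 1) *s T') = 0" unfolding f_lin by (simp add: vec_eq_iff)
    then obtain D where D: "D = 1 *s T + (- 1) *s T'" "f D = 0" by blast
    \<comment> \<open>With two or three rows, a kernel element is a relation between two or three
      pure tensors with independent left factors.\<close>
    have "\<forall>i. row D i = 0"
    proof (rule disjE[OF m])
      assume "CARD('m) = 2"
      then obtain i j :: 'm where U: "UNIV = {i, j}" "i \<noteq> j" unfolding card_2_iff by blast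
      have S: "(\<Sum>l\<in>UNIV. g l) = g i + g j" for g :: "'m \<Rightarrow> 'a ^ 'n" unfolding U(1) using U(2) by simp
      have "p = 0 \<and> q = 0" if "p *s a i + q *s a j = 0" for p q
      proof -
        have "(\<chi> l. if l = i then p else q) = 0" by (rule a(2)) (use that U(2) in \<open>simp add: S\<close>)
        then have z: "(if l = i then p else q) = 0" for l by (simp add: vec_eq_iff)
        show ?thesis using z[of i] z[of j] U(2) by simp
      qed
      from segre_pt_rank_two[OF aA[of i] aA[of j] this rowB[of D i] rowB[of D j]] D(2) U(1) show ?thesis unfolding f_def S by auto
    next
      assume "CARD('m) = 3"
      then obtain i j k :: 'm where U: "UNIV = {i, j, k}" "i \<noteq> j" "i \<noteq> k" "j \<noteq> k" unfolding card_3_iff by blast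
      have S: "(\<Sum>l\<in>UNIV. g l) = g i + g j + g k" for g :: "'m \<Rightarrow> 'a ^ 'n"
        unfolding U(1) using U(2-4) by (simp add: add.assoc)
      have "p = 0 \<and> q = 0 \<and> r = 0" if "p *s a i + q *s a j + r *s a k = 0" for p q r
      proof -
        have "(\<chi> l. if l = i then p else if l = j then q else r) = 0" by (rule a(2)) (use that U(2-4) in \<open>simp add: S\<close>)
        then have z: "(if l = i then p else if l = j then q else r) = 0" for l by (simp add: vec_eq_iff)
        show ?thesis using z[of i] z[of j] z[of k] U(2-4) by simp
      qed
      from segre_pt_rank_three[OF aA[of i] aA[of j] aA[of k] this rowB[of D i] rowB[of D j] rowB[of D k]] D(2) U(1) show ?thesis unfolding f_def S by auto
    qed
    then have "(\<chi> j. D $ (i, j)) = 0" for i by (intro b(2)) (simp add: row_def)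
    then have "D $ (i, j) = 0" for i j by (metis vec_lambda_beta zero_index)
    then have "D = 0" by (simp add: vec_eq_iff split_paired_all)
    then show "T = T'" unfolding D(1) by (simp add: vec_eq_iff)
  qed
  ultimately have "bij f" unfolding bij_def by blast
  with lin Z show ?thesis by blast
qed

lemma inter_dim: "vec.dim (A \<inter> B) \<le> 1"
proof -
  have "A \<inter> B \<subseteq> vec.span {x}"
  proof
    fix t assume "t \<in> A \<inter> B"
    then have "par x t" using AB A_coll by blast
    then show "t \<in> vec.span {x}" unfolding par_def vec.span_singleton by blast
  qed
  from vec.dim_le_card[OF this] show ?thesis by simp
qed

text \<open>The sum of \<open>A\<close> and \<open>B\<close> lies in the tangent space of dimension
  at most 5, and their intersection has dimension at most 1.\<close>

lemma dims: "vec.dim A + vec.dim B \<le> 6"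
proof -
  from tangent[OF A_Z[OF xA] x0] obtain S where S: "vec.subspace S" "vec.dim S \<le> 5" "\<And>u. x \<frown> u \<Longrightarrow> u \<in> S" by blast
  have "{u + v | u v. u \<in> A \<and> v \<in> B} \<subseteq> S" using S(3) A_coll[OF xA] B_coll[OF xB] vec.subspace_add[OF S(1)] by blast
  from vec.dim_subset[OF this] S(2) inter_dim vec.dim_sums_Int[OF A_sub B_sub] show ?thesis by linarith
qed

end

lemma dim_ge_2:
  fixes x u :: "'a::field ^ 'n"
  assumes "x \<in> S" "u \<in> S" "x \<noteq> 0" "\<not> par x u" shows "2 \<le> vec.dim S"
proof -
  have "u \<notin> vec.span {x}" using assms(4) unfolding par_def vec.span_singleton by blast
  then have "vec.independent {u, x}" "u \<noteq> x" using assms(3) vec.independent_insertI[of u "{x}"] vec.span_base[of x "{x}"] by auto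
  then show ?thesis using vec.independent_card_le_dim[of "{u, x}" S] assms(1,2) by simp
qed

section \<open>The two classes at a point as subspaces\<close>

context grid_cone
begin

lemma class_subspace:
  assumes "x \<noteq> 0" "x \<frown> u" "x \<frown> v" "\<not> u \<frown> v"
  shows "vec.subspace {w. x \<frown> w \<and> w \<frown> u}"
    and "x \<frown> w \<Longrightarrow> w \<frown> u \<Longrightarrow> x \<frown> w' \<Longrightarrow> w' \<frown> u \<Longrightarrow> w \<frown> w'"
proof -
  have np: "\<not> par x u" using par_coll_all assms(3,4) coll_sym by blast
  show c: "w \<frown> w'" if "x \<frown> w" "w \<frown> u" "x \<frown> w'" "w' \<frown> u" for w w'
    by (rule coll_trans[OF that(1) assms(2) that(3) that(2) coll_sym[OF that(4)] np assms(1)])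
  show "vec.subspace {w. x \<frown> w \<and> w \<frown> u}"
  proof (rule vec.subspaceI)
    show "0 \<in> {w. x \<frown> w \<and> w \<frown> u}"
      using coll_zero[OF coll_left[OF assms(2)]] coll_sym[OF coll_zero[OF coll_right[OF assms(2)]]] by blast
    show "w + w' \<in> {w. x \<frown> w \<and> w \<frown> u}" if "w \<in> {w. x \<frown> w \<and> w \<frown> u}" "w' \<in> {w. x \<frown> w \<and> w \<frown> u}" for w w'
    proof -
      have h: "x \<frown> w" "w \<frown> u" "x \<frown> w'" "w' \<frown> u" using that by blast+
      have 1: "x \<frown> w + w'" using coll_add[OF assms(1) h(1,3) c[OF h], of 1 1] by simp
      have "u \<noteq> 0" using np par_zero by blast
      from coll_add[OF this coll_sym[OF h(2)] coll_sym[OF h(4)] c[OF h], of 1 1] have "u \<frown> w + w'" by simp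
      with 1 coll_sym show ?thesis by blast
    qed
    show "k *s w \<in> {w. x \<frown> w \<and> w \<frown> u}" if "w \<in> {w. x \<frown> w \<and> w \<frown> u}" for k w
      using coll_scale_right that coll_sym by blast
  qed
qed

lemma two_cone_exists:
  assumes sp: "vec.span Z = UNIV" and x: "x \<in> Z" "x \<noteq> 0"
  obtains A B where "two_cone Z \<Xi> x A B" "2 \<le> vec.dim A" "2 \<le> vec.dim B"
proof -
  from nbrs_exist[OF x] obtain u v where u: "x \<frown> u" and v: "x \<frown> v" and n: "\<not> u \<frown> v" .
  have n': "\<not> v \<frown> u" using n coll_sym by blast
  have two: "two_classes p" if "p \<in> Z" "p \<noteq> 0" for p by (rule all_two_classes[OF sp that])
  note U = class_subspace[OF x(2) u v n] and V = class_subspace[OF x(2) v u n']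
  have np: "\<not> par x u" "\<not> par x v" using par_coll_all u v n n' coll_sym by blast+
  have self: "x \<frown> x" "u \<frown> u" "v \<frown> v"
    using coll_self[OF x(1), of 1] coll_self[OF coll_right[OF u], of 1] coll_self[OF coll_right[OF v], of 1] by simp_all
  show thesis
  proof (rule that)
    show "two_cone Z \<Xi> x {w. x \<frown> w \<and> w \<frown> u} {w. x \<frown> w \<and> w \<frown> v}"
    proof unfold_locales
      show "\<not> a \<frown> b" if "a \<in> {w. x \<frown> w \<and> w \<frown> u}" "b \<in> {w. x \<frown> w \<and> w \<frown> v}" "\<not> par x a" "\<not> par x b" for a b
      proof
        assume h: "a \<frown> b"
        have a: "x \<frown> a" "a \<frown> u" and b: "x \<frown> b" "b \<frown> v" using that by blast+
        have ub: "u \<frown> b" by (rule coll_trans[OF u a(1) b(1) coll_sym[OF a(2)] h that(3) x(2)])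
        have "u \<frown> v" by (rule coll_trans[OF u b(1) v ub b(2) that(4) x(2)])
        with n show False by blast
      qed
      show "w \<in> {w. x \<frown> w \<and> w \<frown> u} \<or> w \<in> {w. x \<frown> w \<and> w \<frown> v}" if "x \<frown> w" for w
        using two_classes_any[OF two[OF x] x(2) u v n that] that by blast
      show "two_classes p" if "p \<in> Z" "p \<noteq> 0" for p by (rule two[OF that])
      show "a \<frown> a'" if "a \<in> {w. x \<frown> w \<and> w \<frown> u}" "a' \<in> {w. x \<frown> w \<and> w \<frown> u}" for a a' using U(2) that by blast
      show "b \<frown> b'" if "b \<in> {w. x \<frown> w \<and> w \<frown> v}" "b' \<in> {w. x \<frown> w \<and> w \<frown> v}" for b b' using V(2) that by blast
    qed (use x(2) u v self U(1) V(1) in blast)+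
    show "2 \<le> vec.dim {w. x \<frown> w \<and> w \<frown> u}" by (rule dim_ge_2[OF _ _ x(2) np(1)]) (use u self in auto)
    show "2 \<le> vec.dim {w. x \<frown> w \<and> w \<frown> v}" by (rule dim_ge_2[OF _ _ x(2) np(2)]) (use v self in auto)
  qed
qed

end

section \<open>Hyperbolic quadrics and their tangent planes\<close>

lemma proj_point_span:
  assumes "proj_subspace 0 p" "v \<in> p" "v \<noteq> 0" shows "p = vec.span {v}"
proof -
  have p: "vec.subspace p" "vec.dim p = 1" using assms(1) unfolding proj_subspace_def by auto
  have "vec.span {v} \<subseteq> p" using vec.span_minimal[OF _ p(1)] assms(2) by blast
  moreover have "vec.dim (vec.span {v}) = 1" using assms(3) by (simp add: vec.dim_eq_card_independent)
  ultimately show ?thesis using vec.subspace_dim_equal[OF vec.subspace_span p(1), of "{v}"] p(2) by simp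
qed

lemma proj_point_ex:
  assumes "proj_subspace 0 p" obtains v where "v \<in> p" "v \<noteq> 0" "p = vec.span {v}"
proof -
  have "\<not> p \<subseteq> {0}" using assms vec.dim_eq_0[of p] unfolding proj_subspace_def by auto
  then obtain v where "v \<in> p" "v \<noteq> 0" by blast
  with proj_point_span[OF assms] that show thesis by blast
qed

lemma span_point: "v \<noteq> 0 \<Longrightarrow> proj_subspace 0 (vec.span {v})"
  unfolding proj_subspace_def by (simp add: vec.dim_eq_card_independent vec.subspace_span)

lemma span_points:
  assumes "vec.subspace U" "v \<in> U" "v \<noteq> 0" shows "vec.span {v} \<in> points U"
  using span_point[OF assms(3)] vec.span_minimal[of "{v}" U] assms(1,2) unfolding points_def by blast

lemma polar_sym: "polar_form q u v = polar_form q v u"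
  unfolding polar_form_def by (simp add: add.commute)

locale quadratic =
  fixes U :: "('a::field ^ 'n) set" and q :: "'a ^ 'n \<Rightarrow> 'a"
  assumes sub: "vec.subspace U" and quad: "quadratic_form_on U q"
begin

lemma q_scale: "u \<in> U \<Longrightarrow> q (c *s u) = c ^ 2 * q u"
  and polar_add: "u \<in> U \<Longrightarrow> v \<in> U \<Longrightarrow> w \<in> U \<Longrightarrow> polar_form q (u + v) w = polar_form q u w + polar_form q v w"
  and polar_scale: "u \<in> U \<Longrightarrow> w \<in> U \<Longrightarrow> polar_form q (c *s u) w = c * polar_form q u w"
  using quad unfolding quadratic_form_on_def by blast+

lemma mem: "u \<in> U \<Longrightarrow> v \<in> U \<Longrightarrow> a *s u + b *s v \<in> U"
  using vec.subspace_add[OF sub vec.subspace_scale[OF sub] vec.subspace_scale[OF sub]] .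

lemma polar_lin:
  "u \<in> U \<Longrightarrow> v \<in> U \<Longrightarrow> w \<in> U \<Longrightarrow> polar_form q (a *s u + b *s v) w = a * polar_form q u w + b * polar_form q v w"
  using polar_add[OF vec.subspace_scale[OF sub] vec.subspace_scale[OF sub]] polar_scale by simp

lemma polar_lin_right:
  "u \<in> U \<Longrightarrow> v \<in> U \<Longrightarrow> w \<in> U \<Longrightarrow> polar_form q w (a *s u + b *s v) = a * polar_form q w u + b * polar_form q w v"
  using polar_lin polar_sym by metis

lemma q_lin: assumes "u \<in> U" "v \<in> U"
  shows "q (a *s u + b *s v) = a ^ 2 * q u + b ^ 2 * q v + a * b * polar_form q u v"
proof -
  have m: "a *s u \<in> U" "b *s v \<in> U" using vec.subspace_scale[OF sub] assms by blast+
  have "polar_form q (a *s u) (b *s v) = a * b * polar_form q u v"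
    using polar_scale[OF assms(1) m(2)] polar_scale[OF assms(2,1)] polar_sym by (metis mult.assoc)
  then show ?thesis using q_scale assms unfolding polar_form_def[of q "a *s u"] by (simp add: algebra_simps)
qed

lemma polar_self: assumes "u \<in> U" "q u = 0" shows "polar_form q u u = 0"
proof -
  have e: "u + u = 2 *s u" by (simp add: vec_eq_iff)
  have "q (u + u) = 2 ^ 2 * q u" unfolding e by (rule q_scale[OF assms(1)])
  then show ?thesis unfolding polar_form_def using assms(2) by simp
qed

lemma q_zero: "q 0 = 0"
  using q_scale[OF vec.subspace_0[OF sub], of 0] by simp

text \<open>If \<open>?B e1\<close> vanished on the kernel of \<open>?B e2\<close>, a combination of
  \<open>e1\<close> and \<open>e2\<close> would lie in the radical. Being singular, it would
  contradict nondegeneracy, which in characteristic 2 concerns only singular radical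
  vectors.\<close>

lemma dual_vector:
  assumes nd: "nondegenerate_on U q" and e: "e1 \<in> U" "e2 \<in> U" "\<And>a b. q (a *s e1 + b *s e2) = 0"
    and ind: "\<And>a b. a *s e1 + b *s e2 = 0 \<Longrightarrow> a = 0 \<and> b = 0"
  obtains w where "w \<in> U" "polar_form q e1 w = 1" "polar_form q e2 w = 0"
proof -
  let ?B = "polar_form q"
  have rad: "a = 0 \<and> b = 0" if "\<And>w. w \<in> U \<Longrightarrow> a * ?B e1 w + b * ?B e2 w = 0" for a b
  proof -
    have "?B (a *s e1 + b *s e2) w = 0" if "w \<in> U" for w
      using polar_lin[OF e(1,2) that] \<open>\<And>w. w \<in> U \<Longrightarrow> a * ?B e1 w + b * ?B e2 w = 0\<close>[OF that] by simp
    then have "a *s e1 + b *s e2 = 0" using nd e(3) mem[OF e(1,2)] unfolding nondegenerate_on_def by blast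
    with ind show ?thesis by blast
  qed
  have "\<exists>w \<in> U. ?B e2 w = 0 \<and> ?B e1 w \<noteq> 0"
  proof (rule ccontr)
    assume "\<not> ?thesis"
    then have n: "?B e1 w = 0" if "w \<in> U" "?B e2 w = 0" for w using that by blast
    have "\<exists>w \<in> U. ?B e2 w \<noteq> 0" using rad[of 0 1] by auto
    then obtain z where z: "z \<in> U" "?B e2 z \<noteq> 0" by blast
    have "?B e2 z * ?B e1 w + (- ?B e1 z) * ?B e2 w = 0" if w: "w \<in> U" for w
    proof -
      have "?B e2 (?B e2 z *s w + (- ?B e2 w) *s z) = 0" unfolding polar_lin_right[OF w z(1) e(2)] by simp
      from n[OF mem[OF w z(1)] this] show ?thesis unfolding polar_lin_right[OF w z(1) e(1)] by (simp add: mult.commute)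
    qed
    from rad[OF this] z(2) show False by simp
  qed
  then obtain w where w: "w \<in> U" "?B e2 w = 0" "?B e1 w \<noteq> 0" by blast
  show thesis
  proof (rule that)
    show "inverse (?B e1 w) *s w \<in> U" by (rule vec.subspace_scale[OF sub w(1)])
    show "?B e1 (inverse (?B e1 w) *s w) = 1" "?B e2 (inverse (?B e1 w) *s w) = 0"
      using polar_lin_right[OF w(1,1) e(1), of "inverse (?B e1 w)" 0] polar_lin_right[OF w(1,1) e(2), of "inverse (?B e1 w)" 0] w(2,3)
      by simp_all
  qed
qed

text \<open>The dual vectors of the singular plane are made singular by subtracting multiples of
  \<open>e1\<close> and \<open>e2\<close>, then made orthogonal to each other. The sign in
  \<open>u = - e2\<close> turns \<open>a d + b c\<close> into \<open>a d - b c\<close>.\<close>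

lemma hyperbolic_basis:
  assumes d: "vec.dim U = 4" and nd: "nondegenerate_on U q"
    and e: "e1 \<in> U" "e2 \<in> U" "\<And>a b. q (a *s e1 + b *s e2) = 0"
    and ind: "\<And>a b. a *s e1 + b *s e2 = 0 \<Longrightarrow> a = 0 \<and> b = 0"
  obtains x u v y where
    "\<And>a b c d. a *s x + b *s u + c *s v + d *s y = 0 \<Longrightarrow> a = 0 \<and> b = 0 \<and> c = 0 \<and> d = 0"
    "\<And>w. w \<in> U \<Longrightarrow> \<exists>a b c d. w = a *s x + b *s u + c *s v + d *s y"
    "\<And>a b c d. a *s x + b *s u + c *s v + d *s y \<in> U"
    "\<And>a b c d. q (a *s x + b *s u + c *s v + d *s y) = a * d - b * c"
proof -
  let ?B = "polar_form q"
  have e': "q (a *s e2 + b *s e1) = 0" for a b using e(3)[of b a] by (simp add: add.commute)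
  have ind': "a = 0 \<and> b = 0" if "a *s e2 + b *s e1 = 0" for a b using ind[of b a] that by (simp add: add.commute)
  from dual_vector[OF nd e ind] obtain w1 where w1: "w1 \<in> U" "?B e1 w1 = 1" "?B e2 w1 = 0" .
  from dual_vector[OF nd e(2,1) e' ind'] obtain w2 where w2: "w2 \<in> U" "?B e2 w2 = 1" "?B e1 w2 = 0" .
  have q12: "q e1 = 0" "q e2 = 0" using e(3)[of 1 0] e(3)[of 0 1] by simp_all
  have B12: "?B e1 e2 = 0" using e(3)[of 1 1] q12 unfolding polar_form_def by simp
  note B11 = polar_self[OF e(1) q12(1)] polar_self[OF e(2) q12(2)]
  define y where "y = 1 *s w1 + (- q w1) *s e1"
  have yU: "y \<in> U" unfolding y_def by (rule mem[OF w1(1) e(1)])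
  have y: "?B e1 y = 1" "?B e2 y = 0"
    unfolding y_def polar_lin_right[OF w1(1) e(1) e(1)] polar_lin_right[OF w1(1) e(1) e(2)] using w1 B11 B12 polar_sym[of q e2 e1] by simp_all
  have qy: "q y = 0" unfolding y_def q_lin[OF w1(1) e(1)] using w1(2) q12 polar_sym[of q w1 e1] by simp
  define m where "m = 1 *s w2 + (- q w2) *s e2"
  have mU: "m \<in> U" unfolding m_def by (rule mem[OF w2(1) e(2)])
  have m: "?B e1 m = 0" "?B e2 m = 1"
    unfolding m_def polar_lin_right[OF w2(1) e(2) e(1)] polar_lin_right[OF w2(1) e(2) e(2)] using w2 B11 B12 by simp_all
  have qm: "q m = 0" unfolding m_def q_lin[OF w2(1) e(2)] using w2(2) q12 polar_sym[of q w2 e2] by simp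
  \<comment> \<open>Subtracting a multiple of \<open>e1\<close> makes \<open>v\<close> orthogonal to
    \<open>y\<close> and leaves its other values unchanged.\<close>
  define v where "v = 1 *s m + (- ?B m y) *s e1"
  have vU: "v \<in> U" unfolding v_def by (rule mem[OF mU e(1)])
  have v: "?B e1 v = 0" "?B e2 v = 1"
    unfolding v_def polar_lin_right[OF mU e(1) e(1)] polar_lin_right[OF mU e(1) e(2)] using m B11 B12 polar_sym[of q e2 e1] by simp_all
  have vy: "?B v y = 0" unfolding v_def polar_lin[OF mU e(1) yU] using y by simp
  have qv: "q v = 0" unfolding v_def q_lin[OF mU e(1)] using qm q12 m polar_sym[of q m e1] by simp
  define u where "u = (- 1) *s e2"
  have uU: "u \<in> U" unfolding u_def by (rule vec.subspace_scale[OF sub e(2)])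
  have Bu: "?B u z = - ?B e2 z" if "z \<in> U" for z unfolding u_def polar_scale[OF e(2) that] by simp
  have qu: "q u = 0" unfolding u_def q_scale[OF e(2)] using q12 by simp
  have B: "?B e1 u = 0" "?B e1 v = 0" "?B e1 y = 1" "?B u v = - 1" "?B u y = 0" "?B v y = 0"
    using Bu[OF e(1)] Bu[OF vU] Bu[OF yU] B12 v y vy polar_sym[of q e1 u] polar_sym[of q e1 e2] by simp_all
  have mem4: "a *s e1 + b *s u + c *s v + d *s y \<in> U" for a b c d
    using mem[OF mem[OF mem[OF e(1) uU] vU] yU, of 1 1 a b c d] by simp
  have q4: "q (a *s e1 + b *s u + c *s v + d *s y) = a * d - b * c" for a b c d
  proof -
    have 1: "a *s e1 + b *s u \<in> U" by (rule mem[OF e(1) uU])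
    have 2: "1 *s (a *s e1 + b *s u) + c *s v \<in> U" by (rule mem[OF 1 vU])
    have "q (1 *s (1 *s (a *s e1 + b *s u) + c *s v) + d *s y) = a * d - b * c"
      unfolding q_lin[OF 2 yU] q_lin[OF 1 vU] q_lin[OF e(1) uU] polar_lin[OF 1 vU yU] polar_lin[OF e(1) uU yU] polar_lin[OF e(1) uU vU]
      using B q12 qu qv qy by (simp add: algebra_simps)
    then show ?thesis by simp
  qed
  have B4: "?B z (a *s e1 + b *s u + c *s v + d *s y) = a * ?B z e1 + b * ?B z u + c * ?B z v + d * ?B z y" if z: "z \<in> U" for z a b c d
  proof -
    have 1: "a *s e1 + b *s u \<in> U" by (rule mem[OF e(1) uU])
    have 2: "1 *s (a *s e1 + b *s u) + c *s v \<in> U" by (rule mem[OF 1 vU])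
    have "?B z (1 *s (1 *s (a *s e1 + b *s u) + c *s v) + d *s y) = a * ?B z e1 + b * ?B z u + c * ?B z v + d * ?B z y"
      unfolding polar_lin_right[OF 2 yU z] polar_lin_right[OF 1 vU z] polar_lin_right[OF e(1) uU z] by simp
    then show ?thesis by simp
  qed
  have B0: "?B z 0 = 0" if "z \<in> U" for z using polar_lin_right[OF that that that, of 0 0] by simp
  \<comment> \<open>Pairing with the opposite basis vector isolates each coefficient.\<close>
  have ind4: "a = 0 \<and> b = 0 \<and> c = 0 \<and> d = 0" if "a *s e1 + b *s u + c *s v + d *s y = 0" for a b c d
  proof -
    note z = B4[of _ a b c d, unfolded that B0]
    have s: "?B u e1 = 0" "?B v e1 = 0" "?B y e1 = 1" "?B v u = - 1" "?B y u = 0" "?B y v = 0" using B polar_sym by metis+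
    note self = polar_self[OF e(1) q12(1)] polar_self[OF uU qu] polar_self[OF vU qv] polar_self[OF yU qy]
    have "a = 0" using z[OF yU] B0[OF yU] s self by simp
    moreover have "b = 0" using z[OF vU] B0[OF vU] s self B by simp
    moreover have "c = 0" using z[OF uU] B0[OF uU] s self B by simp
    moreover have "d = 0" using z[OF e(1)] B0[OF e(1)] s self B by simp
    ultimately show ?thesis by blast
  qed
  have "\<exists>a b c d. w = a *s e1 + b *s u + c *s v + d *s y" if w: "w \<in> U" for w
  proof -
    have "\<exists>g. (\<exists>i<5. g i \<noteq> 0) \<and> (\<Sum>i<5. g i *s ([e1, u, v, y, w] ! i)) = 0"
    proof (rule family_dependent)
      show "[e1, u, v, y, w] ! i \<in> U" if "i < 5" for i
      proof -
        have "i = 0 \<or> i = 1 \<or> i = 2 \<or> i = 3 \<or> i = 4" using that by linarith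
        then show ?thesis using e(1) uU vU yU w by (elim disjE) simp_all
      qed
      show "vec.dim U < 5" using d by simp
    qed
    then obtain g where g: "\<exists>i<5. g i \<noteq> 0" "(\<Sum>i<5. g i *s ([e1, u, v, y, w] ! i)) = 0" by blast
    have s: "g 0 *s e1 + g 1 *s u + g 2 *s v + g 3 *s y + g 4 *s w = 0"
      using g(2) by (simp add: eval_nat_numeral lessThan_Suc algebra_simps)
    have g4: "g 4 \<noteq> 0"
    proof
      assume z: "g 4 = 0"
      with s have "g 0 *s e1 + g 1 *s u + g 2 *s v + g 3 *s y = 0" by simp
      note i4 = ind4[OF this]
      from g(1) obtain i where i: "i < 5" "g i \<noteq> 0" by blast
      then have "i = 0 \<or> i = 1 \<or> i = 2 \<or> i = 3 \<or> i = 4" by linarith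
      with i(2) i4 z show False by auto
    qed
    have "g 4 *s w = (- g 0) *s e1 + (- g 1) *s u + (- g 2) *s v + (- g 3) *s y"
      using s by (simp add: add_eq_0_iff algebra_simps)
    then have "inverse (g 4) *s (g 4 *s w) = inverse (g 4) *s ((- g 0) *s e1 + (- g 1) *s u + (- g 2) *s v + (- g 3) *s y)" by simp
    then have "w = (inverse (g 4) * (- g 0)) *s e1 + (inverse (g 4) * (- g 1)) *s u + (inverse (g 4) * (- g 2)) *s v + (inverse (g 4) * (- g 3)) *s y"
      using g4 by (simp add: vec.scale_right_distrib)
    then show ?thesis by blast
  qed
  from that[OF ind4 this mem4 q4] show thesis .
qed

end

section \<open>Frames of hypos and their tangent planes\<close>

lemma span_pair_iff: "w \<in> vec.span {x, u} \<longleftrightarrow> (\<exists>a b. w = a *s x + b *s u)" for x u w :: "'a::field ^ 'n"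
proof
  assume "w \<in> vec.span {x, u}"
  then obtain a b where "w - a *s x = b *s u" unfolding vec.span_insert[of x] vec.span_singleton by blast
  then have "w = a *s x + b *s u" by (simp add: algebra_simps)
  then show "\<exists>a b. w = a *s x + b *s u" by blast
next
  assume "\<exists>a b. w = a *s x + b *s u"
  then show "w \<in> vec.span {x, u}" using vec.span_add vec.span_scale vec.span_base by (metis insertCI)
qed

lemma span_triple_iff: "w \<in> vec.span {x, u, v} \<longleftrightarrow> (\<exists>a b c. w = a *s x + b *s u + c *s v)" for x u v w :: "'a::field ^ 'n"
proof
  assume "w \<in> vec.span {x, u, v}"
  then obtain a where "w - a *s x \<in> vec.span {u, v}" unfolding vec.span_insert[of x] by blast
  then obtain b c where "w - a *s x = b *s u + c *s v" unfolding span_pair_iff by blast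
  then have "w = a *s x + b *s u + c *s v" by (simp add: algebra_simps)
  then show "\<exists>a b c. w = a *s x + b *s u + c *s v" by blast
next
  assume "\<exists>a b c. w = a *s x + b *s u + c *s v"
  then obtain a b c where w: "w = a *s x + b *s u + c *s v" by blast
  show "w \<in> vec.span {x, u, v}" unfolding w by (intro vec.span_add vec.span_scale vec.span_base) auto
qed

lemma frame_proj_line:
  fixes x u v y :: "'a::field ^ 'n"
  assumes "frame Z \<xi> x u v y" shows "proj_subspace 1 (vec.span {x, u})"
proof -
  have "u \<notin> vec.span {x}" unfolding vec.span_singleton
  proof
    assume "u \<in> range (\<lambda>k. k *s x)"
    then obtain k where "u = k *s x" by blast
    then have "(- k) *s x + 1 *s u + 0 *s v + 0 *s y = 0" by (simp add: vec_eq_iff)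
    from frame_indep[OF assms this] show False by simp
  qed
  then have "vec.independent {u, x}" "u \<noteq> x"
    using frame_vertices(9)[OF assms] vec.independent_insertI[of u "{x}"] vec.span_base[of x "{x}"] by auto
  then have "vec.dim {u, x} = 2" by (simp add: vec.dim_eq_card_independent)
  then show ?thesis unfolding proj_subspace_def by (simp add: insert_commute vec.subspace_span)
qed

lemma frame_proj_plane:
  fixes x u v y :: "'a::field ^ 'n"
  assumes "frame Z \<xi> x u v y" shows "proj_subspace 2 (vec.span {x, u, v})"
proof -
  note i = frame_indep[OF assms]
  have x: "x \<noteq> 0" by (rule frame_vertices(9)[OF assms])
  have "u \<notin> vec.span {x}" unfolding vec.span_singleton
  proof
    assume "u \<in> range (\<lambda>k. k *s x)"
    then obtain k where "u = k *s x" by blast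
    then have "(- k) *s x + 1 *s u + 0 *s v + 0 *s y = 0" by (simp add: vec_eq_iff)
    from i[OF this] show False by simp
  qed
  then have 2: "vec.independent {u, x}" "u \<noteq> x"
    using x vec.independent_insertI[of u "{x}"] vec.span_base[of x "{x}"] by auto
  have n: "v \<notin> vec.span {u, x}"
  proof
    assume "v \<in> vec.span {u, x}"
    then obtain b a where "v = b *s u + a *s x" unfolding span_pair_iff by blast
    then have "(- a) *s x + (- b) *s u + 1 *s v + 0 *s y = 0" by (simp add: vec_eq_iff)
    from i[OF this] show False by simp
  qed
  have "vec.independent {v, u, x}" by (rule vec.independent_insertI[OF n 2(1)])
  moreover have "v \<noteq> u" "v \<noteq> x" using n vec.span_base[of _ "{u, x}"] by blast+
  then have "card {v, u, x} = 3" using 2(2) by simp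
  ultimately have "vec.dim {v, u, x} = 3" by (simp add: vec.dim_eq_card_independent)
  moreover have "{v, u, x} = {x, u, v}" by blast
  ultimately show ?thesis unfolding proj_subspace_def by (simp add: vec.subspace_span)
qed

lemma proj_subspace_eq:
  assumes "proj_subspace d S" "proj_subspace d T" "S \<subseteq> T" shows "S = T"
  using vec.subspace_dim_equal[of S T] assms unfolding proj_subspace_def by simp

lemma Union_points_iff:
  assumes "X \<subseteq> points UNIV" "w \<noteq> 0" shows "w \<in> \<Union>X \<longleftrightarrow> vec.span {w} \<in> X"
proof
  assume "w \<in> \<Union>X"
  then obtain p where p: "p \<in> X" "w \<in> p" by blast
  then have "proj_subspace 0 p" using assms(1) unfolding points_def by blast
  from proj_point_span[OF this p(2) assms(2)] p(1) show "vec.span {w} \<in> X" by simp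
qed (use vec.span_base[of w "{w}"] in blast)

lemma line_in_hypo:
  assumes X: "X \<subseteq> points UNIV" "0 \<in> \<Union>X" "0 \<in> \<xi>" and L: "proj_subspace 1 L" "points L \<subseteq> points \<xi> \<inter> X"
  shows "L \<subseteq> \<xi> \<inter> \<Union>X"
proof
  fix w assume w: "w \<in> L"
  show "w \<in> \<xi> \<inter> \<Union>X"
  proof (cases "w = 0")
    case False
    have "vec.span {w} \<in> points L" by (rule span_points[OF _ w False]) (use L(1) proj_subspace_def in blast)
    then have p: "vec.span {w} \<in> points \<xi>" "vec.span {w} \<in> X" using L(2) by blast+
    then have "w \<in> \<xi>" using vec.span_base[of w "{w}"] unfolding points_def by blast
    with p(2) Union_points_iff[OF X(1) False] show ?thesis by blast
  qed (use X in simp)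
qed

text \<open>The line contained in the hypo is a singular subspace of dimension 2, from which a
  hyperbolic basis is built. Homogeneity of \<open>q\<close> makes membership of a vector in
  \<open>\<Union>X\<close> equivalent to \<open>q w = 0\<close>.\<close>

lemma hypo_frame:
  fixes \<xi> :: "('a::field ^ 'n) set"
  assumes X: "X \<subseteq> points UNIV" "0 \<in> \<Union>X" and h: "hypo \<xi> (points \<xi> \<inter> X)"
  shows "\<exists>x u v y. frame (\<Union>X) \<xi> x u v y"
proof -
  from h obtain q L where xi: "proj_subspace 3 \<xi>" and q: "quadratic_form_on \<xi> q" "nondegenerate_on \<xi> q"
    and H: "points \<xi> \<inter> X = quadric \<xi> q" and L: "proj_subspace 1 L" "points L \<subseteq> points \<xi> \<inter> X"
    unfolding hypo_def by blast
  have sub: "vec.subspace \<xi>" and d: "vec.dim \<xi> = 4" using xi unfolding proj_subspace_def by auto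
  interpret quadratic \<xi> q by unfold_locales (rule sub q)+
  have Zq: "w \<in> \<Union>X \<longleftrightarrow> q w = 0" if w: "w \<in> \<xi>" for w
  proof (cases "w = 0")
    case False
    have p: "vec.span {w} \<in> points \<xi>" by (rule span_points[OF sub w False])
    have "w \<in> \<Union>X \<longleftrightarrow> vec.span {w} \<in> quadric \<xi> q" unfolding Union_points_iff[OF X(1) False] H[symmetric] using p by blast
    also have "\<dots> \<longleftrightarrow> (\<forall>v\<in>vec.span {w}. q v = 0)" unfolding quadric_def using p by blast
    also have "\<dots> \<longleftrightarrow> q w = 0"
    proof
      assume "\<forall>v\<in>vec.span {w}. q v = 0"
      then show "q w = 0" using vec.span_base[of w "{w}"] by blast
    qed (auto simp: vec.span_singleton q_scale[OF w])
    finally show ?thesis .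
  qed (use X(2) q_zero in simp)
  have L': "L \<subseteq> \<xi> \<inter> \<Union>X" by (rule line_in_hypo[OF X vec.subspace_0[OF sub] L])
  have Ls: "vec.subspace L" "vec.dim L = 2" using L(1) unfolding proj_subspace_def by auto
  from vec.basis_exists[of L] obtain B where
    B: "B \<subseteq> L" "vec.independent B" "L \<subseteq> vec.span B" "card B = vec.dim L" by blast
  then obtain e1 e2 where e: "B = {e1, e2}" "e1 \<noteq> e2" unfolding Ls card_2_iff by blast
  have eL: "e1 \<in> L" "e2 \<in> L" using B(1) e(1) by auto
  have mem: "e1 \<in> \<xi>" "e2 \<in> \<xi>" using eL L' by blast+
  have sing: "q (a *s e1 + b *s e2) = 0" for a b
  proof -
    have "a *s e1 + b *s e2 \<in> L" by (intro vec.subspace_add[OF Ls(1)] vec.subspace_scale[OF Ls(1)] eL)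
    with L' Zq show ?thesis by blast
  qed
  have ind: "a = 0 \<and> b = 0" if "a *s e1 + b *s e2 = 0" for a b
  proof -
    have s: "(\<Sum>v\<in>B. (if v = e1 then a else b) *s v) = 0" using that e by simp
    have fin: "finite B" using e(1) by simp
    note z = vec.independentD[OF B(2) fin subset_refl s]
    show ?thesis using z[of e1] z[of e2] e by simp
  qed
  from hyperbolic_basis[OF d q(2) mem sing ind] obtain x u v y where
    b: "\<And>a b c d. a *s x + b *s u + c *s v + d *s y = 0 \<Longrightarrow> a = 0 \<and> b = 0 \<and> c = 0 \<and> d = 0"
    "\<And>w. w \<in> \<xi> \<Longrightarrow> \<exists>a b c d. w = a *s x + b *s u + c *s v + d *s y"
    "\<And>a b c d. a *s x + b *s u + c *s v + d *s y \<in> \<xi>"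
    "\<And>a b c d. q (a *s x + b *s u + c *s v + d *s y) = a * d - b * c" by metis
  have "frame (\<Union>X) \<xi> x u v y"
    by (rule frameI[OF b(1-3)]) (simp_all only: Zq[OF b(3)] b(4) right_minus_eq)
  then show ?thesis by blast
qed

text \<open>Evaluates the definite description: the only lines of the quadric through
  \<open>x\<close> are \<open>x u\<close> and \<open>x v\<close>, so any plane meeting it in two
  lines through \<open>x\<close> contains both.\<close>

lemma tangent_plane_frame:
  fixes x u v y :: "'a::field ^ 'n"
  assumes X: "X \<subseteq> points UNIV" and xi: "vec.subspace \<xi>" and f: "frame (\<Union>X) \<xi> x u v y"
  shows "tangent_plane (points \<xi> \<inter> X) (vec.span {x}) = vec.span {x, u, v}"
proof -
  note fv = frame_vertices[OF f]
  let ?H = "points \<xi> \<inter> X" and ?L = "vec.span {x, u}" and ?M = "vec.span {x, v}" and ?T = "vec.span {x, u, v}"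
  have lines: "proj_subspace 1 ?L" "proj_subspace 1 ?M" using frame_proj_line[OF f] frame_proj_line[OF frame_swap[OF f]] .
  have T: "proj_subspace 2 ?T" by (rule frame_proj_plane[OF f])
  have Z0: "0 \<in> \<Union>X" using coll_D[OF fv(13), of 0 0] by simp
  have xT: "vec.span {x} \<subseteq> ?T" "vec.span {x} \<subseteq> ?L" "vec.span {x} \<subseteq> ?M" by (rule vec.span_mono, blast)+
  have LT: "?L \<subseteq> ?T" "?M \<subseteq> ?T" by (rule vec.span_mono, blast)+
  have Txi: "?T \<subseteq> \<xi>" by (rule vec.span_minimal[OF _ xi]) (use fv in blast)
  have LZ: "?L \<subseteq> \<Union>X" "?M \<subseteq> \<Union>X"
  proof -
    show "?L \<subseteq> \<Union>X"
    proof
      fix w assume "w \<in> ?L"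
      then obtain a b where w: "w = a *s x + b *s u" unfolding span_pair_iff by blast
      show "w \<in> \<Union>X" unfolding w by (rule coll_D[OF fv(13)])
    qed
    show "?M \<subseteq> \<Union>X"
    proof
      fix w assume "w \<in> ?M"
      then obtain a b where w: "w = a *s x + b *s v" unfolding span_pair_iff by blast
      show "w \<in> \<Union>X" unfolding w by (rule coll_D[OF fv(14)])
    qed
  qed
  have uM: "u \<notin> ?M"
  proof
    assume "u \<in> ?M"
    then obtain a b where "u = a *s x + b *s v" unfolding span_pair_iff by blast
    then have "(- a) *s x + 1 *s u + (- b) *s v + 0 *s y = 0" by (simp add: vec_eq_iff)
    from frame_indep[OF f this] show False by simp
  qed
  have LM: "?L \<noteq> ?M" using uM vec.span_base[of u "{x, u}"] by blast
  have subp: "points S \<subseteq> ?H" if "S \<subseteq> ?T" "S \<subseteq> \<Union>X" for S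
  proof
    fix p assume p: "p \<in> points S"
    then have "proj_subspace 0 p" "p \<subseteq> S" unfolding points_def by blast+
    from proj_point_ex[OF this(1)] obtain w where w: "w \<in> p" "w \<noteq> 0" "p = vec.span {w}" .
    have "w \<in> \<Union>X" using w(1) \<open>p \<subseteq> S\<close> that(2) by blast
    then have "p \<in> X" using Union_points_iff[OF X w(2)] w(3) by simp
    moreover have "p \<in> points \<xi>" using p that(1) Txi unfolding points_def by blast
    ultimately show "p \<in> ?H" by blast
  qed
  have pts: "points ?T \<inter> ?H = points ?L \<union> points ?M"
  proof (intro subset_antisym subsetI)
    fix p assume p: "p \<in> points ?T \<inter> ?H"
    then have pp: "proj_subspace 0 p" "p \<subseteq> ?T" "p \<in> X" unfolding points_def by blast+
    from proj_point_ex[OF pp(1)] obtain w where w: "w \<in> p" "w \<noteq> 0" "p = vec.span {w}" .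
    have wZ: "w \<in> \<Union>X" using w(1) pp(3) by blast
    have "w \<in> ?T" using w(1) pp(2) by blast
    then obtain a b c where e: "w = a *s x + b *s u + c *s v" unfolding span_triple_iff by blast
    then have "w = a *s x + b *s u + c *s v + 0 *s y" by simp
    with wZ frame_Z[OF f, of a b c 0] have "b = 0 \<or> c = 0" by simp
    then have "w = a *s x + b *s u \<or> w = a *s x + c *s v" using e by (elim disjE) simp_all
    then have "w \<in> ?L \<or> w \<in> ?M" unfolding span_pair_iff by blast
    then show "p \<in> points ?L \<union> points ?M"
      using span_points[OF vec.subspace_span _ w(2)] w(3) by blast
  next
    fix p assume p: "p \<in> points ?L \<union> points ?M"
    then have "p \<in> points ?T" using LT unfolding points_def by blast
    with p subp[OF LT(1) LZ(1)] subp[OF LT(2) LZ(2)] show "p \<in> points ?T \<inter> ?H" by blast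
  qed
  have uniq: "S = ?L \<or> S = ?M" if S: "proj_subspace 1 S" "vec.span {x} \<subseteq> S" "points S \<subseteq> ?H" for S
  proof -
    have SZ: "S \<subseteq> \<xi> \<inter> \<Union>X" by (rule line_in_hypo[OF X Z0 vec.subspace_0[OF xi] S(1,3)])
    have Ss: "vec.subspace S" "vec.dim S = 2" using S(1) unfolding proj_subspace_def by auto
    have xS: "x \<in> S" using S(2) vec.span_base[of x "{x}"] by blast
    have "\<not> S \<subseteq> vec.span {x}"
    proof
      assume "S \<subseteq> vec.span {x}"
      from vec.dim_le_card[OF this] Ss(2) show False by simp
    qed
    then obtain w where w: "w \<in> S" "w \<notin> vec.span {x}" by blast
    have c: "coll (\<Union>X) x w" unfolding coll_def
      using SZ vec.subspace_add[OF Ss(1) vec.subspace_scale[OF Ss(1) xS] vec.subspace_scale[OF Ss(1) w(1)]] by blast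
    have wxi: "w \<in> \<xi>" using w(1) SZ by blast
    from frame_ex[OF f wxi] obtain a b cc d where e: "w = a *s x + b *s u + cc *s v + d *s y" .
    have z: "a * d = b * cc" using coll_right[OF c] frame_Z[OF f] unfolding e by simp
    have "d = 0" using frame_first_coll[OF f z] c unfolding e by blast
    with z have "b = 0 \<or> cc = 0" by simp
    then show ?thesis
    proof
      assume "b = 0"
      with e \<open>d = 0\<close> have w': "w = a *s x + cc *s v" by simp
      have c0: "cc \<noteq> 0"
      proof
        assume "cc = 0"
        with w' have "w = a *s x" by simp
        with w(2) show False unfolding vec.span_singleton by blast
      qed
      have "v = (- a / cc) *s x + (1 / cc) *s w" by (rule solve_second[OF w' c0])
      then have "v \<in> S" using vec.subspace_add[OF Ss(1) vec.subspace_scale[OF Ss(1) xS] vec.subspace_scale[OF Ss(1) w(1)]] by metis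
      then have "?M \<subseteq> S" using vec.span_minimal[OF _ Ss(1), of "{x, v}"] xS by blast
      from proj_subspace_eq[OF lines(2) S(1) this] show ?thesis by simp
    next
      assume "cc = 0"
      with e \<open>d = 0\<close> have w': "w = a *s x + b *s u" by simp
      have c0: "b \<noteq> 0"
      proof
        assume "b = 0"
        with w' have "w = a *s x" by simp
        with w(2) show False unfolding vec.span_singleton by blast
      qed
      have "u = (- a / b) *s x + (1 / b) *s w" by (rule solve_second[OF w' c0])
      then have "u \<in> S" using vec.subspace_add[OF Ss(1) vec.subspace_scale[OF Ss(1) xS] vec.subspace_scale[OF Ss(1) w(1)]] by metis
      then have "?L \<subseteq> S" using vec.span_minimal[OF _ Ss(1), of "{x, u}"] xS by blast
      from proj_subspace_eq[OF lines(1) S(1) this] show ?thesis by simp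
    qed
  qed
  show ?thesis unfolding tangent_plane_def
  proof (rule the_equality)
    show "proj_subspace 2 ?T \<and> vec.span {x} \<subseteq> ?T \<and> (\<exists>L M. proj_subspace 1 L \<and> proj_subspace 1 M \<and> L \<noteq> M \<and>
        vec.span {x} \<subseteq> L \<and> vec.span {x} \<subseteq> M \<and> points ?T \<inter> ?H = points L \<union> points M)"
      using T xT lines LM pts by blast
  next
    fix T' assume "proj_subspace 2 T' \<and> vec.span {x} \<subseteq> T' \<and> (\<exists>L M. proj_subspace 1 L \<and> proj_subspace 1 M \<and> L \<noteq> M \<and>
        vec.span {x} \<subseteq> L \<and> vec.span {x} \<subseteq> M \<and> points T' \<inter> ?H = points L \<union> points M)"
    then obtain L M where T': "proj_subspace 2 T'" and L: "proj_subspace 1 L" "vec.span {x} \<subseteq> L"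
      and M: "proj_subspace 1 M" "vec.span {x} \<subseteq> M" and ne: "L \<noteq> M" and p: "points T' \<inter> ?H = points L \<union> points M" by blast
    have "points L \<subseteq> ?H" "points M \<subseteq> ?H" using p by blast+
    with uniq[OF L] uniq[OF M] ne have LM': "L = ?L \<and> M = ?M \<or> L = ?M \<and> M = ?L" by blast
    have sub: "S \<subseteq> T'" if S: "S \<in> {L, M}" for S
    proof
      fix w assume w: "w \<in> S"
      have Ss: "vec.subspace S" using S L(1) M(1) unfolding proj_subspace_def by blast
      show "w \<in> T'"
      proof (cases "w = 0")
        case True
        then show ?thesis using T' vec.subspace_0 unfolding proj_subspace_def by blast
      next
        case False
        have "vec.span {w} \<in> points L \<union> points M" using span_points[OF Ss w False] S by blast
        then have "vec.span {w} \<subseteq> T'" using p unfolding points_def by blast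
        then show ?thesis using vec.span_base[of w "{w}"] by blast
      qed
    qed
    have "?L \<subseteq> T'" "?M \<subseteq> T'" using LM' sub[of L] sub[of M] by auto
    moreover have "x \<in> ?L" "u \<in> ?L" "v \<in> ?M" by (rule vec.span_base, simp)+
    ultimately have "{x, u, v} \<subseteq> T'" by blast
    from vec.span_minimal[OF this] have "?T \<subseteq> T'" using T' unfolding proj_subspace_def by blast
    from proj_subspace_eq[OF T T' this] show "T' = ?T" by simp
  qed
qed

section \<open>From the axioms to the classification\<close>

lemma segrean_grid_cone:
  fixes X \<Xi> :: "('a::field ^ 'n) set set"
  assumes sv: "segrean_veronesean_set X \<Xi>" and Z0: "0 \<in> \<Union>X"
  shows "grid_cone (\<Union>X) \<Xi>"
proof -
  let ?Z = "\<Union>X"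
  have X: "X \<subseteq> points UNIV" and "\<forall>\<xi>\<in>\<Xi>. hypo \<xi> (points \<xi> \<inter> X)"
    and S1: "\<forall>x\<in>X. \<forall>y\<in>X. \<exists>\<xi>\<in>\<Xi>. x \<subseteq> \<xi> \<and> y \<subseteq> \<xi>"
    and "\<forall>\<xi>\<in>\<Xi>. \<forall>\<xi>'\<in>\<Xi>. \<xi> \<noteq> \<xi>' \<longrightarrow> points (\<xi> \<inter> \<xi>') \<subseteq> X"
    and S3: "\<forall>x\<in>X. \<exists>S. proj_subspace 4 S \<and> (\<forall>\<xi>\<in>\<Xi>. x \<subseteq> \<xi> \<longrightarrow> tangent_plane (points \<xi> \<inter> X) x \<subseteq> S)"
    using sv unfolding segrean_veronesean_set_def by - (elim conjE, assumption)+
  then have hyp: "\<And>\<xi>. \<xi> \<in> \<Xi> \<Longrightarrow> hypo \<xi> (points \<xi> \<inter> X)"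
    and S2: "\<And>\<xi> \<xi>'. \<xi> \<in> \<Xi> \<Longrightarrow> \<xi>' \<in> \<Xi> \<Longrightarrow> \<xi> \<noteq> \<xi>' \<Longrightarrow> points (\<xi> \<inter> \<xi>') \<subseteq> X" by simp_all
  have sub: "vec.subspace \<xi>" if "\<xi> \<in> \<Xi>" for \<xi> using hyp[OF that] unfolding hypo_def proj_subspace_def by blast
  interpret hyperbolic_cone ?Z \<Xi>
  proof unfold_locales
    show "\<exists>x u v y. frame ?Z \<xi> x u v y" if "\<xi> \<in> \<Xi>" for \<xi> by (rule hypo_frame[OF X Z0 hyp[OF that]])
    show "\<exists>\<xi>\<in>\<Xi>. x \<in> \<xi> \<and> y \<in> \<xi>" if "x \<in> ?Z" "y \<in> ?Z" for x y
    proof -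
      from that obtain p r where "p \<in> X" "x \<in> p" "r \<in> X" "y \<in> r" by blast
      moreover from S1 this have "\<exists>\<xi>\<in>\<Xi>. p \<subseteq> \<xi> \<and> r \<subseteq> \<xi>" by simp
      ultimately show ?thesis by blast
    qed
    show "w \<in> ?Z" if "\<xi> \<in> \<Xi>" "\<xi>' \<in> \<Xi>" "\<xi> \<noteq> \<xi>'" "w \<in> \<xi>" "w \<in> \<xi>'" for \<xi> \<xi>' w
    proof (cases "w = 0")
      case False
      have "vec.span {w} \<in> points (\<xi> \<inter> \<xi>')"
        by (rule span_points[OF vec.subspace_inter[OF sub sub] _ False]) (use that in blast)+
      then have "vec.span {w} \<in> X" using S2[OF that(1-3)] by blast
      then show ?thesis using vec.span_base[of w "{w}"] by blast
    qed (use Z0 in simp)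
  qed
  show ?thesis
  proof unfold_locales
    show "\<exists>S. vec.subspace S \<and> vec.dim S \<le> 5 \<and> (\<forall>u. coll ?Z x u \<longrightarrow> u \<in> S)" if x: "x \<in> ?Z" "x \<noteq> 0" for x
    proof -
      have "vec.span {x} \<in> X" using Union_points_iff[OF X x(2)] x(1) by blast
      from bspec[OF S3 this] obtain S where S: "proj_subspace 4 S"
        "\<And>\<xi>. \<xi> \<in> \<Xi> \<Longrightarrow> vec.span {x} \<subseteq> \<xi> \<Longrightarrow> tangent_plane (points \<xi> \<inter> X) (vec.span {x}) \<subseteq> S" by blast
      \<comment> \<open>A neighbour \<open>u\<close> of \<open>x\<close> lies with \<open>x\<close>
        in some \<open>\<xi>\<close>, on one of its two lines through \<open>x\<close>, hence in the
        tangent plane of \<open>\<xi>\<close> at \<open>x\<close>.\<close>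
      have "u \<in> S" if c: "coll ?Z x u" for u
      proof -
        from join[OF coll_left[OF c] coll_right[OF c]] obtain \<xi> where xi: "\<xi> \<in> \<Xi>" "x \<in> \<xi>" "u \<in> \<xi>" by blast
        from frame_at[OF xi(1) x(1) xi(2) x(2)] obtain a b d where f: "frame ?Z \<xi> x a b d" .
        have "vec.span {x} \<subseteq> \<xi>" by (rule vec.span_minimal[OF _ sub[OF xi(1)]]) (use xi(2) in blast)
        from S(2)[OF xi(1) this] have T: "vec.span {x, a, b} \<subseteq> S" unfolding tangent_plane_frame[OF X sub[OF xi(1)] f] .
        have "u \<in> vec.span {x, a, b}"
        proof (rule frame_nbr[OF f xi(3) c])
          fix p r assume u: "u = p *s x + r *s a"
          show ?thesis unfolding u by (intro vec.span_add vec.span_scale vec.span_base) auto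
        next
          fix p r assume u: "u = p *s x + r *s b"
          show ?thesis unfolding u by (intro vec.span_add vec.span_scale vec.span_base) auto
        qed
        with T show ?thesis by blast
      qed
      with S(1) show ?thesis unfolding proj_subspace_def by (intro exI[of _ S]) auto
    qed
  qed
qed

lemma (in two_cone) segre_variety:
  assumes X: "X \<subseteq> points UNIV" "Z = \<Union>X" and sp: "vec.span Z = UNIV"
    and d: "vec.dim A = CARD('m::finite)" "vec.dim B = CARD('k::finite)" and m: "CARD('m) = 2 \<or> CARD('m) = 3"
  shows "is_segre_variety TYPE('m) TYPE('k) X" and "CARD('n) = CARD('m) * CARD('k)"
proof -
  from segre_param[OF sp d m] obtain f :: "'a ^ ('m \<times> 'k) \<Rightarrow> 'a ^ 'n" where
    lin: "Vector_Spaces.linear (*s) (*s) f" and bij: "bij f" and Z: "Z = {f (segre_map s t) | s t. True}" by blast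
  have f0: "f 0 = 0" using lin unfolding Vector_Spaces.linear_iff by (metis vec.scale_zero_left)
  have inj: "inj f" and surj: "range f = UNIV" using bij unfolding bij_def by auto
  have fs: "f ` vec.span {w} = vec.span {f w}" for w using vec.linear_span_image[OF lin, of "{w}"] by simp
  have nz: "segre_map s t = 0 \<longleftrightarrow> s = 0 \<or> t = 0" for s :: "'a ^ 'm" and t :: "'a ^ 'k"
    unfolding segre_map_def by (auto simp: vec_eq_iff)
  have "X = (\<lambda>p. f ` p) ` standard_segre"
  proof (intro subset_antisym subsetI)
    fix p assume p: "p \<in> X"
    then have "proj_subspace 0 p" using X(1) unfolding points_def by blast
    from proj_point_ex[OF this] obtain v where v: "v \<in> p" "v \<noteq> 0" "p = vec.span {v}" .
    then have "v \<in> Z" using p X(2) by blast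
    then obtain s t where st: "v = f (segre_map s t)" unfolding Z by blast
    then have "s \<noteq> 0 \<and> t \<noteq> 0" using v(2) f0 nz by metis
    then have "vec.span {segre_map s t} \<in> standard_segre" unfolding standard_segre_def by blast
    then show "p \<in> (\<lambda>p. f ` p) ` standard_segre" using v(3) fs st by blast
  next
    fix p assume "p \<in> (\<lambda>p. f ` p) ` (standard_segre :: ('a ^ ('m \<times> 'k)) set set)"
    then obtain s :: "'a ^ 'm" and t :: "'a ^ 'k" where st: "s \<noteq> 0" "t \<noteq> 0" "p = f ` vec.span {segre_map s t}"
      unfolding standard_segre_def by blast
    have n: "f (segre_map s t) \<noteq> 0" using st(1,2) nz f0 injD[OF inj] by metis
    have "f (segre_map s t) \<in> \<Union>X" using Z X(2) by blast
    with Union_points_iff[OF X(1) n] show "p \<in> X" unfolding st(3) fs by blast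
  qed
  with lin bij show "is_segre_variety TYPE('m) TYPE('k) X" unfolding is_segre_variety_def by blast
  have "vec.dim (range f) = vec.dim (UNIV :: ('a ^ ('m \<times> 'k)) set)"
    by (rule vec.dim_image_eq[OF lin]) (use inj in simp)
  then show "CARD('n) = CARD('m) * CARD('k)" unfolding surj vec_dim_card by simp
qed

theorem theorem2p1:
  fixes X \<Xi> :: "('a::field ^ 'n::finite) set set" and N :: nat
  assumes "CARD('n) = N + 1"
    and "N > 3"
    and "segrean_veronesean_set X \<Xi>"
  shows "is_segre_variety TYPE(2) TYPE(3) X \<and> N = 5 \<or>
         is_segre_variety TYPE(2) TYPE(4) X \<and> N = 7 \<or>
         is_segre_variety TYPE(3) TYPE(3) X \<and> N = 8"
proof -
  have X: "X \<subseteq> points UNIV" and sp: "vec.span (\<Union>X) = UNIV"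
    using assms(3) unfolding segrean_veronesean_set_def by - (elim conjE, assumption)+
  have "X \<noteq> {}"
  proof
    assume "X = {}"
    with sp have "(UNIV :: ('a ^ 'n) set) = {0}" by simp
    then have "vec.dim (UNIV :: ('a ^ 'n) set) = 0" using vec.dim_eq_0 by blast
    then show False unfolding vec_dim_card by simp
  qed
  then obtain p where p: "p \<in> X" by blast
  with X have pp: "proj_subspace 0 p" unfolding points_def by blast
  from proj_point_ex[OF pp] obtain x where x: "x \<in> p" "x \<noteq> 0" by blast
  have Z0: "0 \<in> \<Union>X" using p vec.subspace_0 pp unfolding proj_subspace_def by blast
  interpret grid_cone "\<Union>X" \<Xi> by (rule segrean_grid_cone[OF assms(3) Z0])
  have xZ: "x \<in> \<Union>X" using p x(1) by blast
  from two_cone_exists[OF sp xZ x(2)] obtain A B where c: "two_cone (\<Union>X) \<Xi> x A B" "2 \<le> vec.dim A" "2 \<le> vec.dim B" .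
  note V = two_cone.segre_variety[OF c(1) X refl sp]
  note W = two_cone.segre_variety[OF two_cone.swapped[OF c(1)] X refl sp]
  have cases: "(a = 2 \<or> a = 3 \<or> a = 4) \<and> (a = 2 \<longrightarrow> b = 2 \<or> b = 3 \<or> b = 4) \<and> (a = 3 \<longrightarrow> b = 2 \<or> b = 3) \<and> (a = 4 \<longrightarrow> b = 2)"
    if "2 \<le> a" "2 \<le> b" "a + b \<le> 6" for a b :: nat using that by arith
  from cases[OF c(2,3) two_cone.dims[OF c(1)]] consider "vec.dim A = 2" "vec.dim B = 2" | "vec.dim A = 2" "vec.dim B = 3" | "vec.dim A = 2" "vec.dim B = 4"
    | "vec.dim A = 3" "vec.dim B = 2" | "vec.dim A = 4" "vec.dim B = 2" | "vec.dim A = 3" "vec.dim B = 3" by blast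
  then show ?thesis
  proof cases
    \<comment> \<open>Here the dimension would be 2 times 2, that is \<open>N = 3\<close>, against
      \<open>N > 3\<close>.\<close>
    case 1
    with V[where 'm=2 and 'k=2] assms(1,2) show ?thesis by simp
  next
    case 2
    with V[where 'm=2 and 'k=3] assms(1) show ?thesis by simp
  next
    case 3
    with V[where 'm=2 and 'k=4] assms(1) show ?thesis by simp
  next
    \<comment> \<open>The larger class comes first; exchanging the roles of \<open>A\<close> and
      \<open>B\<close> puts the factor of dimension 2 in front.\<close>
    case 4
    with W[where 'm=2 and 'k=3] assms(1) show ?thesis by simp
  next
    case 5
    with W[where 'm=2 and 'k=4] assms(1) show ?thesis by simp
  next
    case 6
    with V[where 'm=3 and 'k=3] assms(1) show ?thesis by simp
  qed
qed

end
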